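(* Let $n\ge2$ be even and $l\ge3$ odd, and let $N=n/2$. The sum, over all vertically symmetric $(n,l)$-alternating sign trapezoids, of the product of $P$-weight and $Q$-weight equals the constant term in $x_1,\dots,x_N$ of $$\frac{1}{N!}\prod_{r=1}^{N}\frac{Q+(Q-P)x_r}{x_r^{n-2}(1+x_r)^{\frac{l-5}{2}+\frac n2}\left(Q(1+x_r)^2-x_r^2\right)}\prod_{1\le s<t\le N}\frac{(x_t-x_s)^2(x_s+x_t+x_sx_t)(Q+(Q-1)x_s+(Q-1)x_t+(Q-2)x_sx_t)(Q-x_sx_t)}{Q(1+x_s)(1+x_t)-x_sx_t}.$$
   Context: The expression is regarded as a formal Laurent series in $x_1,\dots,x_N$: apart from the monomials $x_r^{n-2}$, all factors in denominators have nonzero constant term (as polynomials in $x$ with coefficients in $\mathbb Q(P,Q)$) and are expanded as formal power series; the constant term is the coefficient of $x_1^0\cdots x_N^0$. An $(n,l)$-alternating sign trapezoid is an array $(a_{i,j})$ with entries in $\{-1,0,1\}$, indexed by $1\le i\le n$, $i\le j\le 2n+l-1-i$ (rows centred; column $j$, $1\le j\le 2n+l-2$, consists of the existing $a_{i,j}$), such that: nonzero entries alternate in sign along each row and each column; the topmost nonzero entry of each column (if any) is $1$; each row sums to $1$; the entries in the central $l-2$ columns (columns $n+1,\dots,n+l-2$) sum to $0$. It is vertically symmetric if $a_{i,j}=a_{i,2n+l-1-j}$. A $1$-column is a column with sum $1$; it is a $10$-column if its bottom entry (entry in the lowest row meeting the column) is $0$. The $Q$-weight is $Q$ raised to the number of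 entries $-1$ in the $n-1+(l-1)/2$ leftmost columns; the $P$-weight is $P$ raised to the number of $10$-columns among the $n-1$ leftmost columns. *)

theory Defs
  imports
    "HOL-Library.FuncSet"
    "HOL-Library.Poly_Mapping"
    "HOL-Computational_Algebra.Polynomial"
    "HOL-Computational_Algebra.Fraction_Field"
begin

section \<open>Formal Laurent series in several variables\<close>

text \<open>
  An exponent is a finitely supported map from variables to integers.  A formal Laurent series is
  a coefficient function whose support is bounded below, componentwise, by a single exponent;
  with this condition every coefficient of a product is a finite sum.  The library order on
  \<^typ>\<open>'a \<Rightarrow>\<^sub>0 'b\<close> is lexicographic, so the componentwise one is introduced here.
\<close>

definition exp_le :: "('v \<Rightarrow>\<^sub>0 int) \<Rightarrow> ('v \<Rightarrow>\<^sub>0 int) \<Rightarrow> bool" where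
  "exp_le a b \<longleftrightarrow> (\<forall>v. Poly_Mapping.lookup a v \<le> Poly_Mapping.lookup b v)"

typedef (overloaded) ('v, 'a) mfls =
  "{f :: ('v \<Rightarrow>\<^sub>0 int) \<Rightarrow> 'a::zero. \<exists>m. \<forall>e. f e \<noteq> 0 \<longrightarrow> exp_le m e}"
  morphisms mfls_nth Abs_mfls
  by (rule exI[of _ "\<lambda>_. 0"]) simp

setup_lifting type_definition_mfls

lemma mfls_eqI: "(\<And>e. mfls_nth f e = mfls_nth g e) \<Longrightarrow> f = g"
  by (simp add: mfls_nth_inject[symmetric] fun_eq_iff)

lemma mfls_bound: obtains m where "\<And>e. mfls_nth f e \<noteq> 0 \<Longrightarrow> exp_le m e"
  using mfls_nth[of f] by auto

lemma exp_le_refl [simp]: "exp_le a a"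
  by (simp add: exp_le_def)

lemma exp_le_trans: "exp_le a b \<Longrightarrow> exp_le b c \<Longrightarrow> exp_le a c"
  unfolding exp_le_def by (meson order_trans)

lemma exp_le_lower_bound: "\<exists>m. exp_le m a \<and> exp_le m b"
proof -
  let ?f = "\<lambda>v. min (Poly_Mapping.lookup a v) (Poly_Mapping.lookup b v)"
  have "{v. ?f v \<noteq> 0} \<subseteq> Poly_Mapping.keys a \<union> Poly_Mapping.keys b"
    by (auto simp: in_keys_iff min_def split: if_splits)
  then have "finite {v. ?f v \<noteq> 0}"
    by (meson finite_UnI finite_keys finite_subset)
  then have "Poly_Mapping.lookup (Abs_poly_mapping ?f) = ?f"
    by (simp add: Abs_poly_mapping_inverse)
  then have "exp_le (Abs_poly_mapping ?f) a \<and> exp_le (Abs_poly_mapping ?f) b"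
    by (simp add: exp_le_def)
  then show ?thesis ..
qed

lemma finite_exp_box:
  fixes m k :: "'a \<Rightarrow>\<^sub>0 int"
  shows "finite {a. exp_le m a \<and> exp_le a k}" (is "finite ?B")
proof -
  let ?K = "Poly_Mapping.keys m \<union> Poly_Mapping.keys k"
  let ?r = "\<lambda>a :: 'a \<Rightarrow>\<^sub>0 int. restrict (Poly_Mapping.lookup a) ?K"
  have zero: "Poly_Mapping.lookup a v = 0" if "a \<in> ?B" "v \<notin> ?K" for a v
  proof -
    have "Poly_Mapping.lookup m v \<le> Poly_Mapping.lookup a v"
      and "Poly_Mapping.lookup a v \<le> Poly_Mapping.lookup k v"
      using that(1) by (auto simp: exp_le_def)
    with that(2) show ?thesis
      by (simp add: in_keys_iff)
  qed
  have "inj_on ?r ?B"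
  proof (rule inj_onI)
    fix a b assume ab: "a \<in> ?B" "b \<in> ?B" "?r a = ?r b"
    have "Poly_Mapping.lookup a v = Poly_Mapping.lookup b v" for v
      using zero[OF ab(1), of v] zero[OF ab(2), of v] fun_cong[OF ab(3), of v]
      by (cases "v \<in> ?K") auto
    then show "a = b"
      by (simp add: poly_mapping_eqI)
  qed
  moreover have "?r ` ?B \<subseteq> (\<Pi>\<^sub>E v\<in>?K. {Poly_Mapping.lookup m v..Poly_Mapping.lookup k v})"
    by (rule image_subsetI, subst restrict_PiE_iff) (auto simp: exp_le_def)
  moreover have "finite (\<Pi>\<^sub>E v\<in>?K. {Poly_Mapping.lookup m v..Poly_Mapping.lookup k v})"
    by (intro finite_PiE) auto
  ultimately show ?thesis
    by (meson finite_imageD finite_subset)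
qed

lemma finite_conv_support:
  assumes "\<And>e. f e \<noteq> 0 \<Longrightarrow> exp_le m e" and "\<And>e. g e \<noteq> 0 \<Longrightarrow> exp_le k e"
  shows "finite {a. f a \<noteq> 0 \<and> g (e - a) \<noteq> 0}"
proof (rule finite_subset[OF _ finite_exp_box[of m "e - k"]])
  show "{a. f a \<noteq> 0 \<and> g (e - a) \<noteq> 0} \<subseteq> {a. exp_le m a \<and> exp_le a (e - k)}"
  proof safe
    fix a assume "f a \<noteq> 0" "g (e - a) \<noteq> 0"
    then have "exp_le m a" "exp_le k (e - a)" using assms by auto
    then show "exp_le m a" "exp_le a (e - k)"
      by (auto simp: exp_le_def lookup_minus algebra_simps)
  qed
qed

lemma conv_nonzeroE:
  fixes f g :: "('v \<Rightarrow>\<^sub>0 int) \<Rightarrow> 'a::comm_ring_1"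
  assumes "(\<Sum>a | f a \<noteq> 0 \<and> g (e - a) \<noteq> 0. f a * g (e - a)) \<noteq> 0"
  obtains a where "f a \<noteq> 0" "g (e - a) \<noteq> 0"
  using assms by (elim sum.not_neutral_contains_not_neutral) blast

lemma exp_le_add:
  assumes "exp_le m a" "exp_le k (e - a)"
  shows "exp_le (m + k) e"
  unfolding exp_le_def
proof
  fix v
  have "Poly_Mapping.lookup m v \<le> Poly_Mapping.lookup a v"
    and "Poly_Mapping.lookup k v \<le> Poly_Mapping.lookup e v - Poly_Mapping.lookup a v"
    using assms by (auto simp: exp_le_def lookup_minus)
  then show "Poly_Mapping.lookup (m + k) v \<le> Poly_Mapping.lookup e v"
    by (simp add: lookup_add)
qed

instantiation mfls :: (type, comm_ring_1) comm_ring_1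
begin

lift_definition zero_mfls :: "('a, 'b) mfls" is "\<lambda>_. 0"
  by simp

lift_definition one_mfls :: "('a, 'b) mfls" is "\<lambda>e. if e = 0 then 1 else 0"
  by (rule exI[of _ 0]) simp

lift_definition plus_mfls :: "('a, 'b) mfls \<Rightarrow> ('a, 'b) mfls \<Rightarrow> ('a, 'b) mfls"
  is "\<lambda>f g e. f e + g e"
proof -
  fix f g :: "('a \<Rightarrow>\<^sub>0 int) \<Rightarrow> 'b"
  assume "\<exists>m. \<forall>e. f e \<noteq> 0 \<longrightarrow> exp_le m e" "\<exists>m. \<forall>e. g e \<noteq> 0 \<longrightarrow> exp_le m e"
  then obtain m k where mk: "\<forall>e. f e \<noteq> 0 \<longrightarrow> exp_le m e" "\<forall>e. g e \<noteq> 0 \<longrightarrow> exp_le k e"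
    by blast
  obtain b where b: "exp_le b m" "exp_le b k"
    using exp_le_lower_bound by blast
  have "exp_le b e" if "f e + g e \<noteq> 0" for e
    using that mk b exp_le_trans by (metis add_0)
  then show "\<exists>m. \<forall>e. f e + g e \<noteq> 0 \<longrightarrow> exp_le m e"
    by blast
qed

lift_definition uminus_mfls :: "('a, 'b) mfls \<Rightarrow> ('a, 'b) mfls" is "\<lambda>f e. - f e"
  by simp

definition minus_mfls :: "('a, 'b) mfls \<Rightarrow> ('a, 'b) mfls \<Rightarrow> ('a, 'b) mfls" where
  "minus_mfls f g = f + - g"

lift_definition times_mfls :: "('a, 'b) mfls \<Rightarrow> ('a, 'b) mfls \<Rightarrow> ('a, 'b) mfls"
  is "\<lambda>f g e. \<Sum>a | f a \<noteq> 0 \<and> g (e - a) \<noteq> 0. f a * g (e - a)"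
proof -
  fix f g :: "('a \<Rightarrow>\<^sub>0 int) \<Rightarrow> 'b"
  assume "\<exists>m. \<forall>e. f e \<noteq> 0 \<longrightarrow> exp_le m e" "\<exists>m. \<forall>e. g e \<noteq> 0 \<longrightarrow> exp_le m e"
  then obtain m k where mk: "\<forall>e. f e \<noteq> 0 \<longrightarrow> exp_le m e" "\<forall>e. g e \<noteq> 0 \<longrightarrow> exp_le k e"
    by blast
  have "exp_le (m + k) e" if nz: "(\<Sum>a | f a \<noteq> 0 \<and> g (e - a) \<noteq> 0. f a * g (e - a)) \<noteq> 0" for e
  proof -
    obtain a where "f a \<noteq> 0" "g (e - a) \<noteq> 0"
      using nz by (rule conv_nonzeroE)
    then have "exp_le m a" "exp_le k (e - a)"
      using mk by auto
    then show ?thesis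
      by (rule exp_le_add)
  qed
  then show "\<exists>m. \<forall>e. (\<Sum>a | f a \<noteq> 0 \<and> g (e - a) \<noteq> 0. f a * g (e - a)) \<noteq> 0 \<longrightarrow> exp_le m e"
    by blast
qed

lemma mfls_nth_times_superset:
  fixes f g :: "('a, 'b) mfls"
  assumes "finite S" and "\<And>a. mfls_nth f a \<noteq> 0 \<Longrightarrow> mfls_nth g (e - a) \<noteq> 0 \<Longrightarrow> a \<in> S"
  shows "mfls_nth (f * g) e = (\<Sum>a\<in>S. mfls_nth f a * mfls_nth g (e - a))"
  unfolding times_mfls.rep_eq
  by (rule sum.mono_neutral_left) (use assms in auto)

instance
proof
  fix f g h :: "('a, 'b) mfls"
  show "f + g + h = f + (g + h)" "f + g = g + f" "0 + f = f" "- f + f = 0"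
    by (rule mfls_eqI;
        simp add: plus_mfls.rep_eq zero_mfls.rep_eq uminus_mfls.rep_eq algebra_simps)+
  show "f - g = f + - g"
    by (rule minus_mfls_def)
  show "(0::('a, 'b) mfls) \<noteq> 1"
    by transfer (metis zero_neq_one)
  obtain mf where mf: "\<And>e. mfls_nth f e \<noteq> 0 \<Longrightarrow> exp_le mf e"
    using mfls_bound by blast
  obtain mg where mg: "\<And>e. mfls_nth g e \<noteq> 0 \<Longrightarrow> exp_le mg e"
    using mfls_bound by blast
  obtain mh where mh: "\<And>e. mfls_nth h e \<noteq> 0 \<Longrightarrow> exp_le mh e"
    using mfls_bound by blast
  show "1 * f = f"
  proof (rule mfls_eqI)
    fix e
    show "mfls_nth (1 * f) e = mfls_nth f e"
      by (subst mfls_nth_times_superset[of "{0}"]) (auto simp: one_mfls.rep_eq split: if_splits)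
  qed
  show "f * g = g * f"
  proof (rule mfls_eqI)
    fix e
    show "mfls_nth (f * g) e = mfls_nth (g * f) e"
      unfolding times_mfls.rep_eq
      by (rule sum.reindex_bij_witness[of _ "\<lambda>a. e - a" "\<lambda>a. e - a"]) (auto simp: mult.commute)
  qed
  show "(f + g) * h = f * h + g * h"
  proof (rule mfls_eqI)
    fix e
    let ?S = "{a. mfls_nth f a \<noteq> 0 \<and> mfls_nth h (e - a) \<noteq> 0} \<union>
              {a. mfls_nth g a \<noteq> 0 \<and> mfls_nth h (e - a) \<noteq> 0}"
    have fin: "finite ?S"
      using finite_conv_support[OF mf mh] finite_conv_support[OF mg mh] by blast
    have "mfls_nth ((f + g) * h) e = (\<Sum>a\<in>?S. mfls_nth (f + g) a * mfls_nth h (e - a))"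
      by (rule mfls_nth_times_superset[OF fin]) (auto simp: plus_mfls.rep_eq)
    also have "\<dots> = (\<Sum>a\<in>?S. mfls_nth f a * mfls_nth h (e - a)) +
                    (\<Sum>a\<in>?S. mfls_nth g a * mfls_nth h (e - a))"
      by (simp add: plus_mfls.rep_eq distrib_right sum.distrib)
    also have "(\<Sum>a\<in>?S. mfls_nth f a * mfls_nth h (e - a)) = mfls_nth (f * h) e"
      by (rule mfls_nth_times_superset[OF fin, symmetric]) auto
    also have "(\<Sum>a\<in>?S. mfls_nth g a * mfls_nth h (e - a)) = mfls_nth (g * h) e"
      by (rule mfls_nth_times_superset[OF fin, symmetric]) auto
    finally show "mfls_nth ((f + g) * h) e = mfls_nth (f * h + g * h) e"
      by (simp add: plus_mfls.rep_eq)
  qed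
  show "f * g * h = f * (g * h)"
  proof (rule mfls_eqI)
    fix e
    let ?B = "{b. exp_le (mf + mg) b \<and> exp_le b (e - mh)}"
    let ?A = "{a. exp_le mf a \<and> exp_le a (e - mh - mg)}"
    have finA: "finite ?A" and finB: "finite ?B"
      by (rule finite_exp_box)+
    have fg: "exp_le (mf + mg) b" if nz: "mfls_nth (f * g) b \<noteq> 0" for b
    proof -
      obtain a where "mfls_nth f a \<noteq> 0" "mfls_nth g (b - a) \<noteq> 0"
        using nz unfolding times_mfls.rep_eq by (rule conv_nonzeroE)
      then have "exp_le mf a" "exp_le mg (b - a)"
        using mf mg by auto
      then show ?thesis
        by (rule exp_le_add)
    qed
    have "mfls_nth (f * g * h) e = (\<Sum>b\<in>?B. mfls_nth (f * g) b * mfls_nth h (e - b))"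
    proof (rule mfls_nth_times_superset[OF finB])
      fix b assume "mfls_nth (f * g) b \<noteq> 0" "mfls_nth h (e - b) \<noteq> 0"
      then show "b \<in> ?B"
        using fg[of b] mh[of "e - b"] by (auto simp: exp_le_def lookup_minus algebra_simps)
    qed
    also have "\<dots> = (\<Sum>b\<in>?B. (\<Sum>a\<in>?A. mfls_nth f a * mfls_nth g (b - a)) * mfls_nth h (e - b))"
    proof (rule sum.cong[OF refl])
      fix b assume b: "b \<in> ?B"
      have "mfls_nth (f * g) b = (\<Sum>a\<in>?A. mfls_nth f a * mfls_nth g (b - a))"
      proof (rule mfls_nth_times_superset[OF finA])
        fix a assume "mfls_nth f a \<noteq> 0" "mfls_nth g (b - a) \<noteq> 0"
        then have "exp_le mf a" "exp_le mg (b - a)" "exp_le b (e - mh)"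
          using mf mg b by auto
        then show "a \<in> ?A"
          by (auto simp: exp_le_def lookup_minus lookup_add algebra_simps) (smt (verit, best))
      qed
      then show "mfls_nth (f * g) b * mfls_nth h (e - b) =
          (\<Sum>a\<in>?A. mfls_nth f a * mfls_nth g (b - a)) * mfls_nth h (e - b)"
        by simp
    qed
    also have "\<dots> = (\<Sum>b\<in>?B. \<Sum>a\<in>?A. mfls_nth f a * (mfls_nth g (b - a) * mfls_nth h (e - b)))"
      by (simp add: sum_distrib_right mult.assoc)
    also have "\<dots> = (\<Sum>a\<in>?A. \<Sum>b\<in>?B. mfls_nth f a * (mfls_nth g (b - a) * mfls_nth h (e - b)))"
      by (rule sum.swap)
    also have "\<dots> = (\<Sum>a\<in>?A. mfls_nth f a * mfls_nth (g * h) (e - a))"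
    proof (rule sum.cong[OF refl])
      fix a assume a: "a \<in> ?A"
      have "mfls_nth (g * h) (e - a) =
          (\<Sum>c\<in>(\<lambda>b. b - a) ` ?B. mfls_nth g c * mfls_nth h (e - a - c))"
      proof (rule mfls_nth_times_superset)
        show "finite ((\<lambda>b. b - a) ` ?B)"
          using finB by blast
        fix c assume "mfls_nth g c \<noteq> 0" "mfls_nth h (e - a - c) \<noteq> 0"
        then have "exp_le mg c" "exp_le mh (e - a - c)" "exp_le mf a"
          using mg mh a by auto
        then have "a + c \<in> ?B"
          by (auto simp: exp_le_def lookup_minus lookup_add algebra_simps add_mono)
        then show "c \<in> (\<lambda>b. b - a) ` ?B"
          by (rule rev_image_eqI) simp
      qed
      also have "\<dots> = (\<Sum>b\<in>?B. mfls_nth g (b - a) * mfls_nth h (e - b))"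
        by (subst sum.reindex) (auto simp: inj_on_def)
      finally show "(\<Sum>b\<in>?B. mfls_nth f a * (mfls_nth g (b - a) * mfls_nth h (e - b))) =
          mfls_nth f a * mfls_nth (g * h) (e - a)"
        by (simp add: sum_distrib_left)
    qed
    also have "\<dots> = mfls_nth (f * (g * h)) e"
    proof (rule mfls_nth_times_superset[OF finA, symmetric])
      fix a assume a: "mfls_nth f a \<noteq> 0" "mfls_nth (g * h) (e - a) \<noteq> 0"
      obtain c where "mfls_nth g c \<noteq> 0" "mfls_nth h (e - a - c) \<noteq> 0"
        using a(2) unfolding times_mfls.rep_eq by (rule conv_nonzeroE)
      then have "exp_le mg c" "exp_le mh (e - a - c)" "exp_le mf a"
        using mg mh mf a(1) by auto
      then show "a \<in> ?A"
        by (auto simp: exp_le_def lookup_minus lookup_add algebra_simps) (smt (verit, best))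
    qed
    finally show "mfls_nth (f * g * h) e = mfls_nth (f * (g * h)) e" .
  qed
qed

end

text \<open>
  Division is by units only (inverses in a commutative ring are unique); as usual, the inverse of
  a non-unit is set to 0.  By \<open>mfls_unitI\<close> and \<open>mfls_X_unit\<close> below, power series with nonzero
  constant term and the variables are units, so the inverse of the former is its power series
  expansion.
\<close>

instantiation mfls :: (type, comm_ring_1) inverse
begin

definition inverse_mfls :: "('a, 'b) mfls \<Rightarrow> ('a, 'b) mfls" where
  "inverse_mfls f = (if f dvd 1 then THE g. f * g = 1 else 0)"

definition divide_mfls :: "('a, 'b) mfls \<Rightarrow> ('a, 'b) mfls \<Rightarrow> ('a, 'b) mfls" where
  "divide_mfls f g = f * inverse g"

instance ..

end

lift_definition mfls_const :: "'a::comm_ring_1 \<Rightarrow> ('v, 'a) mfls" is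
  "\<lambda>c e. if e = 0 then c else 0"
  by (rule exI[of _ 0]) simp

lift_definition mfls_X :: "'v \<Rightarrow> ('v, 'a::comm_ring_1) mfls" is
  "\<lambda>v e. if e = Poly_Mapping.single v 1 then 1 else 0"
proof -
  fix v :: 'v
  show "\<exists>m. \<forall>e. (if e = Poly_Mapping.single v 1 then 1 else 0 :: 'a) \<noteq> 0 \<longrightarrow> exp_le m e"
    by (rule exI[of _ "Poly_Mapping.single v 1"]) simp
qed

definition constant_term :: "('v, 'a::comm_ring_1) mfls \<Rightarrow> 'a" where
  "constant_term f = mfls_nth f 0"

lemma mfls_inverse_eqI:
  fixes f g :: "('v, 'a::comm_ring_1) mfls"
  assumes "f * g = 1"
  shows "inverse f = g"
proof -
  have "(THE g. f * g = 1) = g"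
  proof (rule the_equality)
    show "f * g = 1" by (rule assms)
    fix h assume h: "f * h = 1"
    have "h = (f * g) * h" by (simp add: assms)
    also have "\<dots> = (f * h) * g" by (simp add: ac_simps)
    finally show "h = g" by (simp add: h)
  qed
  then show ?thesis
    using dvd_triv_left[of f g] by (simp add: inverse_mfls_def assms)
qed

lemma mfls_inverse_right:
  fixes f :: "('v, 'a::comm_ring_1) mfls"
  assumes "f dvd 1"
  shows "f * inverse f = 1"
proof -
  from assms obtain g where "f * g = 1"
    by (elim dvdE) simp
  then show ?thesis
    by (simp add: mfls_inverse_eqI)
qed

lemma mfls_X_unit: "(mfls_X v :: ('v, 'a::comm_ring_1) mfls) dvd 1"
proof -
  define g :: "('v, 'a) mfls" where
    "g = Abs_mfls (\<lambda>e. if e = Poly_Mapping.single v (- 1) then 1 else 0)"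
  have g: "mfls_nth g = (\<lambda>e. if e = Poly_Mapping.single v (- 1) then 1 else 0)"
    unfolding g_def by (rule Abs_mfls_inverse) (auto intro: exI[of _ "Poly_Mapping.single v (- 1)"])
  have "mfls_X v * g = 1"
  proof (rule mfls_eqI)
    fix e :: "'v \<Rightarrow>\<^sub>0 int"
    have "e - Poly_Mapping.single v 1 = Poly_Mapping.single v (- 1) \<longleftrightarrow> e = 0"
      by (simp add: single_uminus)
    then show "mfls_nth (mfls_X v * g) e = mfls_nth 1 e"
      by (subst mfls_nth_times_superset[of "{Poly_Mapping.single v 1}"])
         (auto simp: mfls_X.rep_eq g one_mfls.rep_eq split: if_splits)
  qed
  then show ?thesis
    by (metis dvd_triv_left)
qed

definition exp_deg :: "('v \<Rightarrow>\<^sub>0 int) \<Rightarrow> int" where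
  "exp_deg e = (\<Sum>v\<in>Poly_Mapping.keys e. Poly_Mapping.lookup e v)"

lemma exp_deg_superset:
  "finite K \<Longrightarrow> Poly_Mapping.keys e \<subseteq> K \<Longrightarrow> exp_deg e = (\<Sum>v\<in>K. Poly_Mapping.lookup e v)"
  unfolding exp_deg_def by (rule sum.mono_neutral_left) (auto simp: in_keys_iff)

lemma exp_deg_add: "exp_deg (a + b) = exp_deg a + exp_deg b"
proof -
  let ?K = "Poly_Mapping.keys a \<union> Poly_Mapping.keys b"
  have "Poly_Mapping.keys (a + b) \<subseteq> ?K"
    by (rule keys_add)
  then have "exp_deg (a + b) = (\<Sum>v\<in>?K. Poly_Mapping.lookup (a + b) v)"
    by (intro exp_deg_superset) simp_all
  also have "\<dots> = (\<Sum>v\<in>?K. Poly_Mapping.lookup a v) + (\<Sum>v\<in>?K. Poly_Mapping.lookup b v)"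
    by (simp only: lookup_add sum.distrib)
  also have "(\<Sum>v\<in>?K. Poly_Mapping.lookup a v) = exp_deg a"
    by (intro exp_deg_superset[symmetric]) simp_all
  also have "(\<Sum>v\<in>?K. Poly_Mapping.lookup b v) = exp_deg b"
    by (intro exp_deg_superset[symmetric]) simp_all
  finally show ?thesis .
qed

lemma exp_deg_nonneg: "exp_le 0 e \<Longrightarrow> exp_deg e \<ge> 0"
  unfolding exp_deg_def exp_le_def by (intro sum_nonneg) simp

lemma exp_deg_pos:
  assumes "exp_le 0 e" "e \<noteq> 0"
  shows "exp_deg e \<ge> 1"
proof -
  have "exp_deg e > 0"
    unfolding exp_deg_def
  proof (rule sum_pos)
    show "finite (Poly_Mapping.keys e)" by simp
    show "Poly_Mapping.keys e \<noteq> {}" using assms(2) by simp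
    show "0 < Poly_Mapping.lookup e v" if "v \<in> Poly_Mapping.keys e" for v
    proof -
      have "0 \<le> Poly_Mapping.lookup e v"
        using assms(1) by (simp add: exp_le_def)
      then show ?thesis
        using that by (simp add: in_keys_iff)
    qed
  qed
  then show ?thesis by simp
qed

lemma mfls_times_nonzeroE:
  fixes f g :: "('v, 'a::comm_ring_1) mfls"
  assumes "mfls_nth (f * g) e \<noteq> 0"
  obtains a where "mfls_nth f a \<noteq> 0" "mfls_nth g (e - a) \<noteq> 0"
  using assms unfolding times_mfls.rep_eq by (rule conv_nonzeroE)

lemma mfls_nth_minus:
  "mfls_nth (f - g) e = mfls_nth f e - mfls_nth g e"
  unfolding minus_mfls_def plus_mfls.rep_eq uminus_mfls.rep_eq by simp

lemma mfls_geometric_unit: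
  fixes u :: "('v, 'a::comm_ring_1) mfls"
  assumes pos: "\<And>e. mfls_nth u e \<noteq> 0 \<Longrightarrow> exp_le 0 e" and u0: "mfls_nth u 0 = 0"
  shows "(1 - u) dvd 1"
proof -
  have upow: "exp_le 0 e \<and> int k \<le> exp_deg e" if "mfls_nth (u ^ k) e \<noteq> 0" for k e
    using that
  proof (induction k arbitrary: e)
    case 0
    then show ?case
      by (auto simp: one_mfls.rep_eq exp_deg_def split: if_splits)
  next
    case (Suc k)
    then obtain a where a: "mfls_nth u a \<noteq> 0" "mfls_nth (u ^ k) (e - a) \<noteq> 0"
      by (auto elim: mfls_times_nonzeroE)
    have "exp_le 0 a" "a \<noteq> 0" "exp_le 0 (e - a)" "int k \<le> exp_deg (e - a)"
      using a pos u0 Suc.IH by auto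
    moreover have "exp_deg e = exp_deg a + exp_deg (e - a)"
      using exp_deg_add[of a "e - a"] by simp
    moreover have "exp_le 0 e"
      using calculation(1,3) by (auto simp: exp_le_def lookup_minus intro: order_trans)
    ultimately show ?case
      using exp_deg_pos[of a] by simp
  qed
  define G where "G k = (\<Sum>i\<le>k. u ^ i)" for k
  have G_step: "mfls_nth (G (Suc k)) e = mfls_nth (G k) e + mfls_nth (u ^ Suc k) e" for k e
    by (simp add: G_def plus_mfls.rep_eq)
  have G_stable: "mfls_nth (G k) e = mfls_nth (G (nat (exp_deg e))) e"
    if "nat (exp_deg e) \<le> k" for k e
    using that
  proof (induction k rule: dec_induct)
    case (step k)
    have "mfls_nth (u ^ Suc k) e = 0"
    proof (rule ccontr)
      assume "mfls_nth (u ^ Suc k) e \<noteq> 0"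
      from upow[OF this] step.hyps show False by linarith
    qed
    with step.IH show ?case
      by (simp add: G_step)
  qed simp
  have G_pos: "exp_le 0 e" if "mfls_nth (G k) e \<noteq> 0" for k e
    using that
  proof (induction k)
    case 0
    then show ?case by (auto simp: G_def one_mfls.rep_eq split: if_splits)
  next
    case (Suc k)
    then show ?case using upow[of "Suc k" e] by (metis G_step add_0)
  qed
  define g :: "('v, 'a) mfls" where "g = Abs_mfls (\<lambda>e. mfls_nth (G (nat (exp_deg e))) e)"
  have g: "mfls_nth g = (\<lambda>e. mfls_nth (G (nat (exp_deg e))) e)"
    unfolding g_def using G_pos by (intro Abs_mfls_inverse) blast
  have tele: "(1 - u) * G k = 1 - u ^ Suc k" for k
  proof (induction k)
    case (Suc k)
    have "(1 - u) * G (Suc k) = (1 - u) * G k + (1 - u) * u ^ Suc k"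
      by (simp only: G_def sum.atMost_Suc distrib_left)
    then show ?case
      by (simp only: Suc.IH) (simp add: algebra_simps)
  qed (simp add: G_def)
  have "(1 - u) * g = 1"
  proof (rule mfls_eqI)
    fix e :: "'v \<Rightarrow>\<^sub>0 int"
    let ?k = "nat (exp_deg e)"
    let ?S = "{a. exp_le 0 a \<and> exp_le a e}"
    have fin: "finite ?S" by (rule finite_exp_box)
    have supp: "exp_le 0 a" if "mfls_nth (1 - u) a \<noteq> 0" for a
    proof (cases "a = 0")
      case False
      then have "mfls_nth u a \<noteq> 0"
        using that by (simp add: mfls_nth_minus one_mfls.rep_eq)
      then show ?thesis by (rule pos)
    qed simp
    have in_S: "a \<in> ?S" if "mfls_nth (1 - u) a \<noteq> 0" "exp_le 0 (e - a)" for a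
      using supp[OF that(1)] that(2) unfolding exp_le_def lookup_minus by simp
    have "mfls_nth ((1 - u) * g) e = (\<Sum>a\<in>?S. mfls_nth (1 - u) a * mfls_nth g (e - a))"
    proof (rule mfls_nth_times_superset[OF fin])
      fix a assume a: "mfls_nth (1 - u) a \<noteq> 0" "mfls_nth g (e - a) \<noteq> 0"
      show "a \<in> ?S"
        using a(1) G_pos[OF a(2)[unfolded g]] by (rule in_S)
    qed
    also have "\<dots> = (\<Sum>a\<in>?S. mfls_nth (1 - u) a * mfls_nth (G ?k) (e - a))"
    proof (rule sum.cong[OF refl])
      fix a assume "a \<in> ?S"
      then have "exp_deg a \<ge> 0"
        by (simp add: exp_deg_nonneg)
      moreover have "exp_deg e = exp_deg a + exp_deg (e - a)"
        using exp_deg_add[of a "e - a"] by simp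
      ultimately have "nat (exp_deg (e - a)) \<le> ?k"
        by linarith
      then show "mfls_nth (1 - u) a * mfls_nth g (e - a) =
          mfls_nth (1 - u) a * mfls_nth (G ?k) (e - a)"
        using G_stable[of "e - a" ?k] by (simp add: g)
    qed
    also have "\<dots> = mfls_nth ((1 - u) * G ?k) e"
    proof (rule mfls_nth_times_superset[OF fin, symmetric])
      fix a assume a: "mfls_nth (1 - u) a \<noteq> 0" "mfls_nth (G ?k) (e - a) \<noteq> 0"
      show "a \<in> ?S"
        using a(1) G_pos[OF a(2)] by (rule in_S)
    qed
    also have "\<dots> = mfls_nth 1 e - mfls_nth (u ^ Suc ?k) e"
      by (simp only: tele mfls_nth_minus)
    also have "mfls_nth (u ^ Suc ?k) e = 0"
    proof (rule ccontr)
      assume "mfls_nth (u ^ Suc ?k) e \<noteq> 0"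
      from upow[OF this] show False by linarith
    qed
    finally show "mfls_nth ((1 - u) * g) e = mfls_nth 1 e" by simp
  qed
  then show ?thesis
    by (metis dvd_triv_left)
qed

lemma mfls_nth_const_times:
  "mfls_nth (mfls_const c * f) e = c * mfls_nth f e"
  by (subst mfls_nth_times_superset[of "{0}"]) (auto simp: mfls_const.rep_eq split: if_splits)

lemma mfls_unitI:
  fixes f :: "('v, 'a::field) mfls"
  assumes "\<And>e. mfls_nth f e \<noteq> 0 \<Longrightarrow> exp_le 0 e" and "mfls_nth f 0 \<noteq> 0"
  shows "f dvd 1"
proof -
  let ?c = "mfls_const (inverse (mfls_nth f 0)) :: ('v, 'a) mfls"
  let ?u = "1 - ?c * f"
  have nth_u: "mfls_nth ?u e = (if e = 0 then 1 else 0) - inverse (mfls_nth f 0) * mfls_nth f e" for e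
    by (simp add: mfls_nth_minus one_mfls.rep_eq mfls_nth_const_times)
  have "(1 - ?u) dvd 1"
  proof (rule mfls_geometric_unit)
    show "exp_le 0 e" if "mfls_nth ?u e \<noteq> 0" for e
      using that assms(1)[of e] unfolding nth_u by (cases "e = 0") auto
    show "mfls_nth ?u 0 = 0"
      using assms(2) unfolding nth_u by simp
  qed
  then have "?c * f dvd 1" by simp
  then show ?thesis
    by (rule dvd_mult_right)
qed


section \<open>Alternating sign trapezoids\<close>

text \<open>
  Arrays are total functions \<open>a i j\<close> (row \<open>i\<close>, column \<open>j\<close>), required to vanish outside
  the trapezoidal index set, so that each array is represented by exactly one function.
\<close>

definition trapezoid_index :: "nat \<Rightarrow> nat \<Rightarrow> (nat \<times> nat) set" where
  "trapezoid_index n l = {(i, j). 1 \<le> i \<and> i \<le> n \<and> i \<le> j \<and> j \<le> 2 * n + l - 1 - i}"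

definition column_sum :: "nat \<Rightarrow> nat \<Rightarrow> (nat \<Rightarrow> nat \<Rightarrow> int) \<Rightarrow> nat \<Rightarrow> int" where
  "column_sum n l a j = (\<Sum>i | (i, j) \<in> trapezoid_index n l. a i j)"

definition bottom_row :: "nat \<Rightarrow> nat \<Rightarrow> nat \<Rightarrow> nat" where
  "bottom_row n l j = Max {i. (i, j) \<in> trapezoid_index n l}"

definition alternating_sign_trapezoid ::
    "nat \<Rightarrow> nat \<Rightarrow> (nat \<Rightarrow> nat \<Rightarrow> int) \<Rightarrow> bool" where
  "alternating_sign_trapezoid n l a \<longleftrightarrow>
     (\<forall>i j. (i, j) \<in> trapezoid_index n l \<longrightarrow> a i j \<in> {-1, 0, 1}) \<and>
     (\<forall>i j. (i, j) \<notin> trapezoid_index n l \<longrightarrow> a i j = 0) \<and>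
     (\<forall>i j j'. (i, j) \<in> trapezoid_index n l \<and> (i, j') \<in> trapezoid_index n l \<and> j < j' \<and>
        a i j \<noteq> 0 \<and> a i j' \<noteq> 0 \<and> (\<forall>k. j < k \<and> k < j' \<longrightarrow> a i k = 0) \<longrightarrow> a i j' = - a i j) \<and>
     (\<forall>i i' j. (i, j) \<in> trapezoid_index n l \<and> (i', j) \<in> trapezoid_index n l \<and> i < i' \<and>
        a i j \<noteq> 0 \<and> a i' j \<noteq> 0 \<and> (\<forall>k. i < k \<and> k < i' \<longrightarrow> a k j = 0) \<longrightarrow> a i' j = - a i j) \<and>
     (\<forall>i j. (i, j) \<in> trapezoid_index n l \<and> a i j \<noteq> 0 \<and>
        (\<forall>k. (k, j) \<in> trapezoid_index n l \<and> k < i \<longrightarrow> a k j = 0) \<longrightarrow> a i j = 1) \<and>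
     (\<forall>i\<in>{1..n}. (\<Sum>j = i..2 * n + l - 1 - i. a i j) = 1) \<and>
     (\<forall>j\<in>{n + 1..n + l - 2}. column_sum n l a j = 0)"

definition vertically_symmetric :: "nat \<Rightarrow> nat \<Rightarrow> (nat \<Rightarrow> nat \<Rightarrow> int) \<Rightarrow> bool" where
  "vertically_symmetric n l a \<longleftrightarrow>
     (\<forall>(i, j)\<in>trapezoid_index n l. a i j = a i (2 * n + l - 1 - j))"

definition vs_trapezoids :: "nat \<Rightarrow> nat \<Rightarrow> (nat \<Rightarrow> nat \<Rightarrow> int) set" where
  "vs_trapezoids n l = {a. alternating_sign_trapezoid n l a \<and> vertically_symmetric n l a}"

definition is_1_column :: "nat \<Rightarrow> nat \<Rightarrow> (nat \<Rightarrow> nat \<Rightarrow> int) \<Rightarrow> nat \<Rightarrow> bool" where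
  "is_1_column n l a j \<longleftrightarrow> column_sum n l a j = 1"

definition is_10_column :: "nat \<Rightarrow> nat \<Rightarrow> (nat \<Rightarrow> nat \<Rightarrow> int) \<Rightarrow> nat \<Rightarrow> bool" where
  "is_10_column n l a j \<longleftrightarrow> is_1_column n l a j \<and> a (bottom_row n l j) j = 0"

lemma finite_trapezoid_index: "finite (trapezoid_index n l)"
  by (rule finite_subset[of _ "{..n} \<times> {..2 * n + l}"]) (auto simp: trapezoid_index_def)

lemma finite_vs_trapezoids: "finite (vs_trapezoids n l)"
proof (rule finite_subset)
  let ?T = "trapezoid_index n l"
  let ?F = "{f. \<forall>p. (p \<in> ?T \<longrightarrow> f p \<in> {-1, 0, 1 :: int}) \<and> (p \<notin> ?T \<longrightarrow> f p = 0)}"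
  show "vs_trapezoids n l \<subseteq> curry ` ?F"
  proof
    fix a assume "a \<in> vs_trapezoids n l"
    then have "case_prod a \<in> ?F"
      by (auto simp: vs_trapezoids_def alternating_sign_trapezoid_def)
    then show "a \<in> curry ` ?F"
      by (rule rev_image_eqI) simp
  qed
  show "finite (curry ` ?F)"
    by (intro finite_imageI finite_set_of_finite_funs finite_trapezoid_index) simp
qed


section \<open>Weights\<close>

text \<open>The field \<open>\<rat>(P, Q)\<close> as the fraction field of \<open>\<rat>[P][Q]\<close>.\<close>

type_synonym ratfun = "rat poly poly fract"

definition indet_P :: ratfun where "indet_P = Fract [:[:0, 1:]:] 1"

definition indet_Q :: ratfun where "indet_Q = Fract [:0, 1:] 1"

definition P_weight :: "nat \<Rightarrow> nat \<Rightarrow> (nat \<Rightarrow> nat \<Rightarrow> int) \<Rightarrow> ratfun" where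
  "P_weight n l a = indet_P ^ card {j \<in> {1..n - 1}. is_10_column n l a j}"

definition Q_weight :: "nat \<Rightarrow> nat \<Rightarrow> (nat \<Rightarrow> nat \<Rightarrow> int) \<Rightarrow> ratfun" where
  "Q_weight n l a =
     indet_Q ^ card {(i, j) \<in> trapezoid_index n l. j \<le> n - 1 + (l - 1) div 2 \<and> a i j = -1}"


section \<open>The Laurent series\<close>

text \<open>
  The variables of the ambient ring are indexed by \<^typ>\<open>nat\<close>; only \<open>x\<^sub>1, \<dots>, x\<^sub>N\<close> occur.

  The exponent \<open>(l - 5) / 2 + n / 2\<close> is written \<open>(n + l - 5) div 2\<close>: for even \<open>n \<ge> 2\<close> and odd
  \<open>l \<ge> 3\<close> the number \<open>n + l - 5\<close> is a nonnegative even integer, whereas \<open>l - 5\<close> would be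
  truncated for \<open>l = 3\<close>.
\<close>

definition vs_series :: "nat \<Rightarrow> nat \<Rightarrow> nat \<Rightarrow> (nat, ratfun) mfls" where
  "vs_series n l N =
     (let P = mfls_const indet_P; Q = mfls_const indet_Q; x = mfls_X in
      mfls_const (1 / fact N) *
      (\<Prod>r = 1..N.
         (Q + (Q - P) * x r) /
         (x r ^ (n - 2) * (1 + x r) ^ ((n + l - 5) div 2) * (Q * (1 + x r)\<^sup>2 - (x r)\<^sup>2))) *
      (\<Prod>(s, t) | 1 \<le> s \<and> s < t \<and> t \<le> N.
         ((x t - x s)\<^sup>2 * (x s + x t + x s * x t) *
          (Q + (Q - 1) * x s + (Q - 1) * x t + (Q - 2) * x s * x t) *
          (Q - x s * x t)) /
         (Q * (1 + x s) * (1 + x t) - x s * x t)))"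

end

theory Submission
  imports Defs "HOL-Computational_Algebra.Polynomial_Factorial"
begin

text \<open>
  Let \<open>m\<close> be the number of columns to the left of the central one.  A vertically symmetric trapezoid is
  determined by the sets of left columns whose partial column sums equal \<open>1\<close> after each row.  Two
  consecutive sets interlace, except that the columns to the left of the current row are frozen.
  Writing \<open>F\<^sub>i(k\<^sub>1, \<dots>, k\<^sub>p)\<close> for the weighted number of ways to reach a set after row \<open>i\<close>, one
  proves by induction on \<open>i\<close> a coordinate Bethe ansatz: \<open>F\<^sub>i\<close> is the constant term of an antisymmetric
  kernel times \<open>\<Prod>\<^bsub>s<t\<^esub> W(x\<^sub>s, x\<^sub>t)\<close> times plane waves \<open>\<Prod>\<^sub>r (1 + x\<^sub>r)^k\<^sub>r\<close>.  Summing plane waves over an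
  interlacing row telescopes; the unwanted boundary terms are killed by antisymmetry, the terms at the
  wall by the symmetry \<open>1 + x \<mapsto> 1 / (1 + x)\<close>, and the position that enters in an even row is created
  by a Laplace expansion of a Vandermonde product in \<open>x\<^sup>2 / (1 + x)\<close>.  Freezing a position
  multiplies its plane wave by \<open>g = - x / (Q + (Q - 1) x)\<close> in each row.  Summing over all final
  positions is then a geometric series, and symmetrizing it (Lagrange interpolation in \<open>x + Q / x\<close>)
  produces the product formula.
\<close>

section \<open>Multivariate Laurent series\<close>

text \<open>The kernel is dictated by three demands. A right end meeting the next left end leaves a
  multiple of \<open>WW s r\<close>, which must die under an exchange of variables; so all factors
  except \<open>WW\<close> have to form an antisymmetric function. At the wall only the
  \<open>WW r z\<close> with \<open>z\<close> last occur; each is multiplied by its reflection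
  \<open>YY r z\<close>, so that \<open>z\<close> enters through \<open>uu z\<close> alone, once the
  power \<open>m + 1\<close> of \<open>1 / (1 + x)\<close> absorbs the wave of the column behind the
  wall. The pole of order \<open>2 p - 2\<close> in each of \<open>p\<close> variables turns the
  result into a Laurent polynomial in \<open>uu z\<close>; it is also exactly the order of the power
  of \<open>uu\<close> produced by the Laplace expansion, so that one variable can be set to 0, and
  its factors then become the ends \<open>al\<close> and \<open>be\<close> of the even row. A free
  position gains \<open>al\<close> in each row and a frozen one gains 1, whence
  \<open>gg = 1 / al\<close>. The obstacle is that formal Laurent series admit no substitution
  \<open>1 + x\<close> to \<open>1 / (1 + x)\<close>; a degree argument in \<open>uu\<close>
  replaces it. Degrees also remove the lower bound on the final positions: the part cut off has
  order \<open>n = 2 N\<close> in a variable, which exceeds the pole of order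
  \<open>2 N - 2\<close>.\<close>

lemma keys_subset_of_exp_le:
  fixes a b :: "'v \<Rightarrow>\<^sub>0 int"
  assumes "exp_le m a" "exp_le k (e - a)" "Poly_Mapping.keys m \<subseteq> V" "Poly_Mapping.keys k \<subseteq> V"
    "Poly_Mapping.keys e \<subseteq> V"
  shows "Poly_Mapping.keys a \<subseteq> V"
proof
  fix v assume v: "v \<in> Poly_Mapping.keys a"
  show "v \<in> V"
  proof (rule ccontr)
    assume "v \<notin> V"
    then have "Poly_Mapping.lookup m v = 0" "Poly_Mapping.lookup k v = 0" "Poly_Mapping.lookup e v = 0"
      using assms(3-5) by (auto simp: in_keys_iff)
    moreover have "Poly_Mapping.lookup m v \<le> Poly_Mapping.lookup a v"
      "Poly_Mapping.lookup k v \<le> Poly_Mapping.lookup e v - Poly_Mapping.lookup a v"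
      using assms(1,2) by (auto simp: exp_le_def lookup_minus)
    ultimately show False
      using v by (simp add: in_keys_iff)
  qed
qed

lemma finite_exp_deg_box:
  fixes m :: "'v \<Rightarrow>\<^sub>0 int"
  assumes "finite V"
  shows "finite {e. exp_le m e \<and> Poly_Mapping.keys e \<subseteq> V \<and> exp_deg e = d}"
proof -
  let ?W = "V \<union> Poly_Mapping.keys m"
  have W: "finite ?W" using assms by simp
  \<comment> \<open>The total excess over the lower bound. All excesses are nonnegative, so it
    bounds the excess in each single variable.\<close>
  define M where "M = d - exp_deg m"
  define k where "k = m + (\<Sum>v\<in>?W. Poly_Mapping.single v M)"
  have lk: "Poly_Mapping.lookup k v = Poly_Mapping.lookup m v + (if v \<in> ?W then M else 0)" for v
    using W by (simp add: k_def lookup_add lookup_sum lookup_single when_def)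
  have "exp_le e k" if e: "exp_le m e" "Poly_Mapping.keys e \<subseteq> V" "exp_deg e = d" for e
    unfolding exp_le_def
  proof
    fix v
    have le: "Poly_Mapping.lookup m w \<le> Poly_Mapping.lookup e w" for w
      using e(1) by (simp add: exp_le_def)
    show "Poly_Mapping.lookup e v \<le> Poly_Mapping.lookup k v"
    proof (cases "v \<in> ?W")
      case True
      have "Poly_Mapping.lookup e v - Poly_Mapping.lookup m v
          \<le> (\<Sum>w\<in>?W. Poly_Mapping.lookup e w - Poly_Mapping.lookup m w)"
        by (rule member_le_sum[OF True]) (use le W in auto)
      also have "\<dots> = M"
        unfolding sum_subtractf M_def e(3)[symmetric]
        using W e(2) by (subst (1 2) exp_deg_superset[of ?W]) auto
      finally show ?thesis using True by (simp add: lk)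
    next
      case False
      then have "Poly_Mapping.lookup e v = 0" "Poly_Mapping.lookup m v = 0"
        using e(2) by (auto simp: in_keys_iff)
      then show ?thesis using False by (simp add: lk)
    qed
  qed
  then have "{e. exp_le m e \<and> Poly_Mapping.keys e \<subseteq> V \<and> exp_deg e = d} \<subseteq> {a. exp_le m a \<and> exp_le a k}"
    by blast
  then show ?thesis
    using finite_exp_box finite_subset by blast
qed

lemma exp_deg_mono: "exp_le a b \<Longrightarrow> exp_deg a \<le> exp_deg b"
  using exp_deg_nonneg[of "b - a"] exp_deg_add[of a "b - a"]
  by (simp add: exp_le_def lookup_minus)

text \<open>Leading exponents are taken with respect to the degree-lexicographic order, among the
  exponents that involve only finitely many fixed variables: there every degree is finite.\<close>

lemma mfls_leading_exponent:
  fixes f :: "('v::linorder, 'a::comm_ring_1) mfls"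
  assumes V: "finite V" and m: "\<And>e. mfls_nth f e \<noteq> 0 \<Longrightarrow> exp_le m e"
    and e0: "mfls_nth f e0 \<noteq> 0" "Poly_Mapping.keys e0 \<subseteq> V"
  obtains e where "mfls_nth f e \<noteq> 0" "Poly_Mapping.keys e \<subseteq> V"
    "\<And>a. mfls_nth f a \<noteq> 0 \<Longrightarrow> Poly_Mapping.keys a \<subseteq> V \<Longrightarrow> exp_deg e \<le> exp_deg a"
    "\<And>a. mfls_nth f a \<noteq> 0 \<Longrightarrow> Poly_Mapping.keys a \<subseteq> V \<Longrightarrow> exp_deg a = exp_deg e \<Longrightarrow> e \<le> a"
proof -
  let ?S = "{a. mfls_nth f a \<noteq> 0 \<and> Poly_Mapping.keys a \<subseteq> V}"
  \<comment> \<open>The shift by the lower bound makes the degrees natural numbers, so that a least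
    one exists.\<close>
  define N where "N a = nat (exp_deg a - exp_deg m)" for a :: "'v \<Rightarrow>\<^sub>0 int"
  have N: "int (N a) = exp_deg a - exp_deg m" if "a \<in> ?S" for a
    using exp_deg_mono[OF m[of a]] that by (simp add: N_def)
  obtain e1 where e1: "e1 \<in> ?S" "\<And>a. a \<in> ?S \<Longrightarrow> N e1 \<le> N a"
    using ex_has_least_nat[of "\<lambda>a. a \<in> ?S" e0 N] e0 by blast
  let ?T = "{a \<in> ?S. exp_deg a = exp_deg e1}"
  have "finite ?T"
    by (rule finite_subset[OF _ finite_exp_deg_box[OF V, of m "exp_deg e1"]]) (use m in auto)
  moreover have "e1 \<in> ?T" using e1 by simp
  ultimately have M: "Min ?T \<in> ?T" "\<And>a. a \<in> ?T \<Longrightarrow> Min ?T \<le> a"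
    using Min_in[of ?T] Min_le[of ?T] by blast+
  show ?thesis
  proof (rule that[of "Min ?T"])
    fix a assume a: "mfls_nth f a \<noteq> 0" "Poly_Mapping.keys a \<subseteq> V"
    then have "int (N e1) \<le> int (N a)" using e1 by auto
    then show "exp_deg (Min ?T) \<le> exp_deg a"
      using N[of e1] N[of a] e1(1) a M(1) by simp
    show "Min ?T \<le> a" if "exp_deg a = exp_deg (Min ?T)"
      using M that a by auto
  qed (use M(1) in auto)
qed

text \<open>Leading coefficients multiply. The point of a domain is its fraction field, in which the
  later rational identities are verified.\<close>

instance mfls :: (linorder, idom) idom
proof
  fix f g :: "('a, 'b) mfls"
  assume fg: "f \<noteq> 0" "g \<noteq> 0"
  obtain a0 where a0: "mfls_nth f a0 \<noteq> 0"
    using fg(1) by (metis mfls_eqI zero_mfls.rep_eq)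
  obtain b0 where b0: "mfls_nth g b0 \<noteq> 0"
    using fg(2) by (metis mfls_eqI zero_mfls.rep_eq)
  obtain mf where mf: "\<And>e. mfls_nth f e \<noteq> 0 \<Longrightarrow> exp_le mf e"
    using mfls_bound by blast
  obtain mg where mg: "\<And>e. mfls_nth g e \<noteq> 0 \<Longrightarrow> exp_le mg e"
    using mfls_bound by blast
  \<comment> \<open>With the variables of both lower bounds in \<open>V\<close>, any two exponents
    from the supports that add up to \<open>a + b\<close> stay inside \<open>V\<close>.\<close>
  define V where "V = Poly_Mapping.keys a0 \<union> Poly_Mapping.keys b0 \<union> Poly_Mapping.keys mf \<union> Poly_Mapping.keys mg"
  have V: "finite V" by (simp add: V_def)
  obtain a where a: "mfls_nth f a \<noteq> 0" "Poly_Mapping.keys a \<subseteq> V"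
    "\<And>x. mfls_nth f x \<noteq> 0 \<Longrightarrow> Poly_Mapping.keys x \<subseteq> V \<Longrightarrow> exp_deg a \<le> exp_deg x"
    "\<And>x. mfls_nth f x \<noteq> 0 \<Longrightarrow> Poly_Mapping.keys x \<subseteq> V \<Longrightarrow> exp_deg x = exp_deg a \<Longrightarrow> a \<le> x"
    using mfls_leading_exponent[OF V mf a0] V_def by blast
  obtain b where b: "mfls_nth g b \<noteq> 0" "Poly_Mapping.keys b \<subseteq> V"
    "\<And>x. mfls_nth g x \<noteq> 0 \<Longrightarrow> Poly_Mapping.keys x \<subseteq> V \<Longrightarrow> exp_deg b \<le> exp_deg x"
    "\<And>x. mfls_nth g x \<noteq> 0 \<Longrightarrow> Poly_Mapping.keys x \<subseteq> V \<Longrightarrow> exp_deg x = exp_deg b \<Longrightarrow> b \<le> x"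
    using mfls_leading_exponent[OF V mg b0] V_def by blast
  have keys_ab: "Poly_Mapping.keys (a + b) \<subseteq> V"
    using keys_add[of a b] a(2) b(2) by blast
  have "mfls_nth (f * g) (a + b) = (\<Sum>x\<in>{a}. mfls_nth f x * mfls_nth g (a + b - x))"
  proof (rule mfls_nth_times_superset)
    fix x assume x: "mfls_nth f x \<noteq> 0" "mfls_nth g (a + b - x) \<noteq> 0"
    define y where "y = a + b - x"
    have xy: "x = a + b - y" "x + y = a + b" by (simp_all add: y_def)
    have "Poly_Mapping.keys x \<subseteq> V"
      by (rule keys_subset_of_exp_le[OF mf[OF x(1)] mg[OF x(2)]])
         (use keys_ab in \<open>auto simp: V_def\<close>)
    moreover have "Poly_Mapping.keys y \<subseteq> V"
      by (rule keys_subset_of_exp_le[OF mg[OF x(2), folded y_def] _ _ _ keys_ab])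
         (use mf[OF x(1)] in \<open>auto simp: xy(1)[symmetric] V_def\<close>)
    ultimately have d: "exp_deg a \<le> exp_deg x" "exp_deg b \<le> exp_deg y"
      "exp_deg x = exp_deg a \<Longrightarrow> a \<le> x" "exp_deg y = exp_deg b \<Longrightarrow> b \<le> y"
      using a(3,4) b(3,4) x y_def by auto
    have "exp_deg x + exp_deg y = exp_deg a + exp_deg b"
      using exp_deg_add[of x y] exp_deg_add[of a b] xy(2) by simp
    with d have "a \<le> x" "b \<le> y" by auto
    moreover have "b \<le> y \<Longrightarrow> x \<le> a"
      using xy(2) add_right_mono[of b y x] by (simp add: add.commute[of y x])
    ultimately have "x = a" by simp
    then show "x \<in> {a}" by simp
  qed simp
  also have "\<dots> \<noteq> 0" using a(1) b(1) by simp
  finally show "f * g \<noteq> 0" by (auto simp: zero_mfls.rep_eq)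
qed

subsection \<open>Constant terms and permutations of the variables\<close>

lemma constant_term_0 [simp]: "constant_term 0 = 0"
  by (simp add: constant_term_def zero_mfls.rep_eq)

lemma constant_term_1 [simp]: "constant_term 1 = 1"
  by (simp add: constant_term_def one_mfls.rep_eq)

lemma constant_term_add: "constant_term (f + g) = constant_term f + constant_term g"
  by (simp add: constant_term_def plus_mfls.rep_eq)

lemma constant_term_uminus: "constant_term (- f) = - constant_term f"
  by (simp add: constant_term_def uminus_mfls.rep_eq)

lemma constant_term_diff: "constant_term (f - g) = constant_term f - constant_term g"
  by (simp add: constant_term_def mfls_nth_minus)

lemma constant_term_const_times: "constant_term (mfls_const c * f) = c * constant_term f"
  by (simp add: constant_term_def mfls_nth_const_times)

lemma constant_term_sum: "constant_term (\<Sum>i\<in>A. f i) = (\<Sum>i\<in>A. constant_term (f i))"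
  by (induction A rule: infinite_finite_induct) (simp_all add: constant_term_add)

lemma mfls_const_1 [simp]: "mfls_const 1 = 1"
  by (rule mfls_eqI) (simp add: mfls_const.rep_eq one_mfls.rep_eq)

lemma mfls_const_mult: "mfls_const (a * b) = mfls_const a * mfls_const b"
  by (rule mfls_eqI) (simp add: mfls_nth_const_times, simp add: mfls_const.rep_eq)

text \<open>Renaming of the variable \<open>v\<close> to \<open>\<sigma> v\<close>. The coefficient
  function is pulled back along \<open>map_key \<sigma>\<close>, because
  \<open>map_key \<sigma> e\<close> reads off at \<open>v\<close> the exponent that \<open>e\<close>
  has at \<open>\<sigma> v\<close>.\<close>

definition mfls_perm :: "('v \<Rightarrow> 'v) \<Rightarrow> ('v, 'a::zero) mfls \<Rightarrow> ('v, 'a) mfls" where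
  "mfls_perm \<sigma> f = Abs_mfls (\<lambda>e. mfls_nth f (Poly_Mapping.map_key \<sigma> e))"

context
  fixes \<sigma> :: "'v \<Rightarrow> 'v"
  assumes bij: "bij \<sigma>"
begin

lemma lookup_map_key: "Poly_Mapping.lookup (Poly_Mapping.map_key \<sigma> e) v = Poly_Mapping.lookup e (\<sigma> v)"
  using map_key.rep_eq[OF bij_is_inj[OF bij], of e] by simp

lemma mfls_nth_perm: "mfls_nth (mfls_perm \<sigma> f) e = mfls_nth f (Poly_Mapping.map_key \<sigma> e)"
proof -
  obtain m where m: "\<And>e. mfls_nth f e \<noteq> 0 \<Longrightarrow> exp_le m e"
    using mfls_bound by blast
  have inv: "bij (inv \<sigma>)" using bij by (rule bij_imp_bij_inv)
  have "exp_le (Poly_Mapping.map_key (inv \<sigma>) m) e" if "mfls_nth f (Poly_Mapping.map_key \<sigma> e) \<noteq> 0" for e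
    unfolding exp_le_def
  proof
    fix v
    have "Poly_Mapping.lookup m (inv \<sigma> v) \<le> Poly_Mapping.lookup e (\<sigma> (inv \<sigma> v))"
      using m[OF that] by (simp add: exp_le_def lookup_map_key)
    then show "Poly_Mapping.lookup (Poly_Mapping.map_key (inv \<sigma>) m) v \<le> Poly_Mapping.lookup e v"
      using map_key.rep_eq[OF bij_is_inj[OF inv], of m] bij
      by (simp add: bij_is_surj surj_f_inv_f)
  qed
  then show ?thesis
    unfolding mfls_perm_def by (subst Abs_mfls_inverse) auto
qed

lemma map_key_bij: "bij (Poly_Mapping.map_key \<sigma> :: ('v \<Rightarrow>\<^sub>0 int) \<Rightarrow> _)"
proof (rule bijI)
  show "inj (Poly_Mapping.map_key \<sigma> :: ('v \<Rightarrow>\<^sub>0 int) \<Rightarrow> _)"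
  proof (rule injI)
    fix a b :: "'v \<Rightarrow>\<^sub>0 int" assume "Poly_Mapping.map_key \<sigma> a = Poly_Mapping.map_key \<sigma> b"
    then have "Poly_Mapping.lookup a (\<sigma> v) = Poly_Mapping.lookup b (\<sigma> v)" for v
      by (metis lookup_map_key)
    then show "a = b"
      by (metis bij bij_pointE poly_mapping_eqI)
  qed
  show "surj (Poly_Mapping.map_key \<sigma> :: ('v \<Rightarrow>\<^sub>0 int) \<Rightarrow> _)"
  proof (rule surjI)
    fix a :: "'v \<Rightarrow>\<^sub>0 int"
    show "Poly_Mapping.map_key \<sigma> (Poly_Mapping.map_key (inv \<sigma>) a) = a"
      using map_key.rep_eq[OF bij_is_inj[OF bij_imp_bij_inv[OF bij]], of a] bij
      by (intro poly_mapping_eqI) (simp add: lookup_map_key bij_is_inj inv_f_f)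
  qed
qed

lemma map_key_eq_single:
  "Poly_Mapping.map_key \<sigma> e = Poly_Mapping.single v c \<longleftrightarrow> e = Poly_Mapping.single (\<sigma> v) c"
proof
  assume "Poly_Mapping.map_key \<sigma> e = Poly_Mapping.single v c"
  then have "Poly_Mapping.lookup e (\<sigma> w) = Poly_Mapping.lookup (Poly_Mapping.single (\<sigma> v) c) (\<sigma> w)" for w
    using lookup_map_key[of e w] bij_is_inj[OF bij] by (simp add: lookup_single when_def inj_eq)
  then show "e = Poly_Mapping.single (\<sigma> v) c"
    by (metis bij bij_pointE poly_mapping_eqI)
qed (simp add: map_key_single bij_is_inj[OF bij])

lemma map_key_0_iff: "Poly_Mapping.map_key \<sigma> e = 0 \<longleftrightarrow> e = (0 :: 'v \<Rightarrow>\<^sub>0 int)"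
proof
  assume "Poly_Mapping.map_key \<sigma> e = 0"
  then have "Poly_Mapping.lookup e (\<sigma> w) = 0" for w
    using lookup_map_key[of e w] by simp
  then have "Poly_Mapping.lookup e w = Poly_Mapping.lookup 0 w" for w
    by (metis bij bij_pointE lookup_zero)
  then show "e = 0" by (rule poly_mapping_eqI)
qed (simp add: bij_is_inj[OF bij])

lemma map_key_diff:
  "Poly_Mapping.map_key \<sigma> (a - b) = Poly_Mapping.map_key \<sigma> a - Poly_Mapping.map_key \<sigma> (b :: 'v \<Rightarrow>\<^sub>0 int)"
  by (rule poly_mapping_eqI) (simp add: lookup_map_key lookup_minus)

lemma mfls_perm_add: "mfls_perm \<sigma> (f + g) = mfls_perm \<sigma> f + mfls_perm \<sigma> g"
  by (rule mfls_eqI) (simp add: mfls_nth_perm plus_mfls.rep_eq)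

lemma mfls_perm_uminus: "mfls_perm \<sigma> (- f) = - mfls_perm \<sigma> f"
  by (rule mfls_eqI) (simp add: mfls_nth_perm uminus_mfls.rep_eq)

lemma mfls_perm_diff: "mfls_perm \<sigma> (f - g) = mfls_perm \<sigma> f - mfls_perm \<sigma> g"
  by (rule mfls_eqI) (simp add: mfls_nth_perm mfls_nth_minus)

lemma mfls_perm_const: "mfls_perm \<sigma> (mfls_const c) = mfls_const c"
  by (rule mfls_eqI) (simp add: mfls_nth_perm mfls_const.rep_eq map_key_0_iff)

lemma mfls_perm_0: "mfls_perm \<sigma> 0 = 0"
  by (rule mfls_eqI) (simp add: mfls_nth_perm zero_mfls.rep_eq)

lemma mfls_perm_1: "mfls_perm \<sigma> 1 = 1"
  by (rule mfls_eqI) (simp add: mfls_nth_perm one_mfls.rep_eq map_key_0_iff)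

lemma mfls_perm_X: "mfls_perm \<sigma> (mfls_X v) = mfls_X (\<sigma> v)"
  by (rule mfls_eqI) (simp add: mfls_nth_perm mfls_X.rep_eq map_key_eq_single)

lemma mfls_perm_mult: "mfls_perm \<sigma> (f * g) = mfls_perm \<sigma> f * mfls_perm \<sigma> g"
proof (rule mfls_eqI)
  fix e
  let ?k = "Poly_Mapping.map_key \<sigma> :: ('v \<Rightarrow>\<^sub>0 int) \<Rightarrow> _"
  have "mfls_nth (mfls_perm \<sigma> (f * g)) e =
      (\<Sum>a | mfls_nth f a \<noteq> 0 \<and> mfls_nth g (?k e - a) \<noteq> 0. mfls_nth f a * mfls_nth g (?k e - a))"
    by (simp add: mfls_nth_perm times_mfls.rep_eq)
  also have "\<dots> = (\<Sum>a | mfls_nth f (?k a) \<noteq> 0 \<and> mfls_nth g (?k (e - a)) \<noteq> 0.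
      mfls_nth f (?k a) * mfls_nth g (?k (e - a)))"
    by (rule sum.reindex_bij_witness[of _ ?k "inv ?k"])
       (simp_all add: map_key_diff inv_f_f[OF bij_is_inj[OF map_key_bij]] surj_f_inv_f[OF bij_is_surj[OF map_key_bij]])
  finally show "mfls_nth (mfls_perm \<sigma> (f * g)) e = mfls_nth (mfls_perm \<sigma> f * mfls_perm \<sigma> g) e"
    by (simp add: mfls_nth_perm times_mfls.rep_eq)
qed

lemma mfls_perm_power: "mfls_perm \<sigma> (f ^ n) = mfls_perm \<sigma> f ^ n"
  by (induction n) (simp_all add: mfls_perm_mult mfls_perm_1)

lemma mfls_perm_inverse: "f dvd 1 \<Longrightarrow> mfls_perm \<sigma> (inverse f) = inverse (mfls_perm \<sigma> f)"
  by (metis mfls_inverse_eqI mfls_inverse_right mfls_perm_mult mfls_perm_1)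

lemma mfls_perm_prod_list: "mfls_perm \<sigma> (prod_list fs) = prod_list (map (mfls_perm \<sigma>) fs)"
  by (induction fs) (simp_all add: mfls_perm_mult mfls_perm_1)

lemma constant_term_perm: "constant_term (mfls_perm \<sigma> f) = constant_term f"
  using map_key_0_iff[of 0] by (simp add: constant_term_def mfls_nth_perm)

end

subsection \<open>The degree in one variable\<close>

definition vge :: "'v \<Rightarrow> int \<Rightarrow> ('v, 'a::zero) mfls \<Rightarrow> bool" where
  "vge v d f \<longleftrightarrow> (\<forall>e. mfls_nth f e \<noteq> 0 \<longrightarrow> d \<le> Poly_Mapping.lookup e v)"

definition vle :: "'v \<Rightarrow> int \<Rightarrow> ('v, 'a::zero) mfls \<Rightarrow> bool" where
  "vle v d f \<longleftrightarrow> (\<forall>e. mfls_nth f e \<noteq> 0 \<longrightarrow> Poly_Mapping.lookup e v \<le> d)"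

definition vfree :: "'v \<Rightarrow> ('v, 'a::zero) mfls \<Rightarrow> bool" where
  "vfree v f \<longleftrightarrow> (\<forall>e. mfls_nth f e \<noteq> 0 \<longrightarrow> Poly_Mapping.lookup e v = 0)"

lemma vfreeD: "vfree v f \<Longrightarrow> vge v 0 f" "vfree v f \<Longrightarrow> vle v 0 f"
  by (auto simp: vfree_def vge_def vle_def)

lemma vge_mono: "vge v d f \<Longrightarrow> d' \<le> d \<Longrightarrow> vge v d' f"
  by (force simp: vge_def)

lemma vge_add: "vge v d f \<Longrightarrow> vge v d g \<Longrightarrow> vge v d (f + g)"
  unfolding vge_def plus_mfls.rep_eq by (metis add_0)

lemma vge_diff: "vge v d f \<Longrightarrow> vge v d g \<Longrightarrow> vge v d (f - g)"
  unfolding vge_def mfls_nth_minus by (metis diff_0_right)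

lemma vge_uminus: "vge v d f \<Longrightarrow> vge v d (- f)"
  unfolding vge_def uminus_mfls.rep_eq by simp

lemma vge_mult:
  assumes "vge v d f" "vge v d' g"
  shows "vge v (d + d') (f * g)"
  unfolding vge_def
proof safe
  fix e assume "mfls_nth (f * g) e \<noteq> 0"
  then obtain a where "mfls_nth f a \<noteq> 0" "mfls_nth g (e - a) \<noteq> 0"
    by (rule mfls_times_nonzeroE)
  then have "d \<le> Poly_Mapping.lookup a v" "d' \<le> Poly_Mapping.lookup (e - a) v"
    using assms by (auto simp: vge_def)
  then show "d + d' \<le> Poly_Mapping.lookup e v" by (simp add: lookup_minus)
qed

lemma vge_mult0: "vge v 0 f \<Longrightarrow> vge v 0 g \<Longrightarrow> vge v 0 (f * g)"
  using vge_mult[of v 0 f 0 g] by simp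

lemma vle_mult:
  assumes "vle v d f" "vle v d' g"
  shows "vle v (d + d') (f * g)"
  unfolding vle_def
proof safe
  fix e assume "mfls_nth (f * g) e \<noteq> 0"
  then obtain a where "mfls_nth f a \<noteq> 0" "mfls_nth g (e - a) \<noteq> 0"
    by (rule mfls_times_nonzeroE)
  then have "Poly_Mapping.lookup a v \<le> d" "Poly_Mapping.lookup (e - a) v \<le> d'"
    using assms by (auto simp: vle_def)
  then show "Poly_Mapping.lookup e v \<le> d + d'" by (simp add: lookup_minus)
qed

lemma vle_add: "vle v d f \<Longrightarrow> vle v d g \<Longrightarrow> vle v d (f + g)"
  unfolding vle_def plus_mfls.rep_eq by (metis add_0)

lemma vfree_add: "vfree v f \<Longrightarrow> vfree v g \<Longrightarrow> vfree v (f + g)"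
  unfolding vfree_def plus_mfls.rep_eq by (metis add_0)

lemma vfree_diff: "vfree v f \<Longrightarrow> vfree v g \<Longrightarrow> vfree v (f - g)"
  unfolding vfree_def mfls_nth_minus by (metis diff_0_right)

lemma vfree_uminus: "vfree v f \<Longrightarrow> vfree v (- f)"
  unfolding vfree_def uminus_mfls.rep_eq by simp

lemma vfree_iff: "vfree v f \<longleftrightarrow> vge v 0 f \<and> vle v 0 f"
  by (force simp: vfree_def vge_def vle_def)

lemma vfree_mult: "vfree v f \<Longrightarrow> vfree v g \<Longrightarrow> vfree v (f * g)"
  using vge_mult[of v 0 f 0 g] vle_mult[of v 0 f 0 g] by (simp add: vfree_iff)

lemma vfree_const: "vfree v (mfls_const c)"
  by (simp add: vfree_def mfls_const.rep_eq)

lemma vfree_0: "vfree v 0"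
  by (simp add: vfree_def zero_mfls.rep_eq)

lemma vfree_1: "vfree v 1"
  by (simp add: vfree_def one_mfls.rep_eq)

lemma vfree_X: "v \<noteq> w \<Longrightarrow> vfree v (mfls_X w)"
  by (auto simp: vfree_def mfls_X.rep_eq lookup_single when_def)

lemma vge_X: "vge v 1 (mfls_X v)"
  by (simp add: vge_def mfls_X.rep_eq lookup_single)

lemma vle_X: "vle v 1 (mfls_X v)"
  by (simp add: vle_def mfls_X.rep_eq lookup_single)

lemma vge_X0: "vge v 0 (mfls_X w)"
  by (cases "v = w") (auto simp: vge_def mfls_X.rep_eq lookup_single when_def)

lemma vfree_power: "vfree v f \<Longrightarrow> vfree v (f ^ n)"
  by (induction n) (simp_all add: vfree_1 vfree_mult)

lemma vge_power: "vge v d f \<Longrightarrow> vge v (int n * d) (f ^ n)"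
proof (induction n)
  case (Suc n)
  then show ?case
    using vge_mult[of v d f "int n * d" "f ^ n"] by (simp add: algebra_simps)
qed (simp add: vfreeD vfree_1)

lemma vle_power: "vle v d f \<Longrightarrow> vle v (int n * d) (f ^ n)"
proof (induction n)
  case (Suc n)
  then show ?case
    using vle_mult[of v d f "int n * d" "f ^ n"] by (simp add: algebra_simps)
qed (simp add: vfreeD vfree_1)

lemma vge_power0: "vge v 0 f \<Longrightarrow> vge v 0 (f ^ n)"
  using vge_power[of v 0 f n] by simp

lemma vfree_prod_list: "(\<And>f. f \<in> set fs \<Longrightarrow> vfree v f) \<Longrightarrow> vfree v (prod_list fs)"
  by (induction fs) (simp_all add: vfree_1 vfree_mult)

lemma vge_prod_list: "(\<And>f. f \<in> set fs \<Longrightarrow> vge v 0 f) \<Longrightarrow> vge v 0 (prod_list fs)"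
  by (induction fs) (simp_all add: vfreeD vfree_1 vge_mult0)

lemma constant_term_vge: "vge v 1 f \<Longrightarrow> constant_term f = 0"
  by (force simp: constant_term_def vge_def)

lemma constant_term_vle: "vle v (- 1) f \<Longrightarrow> constant_term f = 0"
  by (force simp: constant_term_def vle_def)

lift_definition vcomp :: "'v \<Rightarrow> int \<Rightarrow> ('v, 'a::zero) mfls \<Rightarrow> ('v, 'a) mfls" is
  "\<lambda>v d f e. if Poly_Mapping.lookup e v = d then f e else 0"
  by metis

lemma vfree_vcomp_0: "vfree v (vcomp v 0 f)"
  by (simp add: vfree_def vcomp.rep_eq)

text \<open>Degrees in \<open>v\<close> add, so a product term of total degree \<open>d + d'\<close>
  must use the lowest degree in both factors.\<close>

lemma vcomp_mult_lowest:
  fixes f g :: "('v, 'a::comm_ring_1) mfls"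
  assumes "vge v d f" "vge v d' g"
  shows "vcomp v (d + d') (f * g) = vcomp v d f * vcomp v d' g"
proof (rule mfls_eqI)
  fix e
  obtain mf where mf: "\<And>e. mfls_nth f e \<noteq> 0 \<Longrightarrow> exp_le mf e"
    using mfls_bound by blast
  obtain mg where mg: "\<And>e. mfls_nth g e \<noteq> 0 \<Longrightarrow> exp_le mg e"
    using mfls_bound by blast
  let ?S = "{a. mfls_nth f a \<noteq> 0 \<and> mfls_nth g (e - a) \<noteq> 0}"
  have fin: "finite ?S" using finite_conv_support[OF mf mg] .
  have r: "mfls_nth (vcomp v d f * vcomp v d' g) e =
      (\<Sum>a\<in>?S. mfls_nth (vcomp v d f) a * mfls_nth (vcomp v d' g) (e - a))"
    by (rule mfls_nth_times_superset[OF fin]) (auto simp: vcomp.rep_eq split: if_splits)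
  show "mfls_nth (vcomp v (d + d') (f * g)) e = mfls_nth (vcomp v d f * vcomp v d' g) e"
  proof (cases "Poly_Mapping.lookup e v = d + d'")
    case True
    have "Poly_Mapping.lookup a v = d \<and> Poly_Mapping.lookup (e - a) v = d'" if "a \<in> ?S" for a
    proof -
      have "d \<le> Poly_Mapping.lookup a v" "d' \<le> Poly_Mapping.lookup (e - a) v"
        using assms that by (auto simp: vge_def)
      with True show ?thesis by (simp add: lookup_minus)
    qed
    then show ?thesis
      using True unfolding r by (simp add: vcomp.rep_eq times_mfls.rep_eq)
  next
    case False
    have "mfls_nth (vcomp v d f) a * mfls_nth (vcomp v d' g) (e - a) = 0" for a
      using False by (auto simp: vcomp.rep_eq lookup_minus)
    then show ?thesis
      using False unfolding r by (simp add: vcomp.rep_eq)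
  qed
qed

text \<open>In a domain the product of the lowest parts of \<open>f\<close> and of its inverse is
  nonzero. If the inverse started in a negative degree \<open>d\<close>, that product would be the
  part of degree \<open>d\<close> of 1, which is 0.\<close>

lemma vge_inverse:
  fixes f :: "('v::linorder, 'a::idom) mfls"
  assumes u: "f dvd 1" and f: "vge v 0 f" and e0: "mfls_nth f e0 \<noteq> 0" "Poly_Mapping.lookup e0 v = 0"
  shows "vge v 0 (inverse f)"
proof (rule ccontr)
  let ?g = "inverse f"
  assume "\<not> vge v 0 ?g"
  then obtain e1 where e1: "mfls_nth ?g e1 \<noteq> 0" "Poly_Mapping.lookup e1 v < 0"
    by (auto simp: vge_def)
  obtain m where m: "\<And>e. mfls_nth ?g e \<noteq> 0 \<Longrightarrow> exp_le m e"
    using mfls_bound by blast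
  define N where "N e = nat (Poly_Mapping.lookup e v - Poly_Mapping.lookup m v)" for e :: "'v \<Rightarrow>\<^sub>0 int"
  obtain e2 where e2: "mfls_nth ?g e2 \<noteq> 0" "\<And>e. mfls_nth ?g e \<noteq> 0 \<Longrightarrow> N e2 \<le> N e"
    using ex_has_least_nat[of "\<lambda>e. mfls_nth ?g e \<noteq> 0" e1 N] e1 by blast
  define d where "d = Poly_Mapping.lookup e2 v"
  have low: "vge v d ?g"
    unfolding vge_def
  proof safe
    fix e assume e: "mfls_nth ?g e \<noteq> 0"
    have "Poly_Mapping.lookup m v \<le> Poly_Mapping.lookup e v" "Poly_Mapping.lookup m v \<le> Poly_Mapping.lookup e2 v"
      using m[OF e] m[OF e2(1)] by (simp_all add: exp_le_def)
    then show "d \<le> Poly_Mapping.lookup e v"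
      using e2(2)[OF e] by (simp add: N_def d_def)
  qed
  have "d < 0"
    using low e1 unfolding vge_def by force
  have "vcomp v 0 f * vcomp v d ?g = vcomp v d 1"
    using vcomp_mult_lowest[OF f low] mfls_inverse_right[OF u] by simp
  also have "\<dots> = 0"
    using \<open>d < 0\<close> by (intro mfls_eqI) (auto simp: vcomp.rep_eq one_mfls.rep_eq zero_mfls.rep_eq)
  finally have "vcomp v 0 f = 0 \<or> vcomp v d ?g = 0" by simp
  moreover have "mfls_nth (vcomp v 0 f) e0 \<noteq> 0" "mfls_nth (vcomp v d ?g) e2 \<noteq> 0"
    using e0 e2 by (simp_all add: vcomp.rep_eq d_def)
  ultimately show False by (auto simp: zero_mfls.rep_eq)
qed

lemma vge_inverse_series:
  fixes f :: "('v::linorder, 'a::field) mfls"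
  assumes "\<And>w. vge w 0 f" and "constant_term f \<noteq> 0"
  shows "f dvd 1" "vge v 0 (inverse f)"
proof -
  show "f dvd 1"
    by (rule mfls_unitI) (use assms in \<open>auto simp: vge_def exp_le_def constant_term_def\<close>)
  then show "vge v 0 (inverse f)"
    by (rule vge_inverse[of _ _ 0]) (use assms in \<open>auto simp: constant_term_def\<close>)
qed

text \<open>Extracting the part of degree 0 in \<open>v\<close> commutes with multiplication by a
  series free of \<open>v\<close>. Applied to \<open>f * inverse f = 1\<close> it yields another
  inverse of \<open>f\<close>, and inverses are unique.\<close>

lemma vfree_inverse:
  fixes f :: "('v, 'a::comm_ring_1) mfls"
  assumes u: "f dvd 1" and f: "vfree v f"
  shows "vfree v (inverse f)"
proof -
  let ?g = "inverse f"
  have "f * vcomp v 0 ?g = 1"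
  proof (rule mfls_eqI)
    fix e
    obtain mf where mf: "\<And>e. mfls_nth f e \<noteq> 0 \<Longrightarrow> exp_le mf e"
      using mfls_bound by blast
    obtain mg where mg: "\<And>e. mfls_nth ?g e \<noteq> 0 \<Longrightarrow> exp_le mg e"
      using mfls_bound by blast
    let ?S = "{a. mfls_nth f a \<noteq> 0 \<and> mfls_nth ?g (e - a) \<noteq> 0}"
    have "mfls_nth (f * vcomp v 0 ?g) e = (\<Sum>a\<in>?S. mfls_nth f a * mfls_nth (vcomp v 0 ?g) (e - a))"
      by (rule mfls_nth_times_superset[OF finite_conv_support[OF mf mg]])
         (auto simp: vcomp.rep_eq split: if_splits)
    also have "\<dots> = (\<Sum>a\<in>?S. if Poly_Mapping.lookup e v = 0 then mfls_nth f a * mfls_nth ?g (e - a) else 0)"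
      by (rule sum.cong) (use f in \<open>auto simp: vfree_def vcomp.rep_eq lookup_minus\<close>)
    also have "\<dots> = (if Poly_Mapping.lookup e v = 0 then mfls_nth (f * ?g) e else 0)"
      by (simp add: times_mfls.rep_eq)
    also have "\<dots> = mfls_nth 1 e"
      by (auto simp: mfls_inverse_right[OF u] one_mfls.rep_eq)
    finally show "mfls_nth (f * vcomp v 0 ?g) e = mfls_nth 1 e" .
  qed
  then have "inverse f = vcomp v 0 ?g" by (rule mfls_inverse_eqI)
  then show ?thesis by (metis vfree_vcomp_0)
qed

lemma mfls_perm_vfree:
  assumes bij: "bij \<sigma>" and f: "\<And>v. \<sigma> v \<noteq> v \<Longrightarrow> vfree v f"
  shows "mfls_perm \<sigma> f = f"
proof (rule mfls_eqI)
  fix e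
  have k: "Poly_Mapping.map_key \<sigma> e = e" if "\<And>v. \<sigma> v \<noteq> v \<Longrightarrow> Poly_Mapping.lookup e v = 0" for e :: "'a \<Rightarrow>\<^sub>0 int"
  proof (rule poly_mapping_eqI)
    fix v
    show "Poly_Mapping.lookup (Poly_Mapping.map_key \<sigma> e) v = Poly_Mapping.lookup e v"
    proof (cases "\<sigma> v = v")
      case False
      then have "\<sigma> (\<sigma> v) \<noteq> \<sigma> v" using bij by (metis bij_pointE)
      then show ?thesis using that False by (simp add: lookup_map_key[OF bij])
    qed (simp add: lookup_map_key[OF bij])
  qed
  show "mfls_nth (mfls_perm \<sigma> f) e = mfls_nth f e"
  proof (cases "mfls_nth f e = 0")
    case False
    then have "Poly_Mapping.map_key \<sigma> e = e" using f by (intro k) (auto simp: vfree_def)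
    then show ?thesis by (simp add: mfls_nth_perm[OF bij])
  next
    case True
    have "mfls_nth f (Poly_Mapping.map_key \<sigma> e) = 0"
    proof (rule ccontr)
      assume nz: "mfls_nth f (Poly_Mapping.map_key \<sigma> e) \<noteq> 0"
      then have "Poly_Mapping.map_key \<sigma> (Poly_Mapping.map_key \<sigma> e) = Poly_Mapping.map_key \<sigma> e"
        using f by (intro k) (auto simp: vfree_def)
      then have "Poly_Mapping.map_key \<sigma> e = e"
        using map_key_bij[OF bij] by (metis bij_is_inj injD)
      with nz True show False by simp
    qed
    then show ?thesis using True by (simp add: mfls_nth_perm[OF bij])
  qed
qed

text \<open>Ring inverses of units become field inverses, so identities between rational expressions
  can be settled by field arithmetic.\<close>

lemma to_fract_inverse_unit:
  fixes f :: "('v::linorder, 'a::idom) mfls"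
  assumes "f dvd 1"
  shows "to_fract (inverse f) = inverse (to_fract f)"
proof -
  have "to_fract f * to_fract (inverse f) = 1"
    by (metis mfls_inverse_right[OF assms] to_fract_mult to_fract_1)
  then show ?thesis by (metis inverse_unique)
qed

lemma to_fract_inject: "to_fract a = to_fract b \<longleftrightarrow> a = b"
  by (simp add: to_fract_eq_iff)

section \<open>Products over pairs and Lagrange interpolation\<close>

text \<open>The pairs follow the order of the list, so that the asymmetry of \<open>f\<close> is
  kept and a reordering of the variables is a reordering of the list.\<close>

fun pairprod :: "('i \<Rightarrow> 'i \<Rightarrow> 'a::comm_monoid_mult) \<Rightarrow> 'i list \<Rightarrow> 'a" where
  "pairprod f [] = 1"
| "pairprod f (r # rs) = (\<Prod>t\<leftarrow>rs. f r t) * pairprod f rs"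

lemma pairprod_split:
  "pairprod f (pre @ c # post) =
     pairprod f (pre @ post) * ((\<Prod>r\<leftarrow>pre. f r c) * (\<Prod>r\<leftarrow>post. f c r))"
  by (induction pre) (simp_all add: ac_simps)

lemma pairprod_snoc: "pairprod f (rs @ [r]) = pairprod f rs * (\<Prod>s\<leftarrow>rs. f s r)"
  using pairprod_split[of f rs r "[]"] by simp

lemma prod_list_mult_distrib:
  "(\<Prod>r\<leftarrow>rs. f r * g r) = (\<Prod>r\<leftarrow>rs. f r) * (\<Prod>r\<leftarrow>rs. g r :: 'a::comm_monoid_mult)"
  by (induction rs) (simp_all add: ac_simps)

lemma pairprod_mult: "pairprod (\<lambda>s t. f s t * g s t) rs = pairprod f rs * pairprod g rs"
  by (induction rs) (simp_all add: prod_list_mult_distrib ac_simps)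

lemma pairprod_hom:
  assumes "h 1 = 1" "\<And>a b. h (a * b) = h a * h b"
  shows "h (pairprod f rs) = pairprod (\<lambda>s t. h (f s t)) rs"
proof (induction rs)
  case (Cons r rs)
  have "h (\<Prod>t\<leftarrow>ts. f r t) = (\<Prod>t\<leftarrow>ts. h (f r t))" for ts
    by (induction ts) (simp_all add: assms)
  with Cons show ?case by (simp add: assms)
qed (simp add: assms)

lemma pairprod_map: "pairprod f (map h rs) = pairprod (\<lambda>s t. f (h s) (h t)) rs"
  by (induction rs) (simp_all add: o_def)

lemma pairprod_pow:
  "pairprod (\<lambda>s t. f s * f t) rs = (\<Prod>r\<leftarrow>rs. f r :: 'a::comm_monoid_mult) ^ (length rs - 1)"
proof (induction rs)
  case (Cons r rs)
  have c: "(\<Prod>t\<leftarrow>rs. f r * f t) = f r ^ length rs * (\<Prod>t\<leftarrow>rs. f t)"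
    by (induction rs) (simp_all add: ac_simps)
  show ?case
  proof (cases rs)
    case (Cons a as)
    then have "length rs = Suc (length rs - 1)" by simp
    then have "(\<Prod>t\<leftarrow>rs. f t) ^ length rs = (\<Prod>t\<leftarrow>rs. f t) * (\<Prod>t\<leftarrow>rs. f t) ^ (length rs - 1)"
      by (metis power_Suc)
    with c Cons.IH show ?thesis by (simp add: power_mult_distrib ac_simps)
  qed simp
qed simp

text \<open>Exchanging neighbours reverses a single pair; all other pairs form the common cofactor
  \<open>R\<close>.\<close>

lemma pairprod_swap:
  obtains R where "pairprod f (pre @ a # b # post) = f a b * R"
    "pairprod f (pre @ b # a # post) = f b a * R"
proof -
  have "\<exists>R. pairprod f (pre @ a # b # post) = f a b * R \<and> pairprod f (pre @ b # a # post) = f b a * R"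
  proof (induction pre)
    case Nil
    show ?case
      by (rule exI[of _ "(\<Prod>t\<leftarrow>post. f a t) * (\<Prod>t\<leftarrow>post. f b t) * pairprod f post"])
         (simp add: ac_simps)
  next
    case (Cons p pre)
    then obtain R where "pairprod f (pre @ a # b # post) = f a b * R"
      "pairprod f (pre @ b # a # post) = f b a * R" by blast
    then show ?case
      by (intro exI[of _ "(\<Prod>t\<leftarrow>pre @ a # b # post. f p t) * R"]) (simp add: ac_simps)
  qed
  with that show ?thesis by blast
qed

lemma pairprod_rotate:
  fixes f :: "'i \<Rightarrow> 'i \<Rightarrow> 'a::comm_ring_1"
  assumes "\<And>s t. f s t = - f t s"
  shows "pairprod f (pre @ mid @ c # post) = (- 1) ^ length mid * pairprod f (pre @ c # mid @ post)"
proof -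
  have "f r c = - 1 * f c r" for r
    using assms[of r c] by simp
  then have "(\<Prod>r\<leftarrow>mid. f r c) = (\<Prod>r\<leftarrow>mid. - 1 * f c r)"
    by (simp only:)
  also have "\<dots> = (- 1) ^ length mid * (\<Prod>r\<leftarrow>mid. f c r)"
    by (induction mid) simp_all
  finally show ?thesis
    using pairprod_split[of f "pre @ mid" c post] pairprod_split[of f pre c "mid @ post"]
    by (simp add: ac_simps)
qed

text \<open>Having degree below the number of nodes, \<open>p\<close> equals its interpolation
  polynomial; the identity compares the top coefficients of the two.\<close>

lemma lagrange_leading_coeff:
  fixes v :: "'i \<Rightarrow> 'k::field"
  assumes A: "finite A" "inj_on v A" and p: "degree p < card A"
  shows "(\<Sum>i\<in>A. poly p (v i) / (\<Prod>j\<in>A - {i}. v i - v j)) = coeff p (card A - 1)"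
proof -
  define c where "c i = poly p (v i) / (\<Prod>j\<in>A - {i}. v i - v j)" for i
  define B where "B i = (\<Prod>j\<in>A - {i}. [:- v j, 1:])" for i
  have monic: "lead_coeff (B i) = 1" for i
  proof -
    have "lead_coeff (B i) = (\<Prod>j\<in>A - {i}. lead_coeff [:- v j, 1:])"
      unfolding B_def by (rule lead_coeff_prod)
    then show ?thesis by simp
  qed
  have deg: "degree (B i) = card A - 1" if "i \<in> A" for i
  proof -
    have "degree (B i) = (\<Sum>j\<in>A - {i}. degree [:- v j, 1:])"
      unfolding B_def by (rule degree_prod_eq_sum_degree) simp
    also have "\<dots> = card A - 1" using that A by simp
    finally show ?thesis .
  qed
  define L where "L = (\<Sum>i\<in>A. smult (c i) (B i))"
  have pB: "poly (B i) (v j) = (\<Prod>k\<in>A - {i}. v j - v k)" for i j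
    by (simp add: B_def poly_prod)
  have pL: "poly L (v j) = poly p (v j)" if j: "j \<in> A" for j
  proof -
    have "poly L (v j) = (\<Sum>i\<in>A. c i * poly (B i) (v j))"
      by (simp add: L_def poly_sum)
    also have "\<dots> = (\<Sum>i\<in>A. if i = j then poly p (v j) else 0)"
    proof (rule sum.cong[OF refl])
      fix i assume i: "i \<in> A"
      show "c i * poly (B i) (v j) = (if i = j then poly p (v j) else 0)"
      proof (cases "i = j")
        case True
        have "(\<Prod>k\<in>A - {j}. v j - v k) \<noteq> 0"
          using A j by (auto simp: inj_on_def)
        then show ?thesis using True by (simp add: c_def pB)
      next
        case False
        have "poly (B i) (v j) = 0"
          unfolding pB using A(1) j False by (intro prod_zero) auto
        then show ?thesis using False by simp
      qed
    qed
    finally show ?thesis using A(1) j by simp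
  qed
  have "degree L \<le> card A - 1"
    unfolding L_def
  proof (rule degree_sum_le[OF A(1)])
    fix i assume "i \<in> A"
    then show "degree (smult (c i) (B i)) \<le> card A - 1"
      using degree_smult_le[of "c i" "B i"] deg by simp
  qed
  then have "degree L < card A" using p by linarith
  moreover have "card (v ` A) = card A" using A by (simp add: card_image)
  ultimately have "L = p"
    using p pL by (intro poly_eqI_degree[of "v ` A"]) auto
  have "coeff L (card A - 1) = (\<Sum>i\<in>A. c i * coeff (B i) (card A - 1))"
    by (simp add: L_def coeff_sum)
  also have "\<dots> = (\<Sum>i\<in>A. c i)"
  proof (rule sum.cong[OF refl])
    fix i assume "i \<in> A"
    then show "c i * coeff (B i) (card A - 1) = c i"
      using monic[of i] deg[of i] by simp
  qed
  finally show ?thesis using \<open>L = p\<close> by (simp add: c_def)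
qed

definition del_nth :: "nat \<Rightarrow> 'a list \<Rightarrow> 'a list" where
  "del_nth j xs = take j xs @ drop (Suc j) xs"

lemma split_at_nth: "j < length xs \<Longrightarrow> xs = take j xs @ xs ! j # drop (Suc j) xs"
  by (rule id_take_nth_drop)

lemma prod_list_take_drop:
  fixes f :: "'i \<Rightarrow> 'a::comm_monoid_mult"
  assumes "j < length rs"
  shows "(\<Prod>r\<leftarrow>del_nth j rs. f r) = (\<Prod>i\<in>{..<length rs} - {j}. f (rs ! i))"
proof -
  have conv: "(\<Prod>r\<leftarrow>xs. f r) = (\<Prod>i<length xs. f (xs ! i))" for xs
    by (induction xs) (simp_all add: prod.lessThan_Suc_shift del: prod.lessThan_Suc)
  have "(\<Prod>r\<leftarrow>del_nth j rs. f r) = (\<Prod>i<j. f (rs ! i)) * (\<Prod>i<length rs - Suc j. f (rs ! (Suc j + i)))"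
    using assms by (simp add: del_nth_def conv)
  also have "(\<Prod>i<length rs - Suc j. f (rs ! (Suc j + i))) = (\<Prod>i\<in>{Suc j..<length rs}. f (rs ! i))"
    using assms by (intro prod.reindex_bij_witness[of _ "\<lambda>i. i - Suc j" "\<lambda>i. Suc j + i"]) auto
  also have "(\<Prod>i<j. f (rs ! i)) * (\<Prod>i\<in>{Suc j..<length rs}. f (rs ! i)) =
      (\<Prod>i\<in>{..<length rs} - {j}. f (rs ! i))"
    using assms by (subst prod.union_disjoint[symmetric]) (auto intro!: prod.cong)
  finally show ?thesis .
qed

lemma pairprod_diff_del_nth:
  fixes v :: "'i \<Rightarrow> 'a::comm_ring_1"
  assumes "j < length rs"
  shows "pairprod (\<lambda>s t. v t - v s) rs = (- 1) ^ (length rs - 1 - j) *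
    pairprod (\<lambda>s t. v t - v s) (del_nth j rs) * (\<Prod>s\<leftarrow>del_nth j rs. v (rs ! j) - v s)"
proof -
  have m: "(\<Prod>r\<leftarrow>xs. v r - c) = (- 1) ^ length xs * (\<Prod>r\<leftarrow>xs. c - v r)" for xs c
    by (induction xs) (simp_all add: algebra_simps)
  show ?thesis
    by (subst split_at_nth[OF assms], subst pairprod_split)
       (simp add: del_nth_def m[of _ "drop _ _"] ac_simps)
qed

text \<open>Expansion of the Vandermonde determinant along the highest powers. It is Lagrange
  interpolation of the monomial of degree \<open>length rs - 1\<close>, whose top coefficient is
  1.\<close>

lemma vandermonde_laplace:
  fixes v :: "'i \<Rightarrow> 'a::idom"
  assumes rs: "distinct (map v rs)" "rs \<noteq> []"
  shows "pairprod (\<lambda>s t. v t - v s) rs =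
    (\<Sum>j<length rs. (- 1) ^ (length rs - 1 - j) * v (rs ! j) ^ (length rs - 1) *
        pairprod (\<lambda>s t. v t - v s) (del_nth j rs))"
proof -
  define n where "n = length rs"
  define w where "w i = to_fract (v (rs ! i))" for i
  define V where "V = to_fract (pairprod (\<lambda>s t. v t - v s) rs)"
  define D where "D j = to_fract (pairprod (\<lambda>s t. v t - v s) (del_nth j rs))" for j
  define p where "p = monom (1 :: 'a fract) (n - 1)"
  have n: "n > 0" using rs(2) by (simp add: n_def)
  have inj: "inj_on w {..<n}"
    using rs(1) by (auto simp: inj_on_def w_def n_def distinct_conv_nth)
  have V: "V = (- 1) ^ (n - 1 - j) * D j * (\<Prod>i\<in>{..<n} - {j}. w j - w i)" if "j < n" for j
  proof -
    have "to_fract (\<Prod>s\<leftarrow>xs. v c - v s) = (\<Prod>s\<leftarrow>xs. to_fract (v c) - to_fract (v s))" for xs c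
      by (induction xs) simp_all
    then have "to_fract (\<Prod>s\<leftarrow>del_nth j rs. v (rs ! j) - v s) = (\<Prod>i\<in>{..<n} - {j}. w j - w i)"
      using that by (simp only:) (simp add: prod_list_take_drop n_def w_def)
    moreover have "to_fract ((- 1) ^ k) = (- 1 :: 'a fract) ^ k" for k
      by (induction k) simp_all
    ultimately show ?thesis
      using that unfolding V_def D_def n_def by (subst pairprod_diff_del_nth[of j]) simp_all
  qed
  have "(\<Sum>i<n. poly p (w i) / (\<Prod>j\<in>{..<n} - {i}. w i - w j)) = coeff p (card {..<n} - 1)"
    by (rule lagrange_leading_coeff) (use inj n in \<open>auto simp: p_def degree_monom_eq\<close>)
  then have "V = V * (\<Sum>i<n. w i ^ (n - 1) / (\<Prod>j\<in>{..<n} - {i}. w i - w j))"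
    by (simp add: p_def poly_monom)
  also have "\<dots> = (\<Sum>i<n. V * (w i ^ (n - 1) / (\<Prod>j\<in>{..<n} - {i}. w i - w j)))"
    by (rule sum_distrib_left)
  also have "\<dots> = (\<Sum>i<n. (- 1) ^ (n - 1 - i) * w i ^ (n - 1) * D i)"
  proof (rule sum.cong[OF refl])
    fix i assume i: "i \<in> {..<n}"
    have nz: "(\<Prod>j\<in>{..<n} - {i}. w i - w j) \<noteq> 0"
      using inj i by (auto simp: inj_on_def)
    show "V * (w i ^ (n - 1) / (\<Prod>j\<in>{..<n} - {i}. w i - w j)) = (- 1) ^ (n - 1 - i) * w i ^ (n - 1) * D i"
      using V[of i] i nz by simp
  qed
  also have "\<dots> = to_fract (\<Sum>j<n. (- 1) ^ (n - 1 - j) * v (rs ! j) ^ (n - 1) *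
        pairprod (\<lambda>s t. v t - v s) (del_nth j rs))"
  proof -
    have pw: "to_fract (a ^ k) = to_fract a ^ k" for a :: 'a and k
      by (induction k) simp_all
    have sm: "to_fract (\<Sum>i<k. f i) = (\<Sum>i<k. to_fract (f i))" for f :: "nat \<Rightarrow> 'a" and k
      by (induction k) simp_all
    have "to_fract (-1 :: 'a) = -1" by simp
    then show ?thesis unfolding sm by (simp add: w_def D_def pw)
  qed
  finally show ?thesis by (simp only: V_def to_fract_inject n_def)
qed

text \<open>In the coordinate \<open>v = x + Q/x\<close> each factor below is a Moebius function of \<open>v\<close> that takes the
  value \<open>1\<close> at \<open>v = - Q\<close>; the identity is Lagrange interpolation at the nodes \<open>v\<^sub>s\<close> and \<open>- Q\<close>.\<close>

lemma symmetrizer_identity_field: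
  fixes x :: "'i \<Rightarrow> 'k::field" and Q :: 'k
  defines "q \<equiv> \<lambda>i. Q + (Q - 1) * x i"
  defines "y \<equiv> \<lambda>i. - x i / ((1 + x i) * q i)"
  assumes A: "finite A" "inj_on x A"
    and nz: "\<And>i. i \<in> A \<Longrightarrow> x i \<noteq> 0" "\<And>i. i \<in> A \<Longrightarrow> 1 + x i \<noteq> 0" "\<And>i. i \<in> A \<Longrightarrow> q i \<noteq> 0"
    and nz2: "\<And>i j. i \<in> A \<Longrightarrow> j \<in> A \<Longrightarrow> i \<noteq> j \<Longrightarrow> Q - x i * x j \<noteq> 0"
    and nz3: "\<And>i. i \<in> A \<Longrightarrow> Q + Q * x i + x i * x i \<noteq> 0"
  shows "(\<Sum>c\<in>A. (1 - y c) * (\<Prod>s\<in>A - {c}. (Q + (Q - 1) * x s + x c + x s * x c) * y s *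
      (Q * (1 + x s) * (1 + x c) - x s * x c) / ((x c - x s) * (Q - x s * x c)))) = 1 - (\<Prod>s\<in>A. y s)"
proof -
  define v where "v i = (case i of None \<Rightarrow> - Q | Some i \<Rightarrow> x i + Q / x i)" for i
  define a where "a i = q i ^ 2 + Q * (1 + x i) ^ 2" for i
  define b where "b i = (1 + x i) * q i" for i
  \<comment> \<open>The degree of \<open>p\<close> is \<open>card A\<close> and there are
    \<open>card A + 1\<close> nodes, so interpolation returns its leading coefficient, the product
    of the \<open>b s\<close>.\<close>
  define p where "p = (\<Prod>s\<in>A. [:a s, b s:])"
  define B where "B = insert None (Some ` A)"
  have vdiff: "v (Some c) - v (Some s) = (x c - x s) * (x s * x c - Q) / (x s * x c)" if "c \<in> A" "s \<in> A" for c s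
    using nz(1) that by (simp add: v_def field_simps)
  have vQ: "v (Some c) - v None = (Q + Q * x c + x c * x c) / x c" if "c \<in> A" for c
    using nz(1) that by (simp add: v_def field_simps)
  have bnz: "b i \<noteq> 0" if "i \<in> A" for i using nz that by (simp add: b_def)
  have B: "finite B" "card B = Suc (card A)"
    using A(1) by (auto simp: B_def card_image card_insert_if)
  have inj: "inj_on v B"
  proof (rule inj_onI)
    fix i j assume ij: "i \<in> B" "j \<in> B" "v i = v j"
    have 1: "c = s" if "c \<in> A" "s \<in> A" "v (Some c) = v (Some s)" for c s
    proof (rule ccontr)
      assume "c \<noteq> s"
      then have "x c - x s \<noteq> 0" using A(2) that by (auto simp: inj_on_def)
      moreover have "x s * x c - Q \<noteq> 0" using nz2[OF that(2,1)] \<open>c \<noteq> s\<close> by auto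
      ultimately show False using vdiff[OF that(1,2)] that nz(1) by simp
    qed
    have 2: "v (Some c) \<noteq> v None" if "c \<in> A" for c
      using vQ[OF that] nz3[OF that] nz(1)[OF that] by auto
    show "i = j"
    proof (cases i)
      case None
      then show ?thesis using ij 2 by (cases j) (auto simp: B_def)
    next
      case (Some c)
      then show ?thesis using ij 1 2 by (cases j) (auto simp: B_def)
    qed
  qed
  have degp: "degree p = card A"
  proof -
    have "degree p = (\<Sum>s\<in>A. degree [:a s, b s:])"
      unfolding p_def using bnz by (intro degree_prod_eq_sum_degree) auto
    also have "\<dots> = card A" using bnz by simp
    finally show ?thesis .
  qed
  have coeffp: "coeff p (card A) = (\<Prod>s\<in>A. b s)"
  proof -
    have "lead_coeff p = (\<Prod>s\<in>A. lead_coeff [:a s, b s:])"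
      unfolding p_def by (rule lead_coeff_prod)
    also have "\<dots> = (\<Prod>s\<in>A. b s)"
      using bnz by (intro prod.cong) auto
    finally show ?thesis by (simp add: degp)
  qed
  have pv: "poly p t = (\<Prod>s\<in>A. a s + t * b s)" for t
    by (simp add: p_def poly_prod)
  have "(\<Sum>i\<in>B. poly p (v i) / (\<Prod>j\<in>B - {i}. v i - v j)) = (\<Prod>s\<in>A. b s)"
    using lagrange_leading_coeff[OF B(1) inj, of p] degp coeffp B(2) by simp
  also have "(\<Sum>i\<in>B. poly p (v i) / (\<Prod>j\<in>B - {i}. v i - v j)) =
      poly p (v None) / (\<Prod>j\<in>A. v None - v (Some j)) +
      (\<Sum>c\<in>A. poly p (v (Some c)) / ((v (Some c) - v None) * (\<Prod>j\<in>A - {c}. v (Some c) - v (Some j))))"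
  proof -
    have "B - {None} = Some ` A" by (auto simp: B_def)
    then have N: "(\<Prod>j\<in>B - {None}. v None - v j) = (\<Prod>j\<in>A. v None - v (Some j))"
      by (simp add: prod.reindex)
    have S: "(\<Prod>j\<in>B - {Some c}. v (Some c) - v j) =
        (v (Some c) - v None) * (\<Prod>j\<in>A - {c}. v (Some c) - v (Some j))" for c
    proof -
      have "B - {Some c} = insert None (Some ` (A - {c}))" by (auto simp: B_def)
      then show ?thesis using A(1) by (simp add: prod.reindex)
    qed
    have "(\<Sum>i\<in>B. f i) = f None + (\<Sum>c\<in>A. f (Some c))" for f :: "_ \<Rightarrow> 'k"
      unfolding B_def using A(1) by (simp add: sum.reindex)
    then show ?thesis by (simp only: N S)
  qed
  \<comment> \<open>At the node \<open>- Q\<close> each linear factor is \<open>- x s\<close> times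
    a node difference; after division by the product of the \<open>b s\<close> this is the product
    of the \<open>y s\<close> in the conclusion.\<close>
  also have "poly p (v None) / (\<Prod>j\<in>A. v None - v (Some j)) = (\<Prod>s\<in>A. - x s)"
  proof -
    have "(a s + v None * b s) = - x s * (v None - v (Some s))" if "s \<in> A" for s
      using nz(1)[OF that] by (simp add: a_def b_def q_def v_def field_simps power2_eq_square)
    moreover have "v None - v (Some s) \<noteq> 0" if "s \<in> A" for s
      using vQ[OF that] nz3[OF that] nz(1)[OF that] by auto
    ultimately show ?thesis
      unfolding pv prod_dividef[symmetric] by (intro prod.cong) auto
  qed
  finally have main: "(\<Prod>s\<in>A. - x s) + (\<Sum>c\<in>A. poly p (v (Some c)) /
      ((v (Some c) - v None) * (\<Prod>j\<in>A - {c}. v (Some c) - v (Some j)))) = (\<Prod>s\<in>A. b s)" .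
  have bp: "(\<Prod>s\<in>A. b s) \<noteq> 0" using A(1) bnz by simp
  have yb: "y s = - x s / b s" for s by (simp add: y_def b_def)
  have yp: "(\<Prod>s\<in>A. - x s) = (\<Prod>s\<in>A. y s) * (\<Prod>s\<in>A. b s)"
    unfolding prod.distrib[symmetric] using bnz by (intro prod.cong) (auto simp: yb)
  \<comment> \<open>The origin of \<open>a\<close> and \<open>b\<close>: at the node of
    \<open>c\<close> the linear factor of \<open>s\<close> splits into the two polynomials in the
    numerator of the summand.\<close>
  have wt: "a s + v (Some c) * b s = (Q + (Q - 1) * x s + x c + x s * x c) *
      (Q * (1 + x s) * (1 + x c) - x s * x c) / x c" if "c \<in> A" for s c
    using nz(1)[OF that] by (simp add: a_def b_def q_def v_def field_simps power2_eq_square)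
  have summand: "poly p (v (Some c)) / ((v (Some c) - v None) * (\<Prod>j\<in>A - {c}. v (Some c) - v (Some j))) =
      (1 - y c) * (\<Prod>s\<in>A - {c}. (Q + (Q - 1) * x s + x c + x s * x c) * y s *
      (Q * (1 + x s) * (1 + x c) - x s * x c) / ((x c - x s) * (Q - x s * x c))) * (\<Prod>s\<in>A. b s)"
    if c: "c \<in> A" for c
  proof -
    have "poly p (v (Some c)) / ((v (Some c) - v None) * (\<Prod>j\<in>A - {c}. v (Some c) - v (Some j))) =
      (a c + v (Some c) * b c) / (v (Some c) - v None) *
      (\<Prod>s\<in>A - {c}. (a s + v (Some c) * b s) / (v (Some c) - v (Some s)))"
      unfolding pv using c A(1) by (simp add: prod.remove[of A c] prod_dividef)
    \<comment> \<open>For \<open>s = c\<close> the first factor in \<open>wt\<close> is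
      \<open>x c\<close> times the distance from the node \<open>- Q\<close> and cancels against it;
      the second one is \<open>1 - y c\<close> up to \<open>b c\<close>.\<close>
    also have "(a c + v (Some c) * b c) / (v (Some c) - v None) = (1 - y c) * b c"
    proof -
      have "(a c + v (Some c) * b c) / (v (Some c) - v None) = Q * (1 + x c) * (1 + x c) - x c * x c"
      proof -
        have e: "Q + (Q - 1) * x c + x c + x c * x c = Q + Q * x c + x c * x c"
          by (simp add: algebra_simps)
        show ?thesis
          unfolding wt[OF c] vQ[OF c] e using nz(1)[OF c] nz3[OF c] by simp
      qed
      also have "\<dots> = (1 - y c) * b c"
        using bnz[OF c] by (simp add: yb field_simps) (simp add: b_def q_def algebra_simps)
      finally show ?thesis .
    qed
    also have "(\<Prod>s\<in>A - {c}. (a s + v (Some c) * b s) / (v (Some c) - v (Some s))) =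
      (\<Prod>s\<in>A - {c}. (Q + (Q - 1) * x s + x c + x s * x c) * y s *
      (Q * (1 + x s) * (1 + x c) - x s * x c) / ((x c - x s) * (Q - x s * x c)) * b s)"
    proof (rule prod.cong[OF refl])
      fix s assume s: "s \<in> A - {c}"
      have d: "x c - x s \<noteq> 0" using A(2) s c by (auto simp: inj_on_def)
      have e: "Q - x s * x c \<noteq> 0" using nz2[of s c] s c by auto
      then have e': "x s * x c - Q \<noteq> 0" by auto
      show "(a s + v (Some c) * b s) / (v (Some c) - v (Some s)) =
        (Q + (Q - 1) * x s + x c + x s * x c) * y s *
        (Q * (1 + x s) * (1 + x c) - x s * x c) / ((x c - x s) * (Q - x s * x c)) * b s" (is "?l = _")
      proof -
        define w where "w = (Q + (Q - 1) * x s + x c + x s * x c) * (Q * (1 + x s) * (1 + x c) - x s * x c)"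
        have "?l = w / x c / ((x c - x s) * (x s * x c - Q) / (x s * x c))"
          using s c by (simp add: wt vdiff w_def)
        also have "\<dots> = w * x s / ((x c - x s) * (x s * x c - Q))"
          using nz(1)[of s] nz(1)[of c] s c d e' by (simp add: field_simps)
        also have "\<dots> = w * (- x s) / ((x c - x s) * (Q - x s * x c))"
          using d e e' by (simp add: divide_simps) (simp add: algebra_simps)
        also have "- x s = y s * b s" using bnz[of s] s by (simp add: yb)
        finally show ?thesis by (simp add: w_def ac_simps)
      qed
    qed
    also note prod.distrib
    also have "(1 - y c) * b c * (Z * (\<Prod>s\<in>A - {c}. b s)) = (1 - y c) * Z * (\<Prod>s\<in>A. b s)" for Z
      using c A(1) by (simp add: prod.remove[of A c b] ac_simps)
    finally show ?thesis .
  qed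
  define S where "S = (\<Sum>c\<in>A. (1 - y c) * (\<Prod>s\<in>A - {c}. (Q + (Q - 1) * x s + x c + x s * x c) * y s *
      (Q * (1 + x s) * (1 + x c) - x s * x c) / ((x c - x s) * (Q - x s * x c))))"
  have "(\<Prod>s\<in>A. y s) * (\<Prod>s\<in>A. b s) + S * (\<Prod>s\<in>A. b s) = (\<Prod>s\<in>A. b s)"
    using main unfolding yp by (simp add: summand S_def sum_distrib_right)
  then have "((\<Prod>s\<in>A. y s) + S) * (\<Prod>s\<in>A. b s) = 1 * (\<Prod>s\<in>A. b s)"
    by (simp add: distrib_right)
  then have "(\<Prod>s\<in>A. y s) + S = 1" using bp by (simp only: mult_cancel_right) simp
  then show ?thesis unfolding S_def by (simp add: eq_diff_eq add.commute)
qed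

section \<open>Plane waves\<close>

definition pseries :: "('v, 'a::zero) mfls \<Rightarrow> bool" where
  "pseries f \<longleftrightarrow> (\<forall>v. vge v 0 f)"

lemma pseries_add: "pseries f \<Longrightarrow> pseries g \<Longrightarrow> pseries (f + g)"
  by (simp add: pseries_def vge_add)

lemma pseries_diff: "pseries f \<Longrightarrow> pseries g \<Longrightarrow> pseries (f - g)"
  by (simp add: pseries_def vge_diff)

lemma pseries_uminus: "pseries f \<Longrightarrow> pseries (- f)"
  by (simp add: pseries_def vge_uminus)

lemma pseries_mult: "pseries f \<Longrightarrow> pseries g \<Longrightarrow> pseries (f * g)"
  by (simp add: pseries_def vge_mult0)

lemma pseries_const: "pseries (mfls_const c)"
  by (simp add: pseries_def vfreeD vfree_const)

lemma pseries_1: "pseries 1"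
  by (simp add: pseries_def vfreeD vfree_1)

lemma pseries_X: "pseries (mfls_X r)"
  by (simp add: pseries_def vge_X0)

lemma pseries_power: "pseries f \<Longrightarrow> pseries (f ^ n)"
  by (simp add: pseries_def vge_power0)

lemma pseries_prod_list: "(\<And>f. f \<in> set fs \<Longrightarrow> pseries f) \<Longrightarrow> pseries (prod_list fs)"
  by (simp add: pseries_def vge_prod_list)

lemmas pseries_intros = pseries_add pseries_diff pseries_uminus pseries_mult pseries_const pseries_1
  pseries_X pseries_power

lemma constant_term_mult:
  assumes "pseries f" "pseries g"
  shows "constant_term (f * g) = constant_term f * constant_term g"
  unfolding constant_term_def
proof (subst mfls_nth_times_superset[of "{0}"])
  fix a assume a: "mfls_nth f a \<noteq> 0" "mfls_nth g (0 - a) \<noteq> 0"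
  have "Poly_Mapping.lookup a v = 0" for v
  proof -
    have "0 \<le> Poly_Mapping.lookup a v" "0 \<le> Poly_Mapping.lookup (0 - a) v"
      using a assms by (auto simp: pseries_def vge_def simp del: diff_0)
    then show ?thesis by (simp add: lookup_minus del: diff_0)
  qed
  then show "a \<in> {0}" by (simp add: poly_mapping_eqI)
qed simp_all

lemma constant_term_const [simp]: "constant_term (mfls_const c) = c"
  by (simp add: constant_term_def mfls_const.rep_eq)

lemma constant_term_X [simp]: "constant_term (mfls_X r) = 0"
  by (rule constant_term_vge[OF vge_X])

lemma pseries_unit:
  fixes f :: "('v::linorder, 'a::field) mfls"
  assumes "pseries f" "constant_term f \<noteq> 0"
  shows "f dvd 1" "pseries (inverse f)"
  using vge_inverse_series[of f] assms by (auto simp: pseries_def)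

section \<open>The series in one and two variables that make up the kernel\<close>

type_synonym ser = "(nat, ratfun) mfls"

abbreviation sP :: ser where "sP \<equiv> mfls_const indet_P"
abbreviation sQ :: ser where "sQ \<equiv> mfls_const indet_Q"
abbreviation sX :: "nat \<Rightarrow> ser" where "sX \<equiv> mfls_X"

definition sE :: "nat \<Rightarrow> ser" where "sE r = 1 + sX r"
definition sq :: "nat \<Rightarrow> ser" where "sq r = sQ + (sQ - 1) * sX r"
definition iX :: "nat \<Rightarrow> ser" where "iX r = inverse (sX r)"
definition iE :: "nat \<Rightarrow> ser" where "iE r = inverse (sE r)"
definition iq :: "nat \<Rightarrow> ser" where "iq r = inverse (sq r)"

lemma indet_Q_nonzero: "indet_Q \<noteq> 0"
  by (simp add: indet_Q_def Zero_fract_def eq_fract)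

lemma pseries_basic: "pseries (sE r)" "pseries (sq r)"
  unfolding sE_def sq_def by (intro pseries_intros)+

lemma constant_term_sE: "constant_term (sE r) = 1"
  by (simp add: sE_def constant_term_add)

lemma constant_term_sq: "constant_term (sq r) = indet_Q"
  by (simp add: sq_def constant_term_add constant_term_mult pseries_intros)

lemma sE_unit: "sE r dvd 1" and pseries_iE: "pseries (iE r)"
  unfolding iE_def using pseries_unit[of "sE r"] by (simp_all add: pseries_basic constant_term_sE)

lemma sq_unit: "sq r dvd 1" and pseries_iq: "pseries (iq r)"
  unfolding iq_def using pseries_unit[of "sq r"]
  by (simp_all add: pseries_basic constant_term_sq indet_Q_nonzero)

lemma sX_iX: "sX r * iX r = 1"
  unfolding iX_def by (rule mfls_inverse_right[OF mfls_X_unit])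

lemma sE_iE: "sE r * iE r = 1"
  unfolding iE_def by (rule mfls_inverse_right[OF sE_unit])

lemma sq_iq: "sq r * iq r = 1"
  unfolding iq_def by (rule mfls_inverse_right[OF sq_unit])

lemma sX_nonzero: "sX r \<noteq> 0" and sE_nonzero: "sE r \<noteq> 0" and sq_nonzero: "sq r \<noteq> 0"
  using sX_iX[of r] sE_iE[of r] sq_iq[of r] by auto

text \<open>
  \<open>al\<close> and \<open>be\<close> are the contributions of the left and right end when a plane wave is summed over an
  interval with interior weight \<open>Q\<close> (see \<open>row_sum_inner\<close>), \<open>gg = 1 / al\<close>, and \<open>WW\<close> is chosen such that the
  contact term \<open>be r * al s - 1\<close> of two neighbouring positions is proportional to \<open>WW s r\<close> (see \<open>be_al\<close>).
  \<open>YY s t\<close> is \<open>WW s t\<close> with \<open>1 + x\<^sub>t\<close> replaced by its inverse, up to a power of \<open>1 + x\<^sub>t\<close>.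
\<close>

definition al :: "nat \<Rightarrow> ser" where "al r = - sq r * iX r"
definition be :: "nat \<Rightarrow> ser" where "be r = (sQ + sX r) * iX r"
definition gg :: "nat \<Rightarrow> ser" where "gg r = - sX r * iq r"
definition hh :: "nat \<Rightarrow> ser" where "hh r = 1 + (sP - 1) * gg r"
definition uu :: "nat \<Rightarrow> ser" where "uu r = sX r ^ 2 * iE r"
definition WW :: "nat \<Rightarrow> nat \<Rightarrow> ser" where
  "WW s t = sQ + (sQ - 1) * sX s + sX t + sX s * sX t"
definition YY :: "nat \<Rightarrow> nat \<Rightarrow> ser" where
  "YY s t = sQ + (sQ - 1) * sX s + (sQ - 1) * sX t + (sQ - 2) * sX s * sX t"

lemma al_gg: "al r * gg r = 1"
proof -
  have "al r * gg r = (sq r * iq r) * (sX r * iX r)" by (simp add: al_def gg_def algebra_simps)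
  then show ?thesis by (simp add: sq_iq sX_iX)
qed

lemma sX_al: "sX r * al r = - sq r"
  using sX_iX[of r] by (simp add: al_def mult.left_commute)

lemma sX_be: "sX r * be r = sQ + sX r"
  using sX_iX[of r] by (simp add: be_def mult.left_commute)

lemma be_al: "be r * al s - 1 = - (sQ * WW s r * iX r * iX s)"
proof -
  have "sX r * sX s * (be r * al s - 1) = (sX r * be r) * (sX s * al s) - sX r * sX s"
    by (simp add: algebra_simps)
  also have "\<dots> = - (sQ * WW s r)"
    by (simp add: sX_al sX_be WW_def sq_def algebra_simps)
  also have "\<dots> = - (sQ * WW s r) * (sX r * iX r) * (sX s * iX s)"
    by (simp add: sX_iX)
  also have "\<dots> = sX r * sX s * (- (sQ * WW s r * iX r * iX s))"
    by (simp add: algebra_simps)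
  finally show ?thesis
    by (simp only: mult_cancel_left) (simp add: sX_nonzero)
qed

lemma vfree_series:
  assumes "v \<noteq> r"
  shows "vfree v (sE r)" "vfree v (sq r)" "vfree v (iX r)" "vfree v (iE r)" "vfree v (iq r)"
    "vfree v (al r)" "vfree v (be r)" "vfree v (gg r)" "vfree v (hh r)" "vfree v (uu r)"
proof -
  show E: "vfree v (sE r)" unfolding sE_def using assms by (intro vfree_add vfree_1 vfree_X)
  show q: "vfree v (sq r)"
    unfolding sq_def using assms by (intro vfree_add vfree_mult vfree_diff vfree_const vfree_1 vfree_X)
  show iX: "vfree v (iX r)" unfolding iX_def using assms by (intro vfree_inverse mfls_X_unit vfree_X)
  show iE: "vfree v (iE r)" unfolding iE_def by (intro vfree_inverse sE_unit E)
  show iq: "vfree v (iq r)" unfolding iq_def by (intro vfree_inverse sq_unit q)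
  show "vfree v (al r)" unfolding al_def by (intro vfree_mult vfree_uminus q iX)
  show "vfree v (be r)" unfolding be_def using assms by (intro vfree_mult vfree_add vfree_const vfree_X iX)
  show gg: "vfree v (gg r)" unfolding gg_def using assms by (intro vfree_mult vfree_uminus vfree_X iq)
  show "vfree v (hh r)" unfolding hh_def
    by (intro vfree_mult vfree_add vfree_diff vfree_const vfree_1 gg)
  show "vfree v (uu r)" unfolding uu_def using assms by (intro vfree_mult vfree_power vfree_X iE)
qed

lemma vfree_WW: "v \<noteq> s \<Longrightarrow> v \<noteq> t \<Longrightarrow> vfree v (WW s t)"
  unfolding WW_def by (intro vfree_mult vfree_add vfree_diff vfree_const vfree_1 vfree_X)

lemma vfree_YY: "v \<noteq> s \<Longrightarrow> v \<noteq> t \<Longrightarrow> vfree v (YY s t)"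
proof -
  have "vfree v (2 :: ser)" using vfree_add[OF vfree_1 vfree_1] by simp
  then show "v \<noteq> s \<Longrightarrow> v \<noteq> t \<Longrightarrow> vfree v (YY s t)"
  unfolding YY_def by (intro vfree_mult vfree_add vfree_diff vfree_const vfree_1 vfree_X)
qed

lemma pseries_2: "pseries (2 :: ser)"
  using pseries_add[OF pseries_1 pseries_1] by simp

lemma pseries_gg: "pseries (gg r)"
  unfolding gg_def by (intro pseries_intros pseries_iq)

lemma pseries_series:
  "pseries (hh r)" "pseries (uu r)" "pseries (WW s t)" "pseries (YY s t)"
  unfolding hh_def uu_def WW_def YY_def
  by (intro pseries_intros pseries_gg pseries_iE pseries_2)+

lemma mfls_perm_series:
  assumes "bij \<sigma>"
  shows "mfls_perm \<sigma> (sX r) = sX (\<sigma> r)" "mfls_perm \<sigma> (sE r) = sE (\<sigma> r)"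
    "mfls_perm \<sigma> (sq r) = sq (\<sigma> r)" "mfls_perm \<sigma> (iX r) = iX (\<sigma> r)"
    "mfls_perm \<sigma> (iE r) = iE (\<sigma> r)" "mfls_perm \<sigma> (iq r) = iq (\<sigma> r)"
    "mfls_perm \<sigma> (al r) = al (\<sigma> r)" "mfls_perm \<sigma> (be r) = be (\<sigma> r)"
    "mfls_perm \<sigma> (gg r) = gg (\<sigma> r)" "mfls_perm \<sigma> (hh r) = hh (\<sigma> r)"
    "mfls_perm \<sigma> (uu r) = uu (\<sigma> r)" "mfls_perm \<sigma> (WW r s) = WW (\<sigma> r) (\<sigma> s)"
    "mfls_perm \<sigma> (YY r s) = YY (\<sigma> r) (\<sigma> s)"
proof -
  note h = mfls_perm_add[OF assms] mfls_perm_mult[OF assms] mfls_perm_diff[OF assms]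
    mfls_perm_uminus[OF assms] mfls_perm_1[OF assms] mfls_perm_const[OF assms]
    mfls_perm_power[OF assms] mfls_perm_inverse[OF assms]
  show X: "mfls_perm \<sigma> (sX r) = sX (\<sigma> r)" for r by (rule mfls_perm_X[OF assms])
  show E: "mfls_perm \<sigma> (sE r) = sE (\<sigma> r)" by (simp add: sE_def h X)
  show q: "mfls_perm \<sigma> (sq r) = sq (\<sigma> r)" by (simp add: sq_def h X)
  show iX: "mfls_perm \<sigma> (iX r) = iX (\<sigma> r)" by (simp add: iX_def h X mfls_X_unit)
  show iE: "mfls_perm \<sigma> (iE r) = iE (\<sigma> r)" by (simp add: iE_def h E sE_unit)
  show iq: "mfls_perm \<sigma> (iq r) = iq (\<sigma> r)" by (simp add: iq_def h q sq_unit)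
  show "mfls_perm \<sigma> (al r) = al (\<sigma> r)" by (simp add: al_def h q iX)
  show "mfls_perm \<sigma> (be r) = be (\<sigma> r)" by (simp add: be_def h X iX)
  show gg: "mfls_perm \<sigma> (gg r) = gg (\<sigma> r)" by (simp add: gg_def h X iq)
  show "mfls_perm \<sigma> (hh r) = hh (\<sigma> r)" by (simp add: hh_def h gg)
  show "mfls_perm \<sigma> (uu r) = uu (\<sigma> r)" by (simp add: uu_def h X iE)
  show "mfls_perm \<sigma> (WW r s) = WW (\<sigma> r) (\<sigma> s)" by (simp add: WW_def h X)
  have two: "mfls_perm \<sigma> (2 :: ser) = 2"
    using mfls_perm_add[OF assms, of 1 "1 :: ser"] by (simp add: h)
  show "mfls_perm \<sigma> (YY r s) = YY (\<sigma> r) (\<sigma> s)" by (simp add: YY_def h X two)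
qed

section \<open>Summation over one row\<close>

text \<open>The correction of the wave at \<open>k\<close> after row \<open>i\<close>. The factor
  \<open>hh\<close> brings in the weight \<open>P\<close> of an unmoved position in row
  \<open>k\<close>, and each later row multiplies by \<open>gg\<close>.\<close>

definition fz :: "nat \<Rightarrow> nat \<Rightarrow> nat \<Rightarrow> ser" where
  "fz i r k = (if k \<le> i then gg r ^ (i - k) * hh r else 1)"

fun wave :: "nat \<Rightarrow> nat list \<Rightarrow> nat list \<Rightarrow> ser" where
  "wave i (r # rs) (k # ks) = sE r ^ k * fz i r k * wave i rs ks"
| "wave i [] ks = 1"
| "wave i rs [] = 1"

lemma vfree_fz: "v \<noteq> r \<Longrightarrow> vfree v (fz i r k)"
  unfolding fz_def by (auto intro!: vfree_mult vfree_power vfree_series vfree_1)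

lemma geometric_interior:
  "Suc k \<le> k' \<Longrightarrow> sX r * (\<Sum>l\<in>{k<..<k'}. sE r ^ l) = sE r ^ k' - sE r ^ Suc k"
proof (induction k' rule: dec_induct)
  case base
  have "{k<..<Suc k} = {}" by auto
  then show ?case by (simp only: sum.empty) simp
next
  case (step k')
  have "{k<..<Suc k'} = insert k' {k<..<k'}" using step.hyps by auto
  then have "sX r * (\<Sum>l\<in>{k<..<Suc k'}. sE r ^ l) = sX r * sE r ^ k' + (sE r ^ k' - sE r ^ Suc k)"
    using step.IH by (simp add: distrib_left)
  then show ?case by (simp add: sE_def algebra_simps)
qed

text \<open>The weight of a predecessor \<open>l\<close> of the free position \<open>k\<close> with
  right neighbour \<open>k'\<close>. Only an \<open>l\<close> strictly between them leaves the set
  and produces an entry \<open>-1\<close>; \<open>l = k = i\<close> is a column ending with the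
  entry 0.\<close>

definition row_weight :: "nat \<Rightarrow> nat \<Rightarrow> nat \<Rightarrow> nat \<Rightarrow> ratfun" where
  "row_weight i k k' l =
     (if l = k then (if k = i then indet_P else 1) else if l = k' then 1 else indet_Q)"

lemma al_fz: "i \<le> k \<Longrightarrow> al r * fz i r k = al r + mfls_const (row_weight i k k' k) - 1"
proof -
  assume "i \<le> k"
  have "al r * hh r = al r + (sP - 1) * (al r * gg r)" by (simp add: hh_def algebra_simps)
  then show ?thesis using \<open>i \<le> k\<close> by (simp add: fz_def row_weight_def al_gg)
qed

text \<open>After multiplication by \<open>x\<close> the interior telescopes. The coefficients then
  left at the two ends are \<open>al\<close> and \<open>be\<close>, and \<open>fz\<close> accounts
  for the weight \<open>P\<close> at the left one.\<close>

lemma row_sum_inner: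
  assumes "i \<le> k" "k < k'"
  shows "(\<Sum>l\<in>{k..k'}. mfls_const (row_weight i k k' l) * sE r ^ l) =
    al r * sE r ^ k * fz i r k + be r * sE r ^ k'"
proof -
  let ?w = "mfls_const (row_weight i k k' k) :: ser"
  have "{k..k'} = insert k (insert k' {k<..<k'})" using assms by auto
  then have "(\<Sum>l\<in>{k..k'}. mfls_const (row_weight i k k' l) * sE r ^ l) =
      ?w * sE r ^ k + (sE r ^ k' + (\<Sum>l\<in>{k<..<k'}. sQ * sE r ^ l))"
    using assms by (simp add: row_weight_def)
  also have "\<dots> = ?w * sE r ^ k + (sE r ^ k' + sQ * (\<Sum>l\<in>{k<..<k'}. sE r ^ l))"
    by (simp add: sum_distrib_left)
  finally have "sX r * (\<Sum>l\<in>{k..k'}. mfls_const (row_weight i k k' l) * sE r ^ l) =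
      sX r * ?w * sE r ^ k + sX r * sE r ^ k' + sQ * (sX r * (\<Sum>l\<in>{k<..<k'}. sE r ^ l))"
    by (simp add: algebra_simps)
  also have "\<dots> = sX r * ((al r + ?w - 1) * sE r ^ k + be r * sE r ^ k')"
  proof -
    have "sX r * ((al r + ?w - 1) * sE r ^ k + be r * sE r ^ k') =
        (sX r * al r) * sE r ^ k + sX r * (?w - 1) * sE r ^ k + (sX r * be r) * sE r ^ k'"
      by (simp add: algebra_simps)
    then show ?thesis
      unfolding geometric_interior[OF Suc_leI[OF assms(2)]] sX_al sX_be
      by (simp add: sq_def algebra_simps) (simp add: sE_def algebra_simps)
  qed
  also have "\<dots> = sX r * (al r * sE r ^ k * fz i r k + be r * sE r ^ k')"
    using al_fz[OF assms(1), of r k'] by (simp add: ac_simps)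
  finally show ?thesis by (simp add: sX_nonzero)
qed

text \<open>The wall acts like a right neighbour at \<open>m + 1\<close> whose own term, of weight
  1, is removed; this lowers the coefficient \<open>be\<close> of the right end to
  \<open>Q / x\<close>.\<close>

lemma row_sum_wall:
  assumes "i \<le> k" "k \<le> m"
  shows "(\<Sum>l\<in>{k..m}. mfls_const (row_weight i k (Suc m) l) * sE r ^ l) =
    al r * sE r ^ k * fz i r k + sQ * sE r ^ Suc m * iX r"
proof -
  have "{k..Suc m} = insert (Suc m) {k..m}" using assms by auto
  then have "(\<Sum>l\<in>{k..m}. mfls_const (row_weight i k (Suc m) l) * sE r ^ l) + sE r ^ Suc m =
      al r * sE r ^ k * fz i r k + be r * sE r ^ Suc m"
    using row_sum_inner[OF assms(1), of "Suc m" r] assms(2) by (simp add: row_weight_def add.commute)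
  moreover have "be r = 1 + sQ * iX r"
    using sX_iX[of r] by (simp add: be_def algebra_simps)
  ultimately show ?thesis by (simp add: algebra_simps)
qed

text \<open>In row \<open>i\<close> the columns to the left of \<open>i\<close> no longer exist, so their partial sums are frozen;
  the remaining positions interlace.  In an odd row (\<open>ev = False\<close>) the last position may move up to
  the wall \<open>m\<close>, in an even row a new one has entered there.\<close>

fun preds :: "bool \<Rightarrow> nat \<Rightarrow> nat \<Rightarrow> nat list \<Rightarrow> nat list set" where
  "preds ev m i [] = (if ev then {} else {[]})"
| "preds ev m i [k] =
    (if k < i then (#) k ` preds ev m i [] else if ev then {[]} else (\<lambda>l. [l]) ` {k..m})"
| "preds ev m i (k # k' # ks) =
    (if k < i then (#) k ` preds ev m i (k' # ks)
     else (\<Union>l\<in>{k..k'}. (#) l ` {ls \<in> preds ev m i (k' # ks). ls = [] \<or> l < hd ls}))"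

definition step_weight :: "nat \<Rightarrow> nat list \<Rightarrow> nat list \<Rightarrow> ratfun" where
  "step_weight i ls ks = indet_Q ^ card (set ls - set ks) *
     (if i \<in> set ls \<and> i \<in> set ks then indet_P else 1)"

text \<open>
  \<open>tsum\<close> evaluates the sum over all predecessors position by position; the subtracted term removes the
  case that two neighbouring predecessors both equal \<open>k'\<close>.  In an even row \<open>rs\<close> is shorter than the list of
  positions by one, and the junk values of \<open>hd []\<close> are multiplied by \<open>0\<close>.
\<close>

fun tsum :: "bool \<Rightarrow> nat \<Rightarrow> nat \<Rightarrow> nat list \<Rightarrow> nat list \<Rightarrow> ser" where
  "tsum ev m i rs [] = (if ev then 0 else 1)"
| "tsum ev m i rs [k] =
    (if k < i then sE (hd rs) ^ k * (gg (hd rs) ^ (i - 1 - k) * hh (hd rs)) * (if ev then 0 else 1)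
     else if ev then 1 else (\<Sum>l\<in>{k..m}. mfls_const (row_weight i k (Suc m) l) * sE (hd rs) ^ l))"
| "tsum ev m i rs (k # k' # ks) =
    (if k < i then sE (hd rs) ^ k * (gg (hd rs) ^ (i - 1 - k) * hh (hd rs)) * tsum ev m i (tl rs) (k' # ks)
     else (\<Sum>l\<in>{k..k'}. mfls_const (row_weight i k k' l) * sE (hd rs) ^ l) * tsum ev m i (tl rs) (k' # ks)
       - sE (hd rs) ^ k' * sE (hd (tl rs)) ^ k' * tsum ev m i (tl (tl rs)) ks)"

section \<open>Structure of the predecessor lists\<close>

lemma finite_preds: "finite (preds ev m i ks)"
  by (induction ev m i ks rule: preds.induct) auto

lemma preds_ge:
  assumes "ls \<in> preds ev m i (k # ks)" "sorted_wrt (<) (k # ks)" "l \<in> set ls"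
  shows "k \<le> l"
  using assms
proof (induction ks arbitrary: k ls l)
  case Nil
  then show ?case by (auto split: if_splits)
next
  case (Cons k' ks)
  then obtain l' ls' where ls: "ls = l' # ls'" "l' \<in> {k..k'}" "ls' \<in> preds ev m i (k' # ks)"
    by (auto split: if_splits)
  show ?case
  proof (cases "l = l'")
    case False
    then have "k' \<le> l" using Cons ls by (intro Cons.IH[of ls' k']) auto
    then show ?thesis using Cons.prems by auto
  qed (use ls in auto)
qed

text \<open>All later predecessors are at least the second position and hence exceed
  \<open>k\<close>, so the choice of \<open>k\<close> as head does not restrict the tail. These are
  the collisions to be excluded in \<open>tsum\<close>.\<close>

lemma preds_hd:
  assumes "sorted_wrt (<) (k # ks)" "i \<le> k" "k \<le> m"
  shows "{ls \<in> preds ev m i (k # ks). ls \<noteq> [] \<and> hd ls = k} = (#) k ` preds ev m i ks"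
proof (cases ks)
  case Nil
  then show ?thesis using assms by auto
next
  case (Cons k' ks')
  have "ls = [] \<or> k < hd ls" if "ls \<in> preds ev m i (k' # ks')" for ls
  proof (cases ls)
    case (Cons l ls')
    then have "k' \<le> l" using preds_ge[OF that, of l] assms \<open>ks = k' # ks'\<close> by auto
    then show ?thesis using assms \<open>ks = k' # ks'\<close> Cons by auto
  qed simp
  then show ?thesis using assms Cons by (auto intro!: bexI[of _ k])
qed

lemma preds_length:
  "ls \<in> preds ev m i ks \<Longrightarrow> length ls + (if ev then 1 else 0) = length ks"
  by (induction ev m i ks arbitrary: ls rule: preds.induct) (auto split: if_splits, force+)

lemma preds_sorted:
  "ls \<in> preds ev m i ks \<Longrightarrow> sorted_wrt (<) ks \<Longrightarrow> sorted_wrt (<) ls"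
proof (induction ev m i ks arbitrary: ls rule: preds.induct)
  case (3 ev m i k k' ks)
  then obtain l ls' where ls: "ls = l # ls'" "ls' \<in> preds ev m i (k' # ks)"
    "k < i \<and> l = k \<or> (ls' = [] \<or> l < hd ls')"
    by (auto split: if_splits)
  have "sorted_wrt (<) ls'"
    using 3 ls(2) by (cases "k < i") (auto split: if_splits)
  moreover have "l < t" if "t \<in> set ls'" for t
  proof (cases "k < i \<and> l = k")
    case True
    then show ?thesis using preds_ge[OF ls(2) _ that] 3(4) by force
  next
    case False
    then have "l < hd ls'" using ls(3) that by auto
    then show ?thesis using \<open>sorted_wrt (<) ls'\<close> that by (cases ls') auto
  qed
  ultimately show ?case using ls(1) by simp
qed (auto split: if_splits)

lemma step_weight_frozen:
  assumes "k < i" "k \<notin> set ls"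
  shows "step_weight i (k # ls) (k # ks) = step_weight i ls ks"
proof -
  have "set (k # ls) - set (k # ks) = set ls - set ks" using assms by auto
  then show ?thesis using assms by (simp add: step_weight_def)
qed

lemma step_weight_free:
  assumes "i \<le> k" "k < k'" "l \<in> {k..k'}" "l \<notin> set ls" "\<And>l. l \<in> set ls \<Longrightarrow> k' \<le> l"
    "sorted_wrt (<) (k' # ks)"
  shows "step_weight i (l # ls) (k # k' # ks) = row_weight i k k' l * step_weight i ls (k' # ks)"
proof -
  have i: "i \<notin> set ls" "i \<notin> set (k' # ks)" "k \<notin> set ls" "\<And>t. t \<in> set ks \<Longrightarrow> k' < t"
    using assms by force+
  show ?thesis
  proof (cases "l = k \<or> l = k'")
    case True
    then have "set (l # ls) - set (k # k' # ks) = set ls - set (k' # ks)" using i assms by auto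
    then show ?thesis using True i assms by (auto simp: step_weight_def row_weight_def)
  next
    case False
    then have "l \<notin> set (k # k' # ks)" using assms(3) i by force
    then have "set (l # ls) - set (k # k' # ks) = insert l (set ls - set (k' # ks))" using i by auto
    then show ?thesis using False i assms by (auto simp: step_weight_def row_weight_def)
  qed
qed

text \<open>Predecessors interact only with their neighbours: the closed intervals share the end
  \<open>k'\<close>, and only there can strictness fail. The induction is on the length because
  removing a collision consumes two positions at once.\<close>

lemma sum_preds_eq_tsum:
  assumes "sorted_wrt (<) ks" "\<And>k. k \<in> set ks \<Longrightarrow> k \<le> m" "0 < i"
    "length rs + (if ev then 1 else 0) = length ks"
  shows "(\<Sum>ls\<in>preds ev m i ks. mfls_const (step_weight i ls ks) * wave (i - 1) rs ls) =
    tsum ev m i rs ks"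
  using assms
proof (induction "length ks" arbitrary: ks rs rule: less_induct)
  case less
  have inj: "inj_on ((#) k) A" for k :: nat and A by (simp add: inj_on_def)
  have frozen: "(\<Sum>ls\<in>(#) k ` preds ev m i ks'. mfls_const (step_weight i ls ks) * wave (i - 1) rs ls) =
      sE (hd rs) ^ k * (gg (hd rs) ^ (i - 1 - k) * hh (hd rs)) * tsum ev m i (tl rs) ks'"
    if ks: "ks = k # ks'" and k: "k < i" and rs: "rs \<noteq> []" for k ks'
  proof -
    have nin: "k \<notin> set ls" if "ls \<in> preds ev m i ks'" for ls
    proof (cases ks')
      case Nil
      then show ?thesis using that by (auto split: if_splits)
    next
      case (Cons k' ks'')
      then show ?thesis using preds_ge[OF that[unfolded Cons], of k] less.prems ks by auto
    qed
    have "(\<Sum>ls\<in>(#) k ` preds ev m i ks'. mfls_const (step_weight i ls ks) * wave (i - 1) rs ls) =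
      (\<Sum>ls\<in>preds ev m i ks'. mfls_const (step_weight i (k # ls) ks) * wave (i - 1) rs (k # ls))"
      by (subst sum.reindex[OF inj]) simp
    also have "\<dots> = (\<Sum>ls\<in>preds ev m i ks'. sE (hd rs) ^ k * (gg (hd rs) ^ (i - 1 - k) * hh (hd rs)) *
        (mfls_const (step_weight i ls ks') * wave (i - 1) (tl rs) ls))"
    proof (rule sum.cong[OF refl])
      fix ls assume "ls \<in> preds ev m i ks'"
      then show "mfls_const (step_weight i (k # ls) ks) * wave (i - 1) rs (k # ls) =
        sE (hd rs) ^ k * (gg (hd rs) ^ (i - 1 - k) * hh (hd rs)) *
        (mfls_const (step_weight i ls ks') * wave (i - 1) (tl rs) ls)"
        using rs k nin ks by (cases rs) (auto simp: step_weight_frozen fz_def ac_simps)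
    qed
    also have "\<dots> = sE (hd rs) ^ k * (gg (hd rs) ^ (i - 1 - k) * hh (hd rs)) * tsum ev m i (tl rs) ks'"
      unfolding sum_distrib_left[symmetric]
      by (subst less.hyps[of ks']) (use less.prems ks rs in \<open>auto simp: neq_Nil_conv\<close>)
    finally show ?thesis .
  qed
  show ?case
  proof (cases ks)
    case Nil
    then show ?thesis using less.prems by (auto simp: step_weight_def)
  next
    case (Cons k ks1)
    note ks = this
    show ?thesis
    proof (cases "k < i")
      case True
      show ?thesis
      proof (cases "rs = []")
        case True
        then have "ks1 = []" "ev" using less.prems ks by (auto split: if_splits)
        then show ?thesis using ks \<open>k < i\<close> by simp
      next
        case False
        have "preds ev m i ks = (#) k ` preds ev m i ks1" using ks True by (cases ks1) auto
        moreover have "tsum ev m i rs ks = sE (hd rs) ^ k * (gg (hd rs) ^ (i - 1 - k) * hh (hd rs)) * tsum ev m i (tl rs) ks1"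
          using ks True by (cases ks1) auto
        ultimately show ?thesis using frozen[OF ks True False] by simp
      qed
    next
      case False
      note k = this
      show ?thesis
      proof (cases ks1)
        case Nil
        show ?thesis
        proof (cases ev)
          case True
          then show ?thesis using less.prems ks Nil k by (simp add: step_weight_def)
        next
          case False
          then obtain r where r: "rs = [r]" using less.prems ks Nil by (cases rs) auto
          have "(\<Sum>ls\<in>preds ev m i ks. mfls_const (step_weight i ls ks) * wave (i - 1) rs ls) =
              (\<Sum>l\<in>{k..m}. mfls_const (step_weight i [l] [k]) * wave (i - 1) rs [l])"
            using k ks Nil False by (simp add: sum.reindex inj_on_def)
          also have "\<dots> = (\<Sum>l\<in>{k..m}. mfls_const (row_weight i k (Suc m) l) * sE r ^ l)"
            using k less.prems(3) r
            by (intro sum.cong) (auto simp: step_weight_def row_weight_def fz_def)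
          finally show ?thesis using k ks Nil False r by simp
        qed
      next
        case (Cons k' ks2)
        have sorted: "sorted_wrt (<) (k' # ks2)" "k < k'" using less.prems(1) ks Cons by auto
        obtain r rs1 where rs: "rs = r # rs1"
          using less.prems ks Cons by (cases rs; cases ev) auto
        define f where "f = (\<lambda>ls. mfls_const (step_weight i ls (k' # ks2)) * wave (i - 1) rs1 ls)"
        define S where "S = preds ev m i (k' # ks2)"
        define T where "T l = {ls \<in> S. ls = [] \<or> l < hd ls}" for l
        have ge: "k' \<le> t" if "ls \<in> S" "t \<in> set ls" for ls t
          using preds_ge[of ls ev m i k' ks2 t] that sorted by (simp add: S_def)
        have finS: "finite S" unfolding S_def by (rule finite_preds)
        have IH: "(\<Sum>ls\<in>S. f ls) = tsum ev m i rs1 (k' # ks2)"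
          unfolding f_def S_def by (rule less.hyps) (use less.prems ks Cons rs in auto)
        \<comment> \<open>With \<open>k'\<close> already chosen, the tails starting with
          \<open>k'\<close> are forbidden. Since \<open>k'\<close> is itself a position and lies to
          the right of \<open>i\<close>, its repetition would carry neither \<open>Q\<close> nor
          \<open>P\<close>.\<close>
        have excl: "(\<Sum>ls\<in>T k'. f ls) = tsum ev m i rs1 (k' # ks2) - sE (hd rs1) ^ k' * tsum ev m i (tl rs1) ks2"
        proof -
          have "(\<Sum>ls\<in>S. f ls) = (\<Sum>ls\<in>T k'. f ls) + (\<Sum>ls\<in>S - T k'. f ls)"
            using sum.subset_diff[of "T k'" S f] finS by (simp add: T_def Collect_restrict add.commute)
          also have "S - T k' = {ls \<in> S. ls \<noteq> [] \<and> hd ls = k'}"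
            using ge by (force simp: T_def neq_Nil_conv)
          also have "\<dots> = (#) k' ` preds ev m i ks2"
            unfolding S_def by (rule preds_hd) (use sorted k less.prems ks Cons in auto)
          also have "(\<Sum>ls\<in>\<dots>. f ls) = sE (hd rs1) ^ k' * tsum ev m i (tl rs1) ks2"
          proof (cases "rs1 = []")
            case True
            then have "ks2 = []" "ev" using less.prems ks Cons rs by (auto split: if_splits)
            then show ?thesis by simp
          next
            case False
            then obtain r' rs2 where rs1: "rs1 = r' # rs2" by (cases rs1) auto
            have nin: "k' \<notin> set ls" if "ls \<in> preds ev m i ks2" for ls
            proof (cases ks2)
              case Nil
              then show ?thesis using that by (auto split: if_splits)
            next
              case (Cons k'' ks3)
              then show ?thesis using preds_ge[OF that[unfolded Cons], of k'] sorted by auto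
            qed
            have "(\<Sum>ls\<in>(#) k' ` preds ev m i ks2. f ls) = (\<Sum>ls\<in>preds ev m i ks2. f (k' # ls))"
              by (subst sum.reindex[OF inj]) simp
            also have "\<dots> = (\<Sum>ls\<in>preds ev m i ks2. sE r' ^ k' * (mfls_const (step_weight i ls ks2) * wave (i - 1) rs2 ls))"
            proof (rule sum.cong[OF refl])
              fix ls assume ls: "ls \<in> preds ev m i ks2"
              have "set (k' # ls) - set (k' # ks2) = set ls - set ks2" using nin[OF ls] by auto
              moreover have "i \<notin> set ks2" "i \<noteq> k'" using sorted k by auto
              ultimately have "step_weight i (k' # ls) (k' # ks2) = step_weight i ls ks2"
                by (simp add: step_weight_def)
              then show "f (k' # ls) = sE r' ^ k' * (mfls_const (step_weight i ls ks2) * wave (i - 1) rs2 ls)"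
                using sorted k less.prems(3) by (simp add: f_def rs1 fz_def ac_simps)
            qed
            also have "\<dots> = sE r' ^ k' * tsum ev m i rs2 ks2"
              unfolding sum_distrib_left[symmetric]
              by (subst less.hyps[of ks2]) (use less.prems ks Cons rs rs1 in auto)
            finally show ?thesis by (simp add: rs1)
          qed
          finally show ?thesis unfolding IH by simp
        qed
        have below: "T l = S" if "l < k'" for l
        proof -
          have "l < hd ls" if "ls \<in> S" "ls \<noteq> []" for ls
            using ge[OF that(1), of "hd ls"] that \<open>l < k'\<close> by auto
          then show ?thesis by (auto simp: T_def)
        qed
        have "preds ev m i ks = (\<Union>l\<in>{k..k'}. (#) l ` T l)"
          using ks Cons k by (simp add: T_def S_def)
        then have "(\<Sum>ls\<in>preds ev m i ks. mfls_const (step_weight i ls ks) * wave (i - 1) rs ls) =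
            (\<Sum>l\<in>{k..k'}. \<Sum>ls\<in>(#) l ` T l. mfls_const (step_weight i ls ks) * wave (i - 1) rs ls)"
          using finS by (simp only:) (subst sum.UNION_disjoint, auto simp: T_def)
        also have "\<dots> = (\<Sum>l\<in>{k..k'}. mfls_const (row_weight i k k' l) * sE r ^ l * (\<Sum>ls\<in>T l. f ls))"
        proof (rule sum.cong[OF refl])
          fix l assume l: "l \<in> {k..k'}"
          have "(\<Sum>ls\<in>(#) l ` T l. mfls_const (step_weight i ls ks) * wave (i - 1) rs ls) =
            (\<Sum>ls\<in>T l. mfls_const (step_weight i (l # ls) ks) * wave (i - 1) rs (l # ls))"
            by (subst sum.reindex[OF inj]) simp
          also have "\<dots> = (\<Sum>ls\<in>T l. mfls_const (row_weight i k k' l) * sE r ^ l * f ls)"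
          proof (rule sum.cong[OF refl])
            fix ls assume ls: "ls \<in> T l"
            have sl: "l \<notin> set ls"
            proof (cases ls)
              case (Cons a as)
              have "sorted_wrt (<) ls"
                using ls sorted preds_sorted[of ls ev m i "k' # ks2"] by (simp add: T_def S_def)
              then show ?thesis using ls Cons by (force simp: T_def)
            qed simp
            have "step_weight i (l # ls) ks = row_weight i k k' l * step_weight i ls (k' # ks2)"
              unfolding ks Cons
              by (rule step_weight_free) (use sorted k l sl ge ls in \<open>auto simp: T_def\<close>)
            then show "mfls_const (step_weight i (l # ls) ks) * wave (i - 1) rs (l # ls) =
                mfls_const (row_weight i k k' l) * sE r ^ l * f ls"
            proof -
              have "\<not> l \<le> i - 1" using k l less.prems(3) by auto
              then have "fz (i - 1) r l = 1" by (simp add: fz_def)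
              with \<open>step_weight i (l # ls) ks = _\<close> show ?thesis
                by (simp add: rs f_def mfls_const_mult ac_simps)
            qed
          qed
          finally show "(\<Sum>ls\<in>(#) l ` T l. mfls_const (step_weight i ls ks) * wave (i - 1) rs ls) =
            mfls_const (row_weight i k k' l) * sE r ^ l * (\<Sum>ls\<in>T l. f ls)"
            by (simp add: sum_distrib_left)
        qed
        also have "\<dots> = (\<Sum>l\<in>{k..k'}. mfls_const (row_weight i k k' l) * sE r ^ l * tsum ev m i rs1 (k' # ks2)
            - (if l = k' then sE r ^ k' * (sE (hd rs1) ^ k' * tsum ev m i (tl rs1) ks2) else 0))"
        proof (rule sum.cong[OF refl])
          fix l assume l: "l \<in> {k..k'}"
          show "mfls_const (row_weight i k k' l) * sE r ^ l * (\<Sum>ls\<in>T l. f ls) =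
            mfls_const (row_weight i k k' l) * sE r ^ l * tsum ev m i rs1 (k' # ks2)
            - (if l = k' then sE r ^ k' * (sE (hd rs1) ^ k' * tsum ev m i (tl rs1) ks2) else 0)"
          proof (cases "l = k'")
            case True
            have "row_weight i k k' k' = 1" using sorted by (simp add: row_weight_def)
            then show ?thesis unfolding True excl by (simp add: algebra_simps)
          next
            case False
            then show ?thesis using below[of l] IH l by simp
          qed
        qed
        also have "\<dots> = tsum ev m i rs ks"
          using ks Cons k rs sorted by (simp add: sum_subtractf sum_distrib_right mult.assoc)
        finally show ?thesis .
      qed
    qed
  qed
qed

text \<open>
  What survives of \<open>tsum\<close> under the constant term: the positions before some index contribute their left
  end, the remaining ones their right end (in an odd row there are none of the latter).
\<close>

fun rights :: "bool \<Rightarrow> nat list \<Rightarrow> nat list \<Rightarrow> ser" where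
  "rights ev rs [] = 0"
| "rights ev rs [k] = (if ev then 1 else 0)"
| "rights ev rs (k # k' # ks) = be (hd rs) * sE (hd rs) ^ k' * rights ev (tl rs) (k' # ks)"

fun tmain :: "bool \<Rightarrow> nat \<Rightarrow> nat list \<Rightarrow> nat list \<Rightarrow> ser" where
  "tmain ev i rs [] = (if ev then 0 else 1)"
| "tmain ev i rs (k # ks) =
    al (hd rs) * sE (hd rs) ^ k * fz i (hd rs) k * tmain ev i (tl rs) ks +
    (if k < i then 0 else rights ev rs (k # ks))"

lemma vfree_rights:
  "v \<notin> set rs \<Longrightarrow> length rs + (if ev then 1 else 0) = length ks \<Longrightarrow> vfree v (rights ev rs ks)"
proof (induction ev rs ks rule: rights.induct)
  case (3 ev rs k k' ks)
  obtain r rs1 where rs: "rs = r # rs1" using 3(3) by (cases rs; cases ev) auto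
  show ?case using 3 by (auto simp: rs intro!: vfree_mult vfree_power vfree_series)
qed (auto simp: vfree_0 vfree_1)

lemma vfree_tmain:
  "v \<notin> set rs \<Longrightarrow> length rs + (if ev then 1 else 0) = length ks \<Longrightarrow> vfree v (tmain ev i rs ks)"
proof (induction ks arbitrary: rs)
  case (Cons k ks)
  show ?case
  proof (cases rs)
    case Nil
    then have "ks = []" "ev" using Cons.prems by (auto split: if_splits)
    then show ?thesis by (simp add: vfree_0 vfree_1)
  next
    case (Cons r rs1)
    have "vfree v (tmain ev i rs1 ks)" using Cons.prems Cons by (intro Cons.IH) auto
    moreover have "vfree v (rights ev rs (k # ks))" using Cons.prems by (intro vfree_rights) auto
    ultimately show ?thesis
      using Cons Cons.prems
      by (auto intro!: vfree_add vfree_mult vfree_power vfree_series vfree_fz vfree_0)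
  qed
qed (auto simp: vfree_0 vfree_1)

definition swp :: "nat \<Rightarrow> nat \<Rightarrow> nat \<Rightarrow> nat" where
  "swp a b v = (if v = a then b else if v = b then a else v)"

lemma bij_swp: "bij (swp a b)"
  by (rule o_bij[of "swp a b"]) (auto simp: swp_def fun_eq_iff)

lemma mfls_perm_swp_vfree: "vfree a f \<Longrightarrow> vfree b f \<Longrightarrow> mfls_perm (swp a b) f = f"
  by (rule mfls_perm_vfree[OF bij_swp]) (auto simp: swp_def split: if_splits)

text \<open>
  Since the multiplier \<open>U\<close> is free of the variables of the positions being summed, every contact term is
  a multiple of \<open>WW b a\<close> by a factor symmetric in \<open>a\<close>, \<open>b\<close>.
\<close>

lemma row_step:
  assumes dist: "distinct RS"
    and H1: "\<And>pre a b post F. RS = pre @ a # b # post \<Longrightarrow> mfls_perm (swp a b) F = F \<Longrightarrow>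
        constant_term (\<Psi> * (WW b a * F)) = 0"
    and H2: "\<And>pre z U. \<not> ev \<Longrightarrow> RS = pre @ [z] \<Longrightarrow> vfree z U \<Longrightarrow>
        constant_term (\<Psi> * (U * (sE z ^ Suc m * iX z))) = 0"
    and i: "0 < i"
    and prems: "RS = pre @ rs" "sorted_wrt (<) ks" "length rs + (if ev then 1 else 0) = length ks"
      "\<And>k. k \<in> set ks \<Longrightarrow> k \<le> m" "\<And>v. v \<in> set rs \<Longrightarrow> vfree v U"
  shows "constant_term (\<Psi> * (U * tsum ev m i rs ks)) = constant_term (\<Psi> * (U * tmain ev i rs ks))"
  using prems
proof (induction "length ks" arbitrary: pre rs ks U rule: less_induct)
  case less
  show ?case
  proof (cases ks)
    case Nil
    then show ?thesis by simp
  next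
    case (Cons k ks1)
    note ks = this
    show ?thesis
    proof (cases rs)
      case Nil
      then have "ks1 = []" "ev" using less.prems ks by (auto split: if_splits)
      then show ?thesis using ks by simp
    next
      case (Cons r rs1)
      note rs = this
      have r: "r \<notin> set rs1" using dist less.prems(1) rs by auto
      have IH: "constant_term (\<Psi> * (U * V * tsum ev m i rs1 ks1)) = constant_term (\<Psi> * (U * V * tmain ev i rs1 ks1))"
        if "\<And>v. v \<noteq> r \<Longrightarrow> vfree v V" for V
      proof (rule less.hyps[of ks1 "pre @ [r]"])
        fix v assume "v \<in> set rs1"
        then show "vfree v (U * V)"
          using less.prems(5)[of v] that[of v] r rs by (intro vfree_mult) auto
      qed (use less.prems ks rs in auto)
      show ?thesis
      proof (cases "k < i")
        case True
        define V where "V = sE r ^ k * (gg r ^ (i - 1 - k) * hh r)"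
        have "tsum ev m i rs ks = V * tsum ev m i rs1 ks1"
          using ks rs True by (cases ks1) (auto simp: V_def)
        moreover have "tmain ev i rs ks = V * tmain ev i rs1 ks1"
        proof -
          \<comment> \<open>From row \<open>i - 1\<close> to row \<open>i\<close> the factor
            \<open>fz\<close> gains one power of \<open>gg\<close>, which the \<open>al\<close> of
            the supposed left end cancels; a frozen position thus keeps its old wave.\<close>
          have "i - k = Suc (i - 1 - k)" using True by simp
          then have "al r * fz i r k = (al r * gg r) * (gg r ^ (i - 1 - k) * hh r)"
            using True by (simp add: fz_def ac_simps)
          then have "al r * sE r ^ k * fz i r k = V"
            by (simp add: V_def al_gg mult.left_commute mult.commute)
          then show ?thesis using ks rs True by simp
        qed
        moreover have "vfree v V" if "v \<noteq> r" for v
          unfolding V_def using that by (intro vfree_mult vfree_power vfree_series)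
        ultimately show ?thesis using IH[of V] by (simp add: mult.assoc)
      next
        case False
        note k = this
        show ?thesis
        proof (cases ks1)
          case Nil
          show ?thesis
          proof (cases ev)
            case True
            then show ?thesis using less.prems ks Nil rs by simp
          next
            case False
            have rs1: "rs1 = []" using less.prems ks Nil rs False by simp
            \<comment> \<open>The second summand is the wave at the column \<open>m + 1\<close>
              behind the wall, which \<open>H2\<close> annihilates.\<close>
            have "tsum ev m i rs ks = al r * sE r ^ k * fz i r k + sQ * (sE r ^ Suc m * iX r)"
              using ks Nil k False rs row_sum_wall[of i k m r] less.prems(4)[of k] by (simp add: mult.assoc)
            moreover have "tmain ev i rs ks = al r * sE r ^ k * fz i r k"
              using ks Nil False rs by simp
            moreover have "constant_term (\<Psi> * (U * (sE r ^ Suc m * iX r))) = 0"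
              by (rule H2[OF False]) (use less.prems rs rs1 in auto)
            ultimately show ?thesis
              by (simp add: distrib_left constant_term_add mult.left_commute[of _ sQ] constant_term_const_times)
          qed
        next
          case (Cons k' ks2)
          have kk': "k < k'" "sorted_wrt (<) (k' # ks2)" using less.prems ks Cons by auto
          define A where "A = al r * sE r ^ k * fz i r k"
          define B where "B = be r * sE r ^ k'"
          define D where "D = sE (hd rs1) ^ k'"
          define Z where "Z = tmain ev i (tl rs1) ks2"
          define R where "R = rights ev rs1 (k' # ks2)"
          have T: "tsum ev m i rs ks = (A + B) * tsum ev m i rs1 ks1 - sE r ^ k' * D * tsum ev m i (tl rs1) ks2"
            using ks Cons k rs row_sum_inner[of i k k' r] kk' by (simp add: A_def B_def D_def)
          have fz1: "fz i (hd rs1) k' = 1" using k kk' by (simp add: fz_def)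
          have M1: "tmain ev i rs1 ks1 = al (hd rs1) * D * Z + R"
            using Cons k kk' fz1 by (simp add: D_def Z_def R_def)
          have M: "tmain ev i rs ks = A * tmain ev i rs1 ks1 + B * R"
            using ks Cons k rs by (simp add: A_def B_def R_def)
          have vAB: "vfree v (A + B)" if "v \<noteq> r" for v
            unfolding A_def B_def using that by (intro vfree_add vfree_mult vfree_power vfree_series vfree_fz)
          have e1: "constant_term (\<Psi> * (U * (A + B) * tsum ev m i rs1 ks1)) =
              constant_term (\<Psi> * (U * (A + B) * tmain ev i rs1 ks1))"
            by (rule IH[OF vAB])
          have e2: "constant_term (\<Psi> * (U * (sE r ^ k' * D) * tsum ev m i (tl rs1) ks2)) =
              constant_term (\<Psi> * (U * (sE r ^ k' * D) * Z))"
          proof (cases rs1)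
            case Nil
            then have "ks2 = []" "ev" using less.prems ks rs Cons by (auto split: if_splits)
            then show ?thesis by (simp add: Z_def)
          next
            case (Cons r' rs2)
            show ?thesis
              unfolding Z_def
            proof (rule less.hyps[of ks2 "pre @ [r, r']"])
              fix v assume v: "v \<in> set (tl rs1)"
              then have "v \<noteq> r" "v \<noteq> r'" "v \<in> set rs" using dist less.prems(1) rs Cons by auto
              then show "vfree v (U * (sE r ^ k' * D))"
                using less.prems(5)[of v] by (auto simp: D_def Cons intro!: vfree_mult vfree_power vfree_series)
            qed (use less.prems ks rs Cons \<open>ks1 = k' # ks2\<close> in auto)
          qed
          \<comment> \<open>The right end of this interval times the left end of the next one, minus
            the excluded collision at \<open>k'\<close>. By \<open>be_al\<close> the factor
            \<open>be r * al r' - 1\<close> is a multiple of \<open>WW r' r\<close>, so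
            \<open>H1\<close> applies.\<close>
          have e3: "constant_term (\<Psi> * (U * (sE r ^ k' * D * (be r * al (hd rs1) - 1) * Z))) = 0"
          proof (cases rs1)
            case Nil
            then have "ks2 = []" "ev" using less.prems ks rs Cons by (auto split: if_splits)
            then show ?thesis by (simp add: Z_def)
          next
            case (Cons r' rs2)
            define F where "F = U * (sE r ^ k' * sE r' ^ k') * (iX r * iX r') * Z"
            have RS: "RS = pre @ r # r' # rs2" using less.prems rs Cons by simp
            have n: "r \<notin> set rs2" "r' \<notin> set rs2" "r \<noteq> r'" using dist RS by auto
            have Z: "mfls_perm (swp r r') Z = Z"
              unfolding Z_def using n less.prems ks rs Cons \<open>ks1 = k' # ks2\<close>
              by (intro mfls_perm_swp_vfree vfree_tmain) auto
            have U: "mfls_perm (swp r r') U = U"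
              using less.prems(5) rs Cons by (intro mfls_perm_swp_vfree) auto
            have "mfls_perm (swp r r') F = F"
              using n by (simp add: F_def mfls_perm_mult[OF bij_swp] mfls_perm_power[OF bij_swp]
                  mfls_perm_series[OF bij_swp] Z U swp_def ac_simps)
            then have "constant_term (\<Psi> * (WW r' r * F)) = 0"
              by (rule H1[OF RS])
            moreover have "\<Psi> * (U * (sE r ^ k' * D * (be r * al (hd rs1) - 1) * Z)) =
                mfls_const (- indet_Q) * (\<Psi> * (WW r' r * F))"
            proof -
              have "mfls_const (- indet_Q) = - sQ"
                by (rule mfls_eqI) (simp add: mfls_const.rep_eq uminus_mfls.rep_eq)
              then show ?thesis
                unfolding be_al by (simp add: Cons D_def F_def ac_simps)
            qed
            ultimately show ?thesis by (simp only: constant_term_const_times mult_zero_right)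
          qed
          have "constant_term (\<Psi> * (U * tsum ev m i rs ks)) =
              constant_term (\<Psi> * (U * (A + B) * tsum ev m i rs1 ks1)) -
              constant_term (\<Psi> * (U * (sE r ^ k' * D) * tsum ev m i (tl rs1) ks2))"
            unfolding T constant_term_diff[symmetric] by (simp add: algebra_simps)
          also have "\<dots> = constant_term (\<Psi> * (U * (A + B) * tmain ev i rs1 ks1)) -
              constant_term (\<Psi> * (U * (sE r ^ k' * D) * Z))"
            unfolding e1 e2 ..
          also have "\<dots> = constant_term (\<Psi> * (U * tmain ev i rs ks)) +
              constant_term (\<Psi> * (U * (sE r ^ k' * D * (be r * al (hd rs1) - 1) * Z)))"
            unfolding constant_term_diff[symmetric] constant_term_add[symmetric] M
            by (intro arg_cong[of _ _ constant_term]) (simp add: M1 B_def algebra_simps)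
          finally show ?thesis unfolding e3 by simp
        qed
      qed
    qed
  qed
qed

section \<open>The antisymmetric kernel\<close>

definition vand :: "nat list \<Rightarrow> ser" where
  "vand = pairprod (\<lambda>s t. uu t - uu s)"

text \<open>The exponent of \<open>iX\<close> supplies \<open>iX s ^ 2 * iX t ^ 2\<close> for each
  pair; \<open>c\<close> is instantiated by \<open>m + 1\<close>. Since \<open>YY\<close> is
  symmetric, \<open>Phi\<close> changes sign under each exchange of two neighbouring
  variables.\<close>

definition Phi :: "nat \<Rightarrow> nat list \<Rightarrow> ser" where
  "Phi c rs = vand rs * pairprod YY rs * (\<Prod>r\<leftarrow>rs. iE r ^ c * iX r ^ (2 * length rs - 2))"

definition Psi :: "nat \<Rightarrow> nat list \<Rightarrow> ser" where
  "Psi c rs = Phi c rs * pairprod WW rs"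

text \<open>The kernel after an odd row, where each position has contributed its left end.\<close>

definition PsiA :: "nat \<Rightarrow> nat list \<Rightarrow> ser" where
  "PsiA c rs = Psi c rs * (\<Prod>r\<leftarrow>rs. al r)"

lemma vfree_pairprod:
  "(\<And>s t. s \<in> set rs \<Longrightarrow> t \<in> set rs \<Longrightarrow> vfree z (f s t)) \<Longrightarrow> vfree z (pairprod f rs)"
  by (induction rs) (auto intro!: vfree_mult vfree_prod_list vfree_1)

lemma mfls_perm_pairprod:
  "bij \<sigma> \<Longrightarrow> mfls_perm \<sigma> (pairprod f rs) = pairprod (\<lambda>s t. mfls_perm \<sigma> (f s t)) rs"
  by (rule pairprod_hom) (simp_all add: mfls_perm_mult mfls_perm_1)

lemma mfls_perm_prod_list_map:
  "bij \<sigma> \<Longrightarrow> mfls_perm \<sigma> (\<Prod>r\<leftarrow>rs. f r) = (\<Prod>r\<leftarrow>rs. mfls_perm \<sigma> (f r))"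
  by (simp add: mfls_perm_prod_list o_def)

lemma mfls_perm_Phi: "bij \<sigma> \<Longrightarrow> mfls_perm \<sigma> (Phi c rs) = Phi c (map \<sigma> rs)"
  by (simp add: Phi_def vand_def mfls_perm_mult mfls_perm_pairprod mfls_perm_prod_list_map mfls_perm_series
      mfls_perm_diff mfls_perm_power pairprod_map o_def)

lemma mfls_perm_Psi: "bij \<sigma> \<Longrightarrow> mfls_perm \<sigma> (Psi c rs) = Psi c (map \<sigma> rs)"
  by (simp add: Psi_def mfls_perm_Phi mfls_perm_mult mfls_perm_pairprod mfls_perm_series pairprod_map)

lemma mfls_perm_PsiA: "bij \<sigma> \<Longrightarrow> mfls_perm \<sigma> (PsiA c rs) = PsiA c (map \<sigma> rs)"
  by (simp add: PsiA_def mfls_perm_Psi mfls_perm_mult mfls_perm_prod_list_map mfls_perm_series o_def)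

lemma YY_commute: "YY s t = YY t s"
  by (simp add: YY_def algebra_simps)

lemma pairprod_symmetric_swap:
  assumes "\<And>s t. f s t = f t s"
  shows "pairprod f (pre @ b # a # post) = pairprod f (pre @ a # b # post)"
  by (metis assms pairprod_swap)

lemma Phi_swap: "Phi c (pre @ b # a # post) = - Phi c (pre @ a # b # post)"
proof -
  obtain R where R: "vand (pre @ a # b # post) = (uu b - uu a) * R"
    "vand (pre @ b # a # post) = (uu a - uu b) * R"
    unfolding vand_def by (rule pairprod_swap[of "\<lambda>s t. uu t - uu s" pre a b post])
  have "vand (pre @ b # a # post) = - vand (pre @ a # b # post)"
    unfolding R by (simp add: algebra_simps)
  moreover have "pairprod YY (pre @ b # a # post) = pairprod YY (pre @ a # b # post)"
    by (rule pairprod_symmetric_swap[OF YY_commute])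
  ultimately show ?thesis by (simp add: Phi_def ac_simps)
qed

lemma map_swp:
  "distinct (pre @ a # b # post) \<Longrightarrow> map (swp a b) (pre @ a # b # post) = pre @ b # a # post"
  by (auto simp: swp_def intro!: map_idI)

text \<open>The kernel contains \<open>WW a b\<close> but not \<open>WW b a\<close>. Once the latter
  is supplied, only \<open>Phi\<close> changes under the exchange of \<open>a\<close> and
  \<open>b\<close>, and it changes sign; so the constant term equals its own negative.\<close>

lemma constant_term_Psi_swap:
  assumes "distinct (pre @ a # b # post)" "mfls_perm (swp a b) F = F"
  shows "constant_term (Psi c (pre @ a # b # post) * (WW b a * F)) = 0"
proof -
  let ?\<sigma> = "swp a b" and ?rs = "pre @ a # b # post" and ?rs' = "pre @ b # a # post"
  obtain R where R: "pairprod WW ?rs = WW a b * R" "pairprod WW ?rs' = WW b a * R"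
    by (rule pairprod_swap)
  have sw: "?\<sigma> a = b" "?\<sigma> b = a" by (simp_all add: swp_def)
  have "mfls_perm ?\<sigma> (Psi c ?rs * (WW b a * F)) = Psi c ?rs' * (WW a b * F)"
    using assms by (simp only: mfls_perm_mult[OF bij_swp] mfls_perm_Psi[OF bij_swp]
        mfls_perm_series[OF bij_swp] map_swp sw)
  also have "\<dots> = - (Psi c ?rs * (WW b a * F))"
    by (simp add: Psi_def Phi_swap[of c pre b a post] R ac_simps)
  finally have "constant_term (Psi c ?rs * (WW b a * F)) = - constant_term (Psi c ?rs * (WW b a * F))"
    by (metis constant_term_perm[OF bij_swp] constant_term_uminus)
  then show ?thesis by (simp only: equal_neg_zero)
qed

lemma constant_term_PsiA_swap:
  assumes "distinct (pre @ a # b # post)" "mfls_perm (swp a b) F = F"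
  shows "constant_term (PsiA c (pre @ a # b # post) * (WW b a * F)) = 0"
proof -
  let ?A = "\<Prod>r\<leftarrow>pre @ a # b # post. al r"
  have "mfls_perm (swp a b) ?A = (\<Prod>r\<leftarrow>map (swp a b) (pre @ a # b # post). al r)"
    by (simp add: mfls_perm_prod_list_map[OF bij_swp] mfls_perm_mult[OF bij_swp] mfls_perm_series[OF bij_swp] o_def)
  also have "\<dots> = ?A"
    unfolding map_swp[OF assms(1)] by (simp add: ac_simps)
  finally have "mfls_perm (swp a b) (?A * F) = ?A * F"
    using assms(2) by (simp only: mfls_perm_mult[OF bij_swp])
  then have "constant_term (Psi c (pre @ a # b # post) * (WW b a * (?A * F))) = 0"
    by (rule constant_term_Psi_swap[OF assms(1)])
  then show ?thesis by (simp only: PsiA_def mult.assoc mult.left_commute)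
qed

subsection \<open>Reflection at the wall\<close>

lemma iX_degree: "vge z (- 1) (iX z)" "vle z (- 1) (iX z)"
proof -
  have nth: "mfls_nth (iX z) e = mfls_nth 1 (e + Poly_Mapping.single z 1)" for e
    unfolding sX_iX[of z, symmetric]
    by (subst mfls_nth_times_superset[of "{Poly_Mapping.single z 1}"])
       (auto simp: mfls_X.rep_eq split: if_splits)
  have "Poly_Mapping.lookup e z = - 1" if "mfls_nth (iX z) e \<noteq> 0" for e
  proof -
    have "e + Poly_Mapping.single z 1 = 0"
      using that by (simp add: nth one_mfls.rep_eq split: if_splits)
    then have "Poly_Mapping.lookup (e + Poly_Mapping.single z 1) z = 0" by simp
    then show ?thesis by (simp add: lookup_add)
  qed
  then show "vge z (- 1) (iX z)" "vle z (- 1) (iX z)" by (auto simp: vge_def vle_def)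
qed

definition iu :: "nat \<Rightarrow> ser" where "iu z = sE z * iX z ^ 2"

lemma uu_iu: "uu z * iu z = 1"
proof -
  have "uu z * iu z = (sX z * iX z) ^ 2 * (sE z * iE z)"
    by (simp add: uu_def iu_def power_mult_distrib ac_simps)
  then show ?thesis by (simp add: sX_iX sE_iE)
qed

lemma uu_degree: "vge z 2 (uu z)"
  using vge_mult[of z "int 2 * 1" "sX z ^ 2" 0 "iE z"] vge_power[OF vge_X, of z 2] pseries_iE[of z]
  by (simp add: uu_def pseries_def)

lemma iu_degree: "vle z (- 1) (iu z)"
proof -
  have "vle z 1 (sE z)" unfolding sE_def
  proof (rule vle_add)
    show "vle z 1 (1 :: ser)" by (auto simp: vle_def one_mfls.rep_eq split: if_splits)
  qed (rule vle_X)
  then show ?thesis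
    using vle_mult[of z 1 "sE z" "int 2 * - 1" "iX z ^ 2"] vle_power[OF iX_degree(2), of z 2]
    by (simp add: iu_def)
qed

text \<open>This replaces invariance under \<open>1 + x \<mapsto> 1 / (1 + x)\<close>, for which \<open>uu\<close> is a coordinate on the quotient.\<close>

lemma constant_term_uu_power:
  assumes "vfree z U"
  shows "constant_term (U * uu z ^ a * iu z ^ b * iX z) = 0"
proof (cases "b < a")
  \<comment> \<open>The series \<open>uu\<close> starts with \<open>x^2\<close>, whereas its inverse
    is a polynomial in \<open>1 / x\<close> without constant term. With the additional
    \<open>1 / x\<close>, neither positive nor nonpositive powers of \<open>uu\<close> reach degree
    0.\<close>
  case True
  then obtain d where d: "a = b + Suc d" using less_iff_Suc_add by auto
  have "U * uu z ^ a * iu z ^ b * iX z = U * uu z ^ Suc d * (uu z * iu z) ^ b * iX z"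
    by (simp only: d power_add power_mult_distrib ac_simps)
  also have "\<dots> = U * (uu z ^ Suc d * iX z)" by (simp only: uu_iu power_one mult_1_right mult.assoc)
  finally have e: "U * uu z ^ a * iu z ^ b * iX z = U * (uu z ^ Suc d * iX z)" .
  have "vge z (0 + (int (Suc d) * 2 + - 1)) (U * (uu z ^ Suc d * iX z))"
    by (intro vge_mult vge_power vfreeD(1) assms uu_degree iX_degree)
  then have "vge z 1 (U * (uu z ^ Suc d * iX z))" by (rule vge_mono) simp
  then show ?thesis unfolding e by (rule constant_term_vge)
next
  case False
  then obtain d where d: "b = a + d" using le_Suc_ex not_less by blast
  have "U * uu z ^ a * iu z ^ b * iX z = U * iu z ^ d * (uu z * iu z) ^ a * iX z"
    by (simp only: d power_add power_mult_distrib ac_simps)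
  also have "\<dots> = U * (iu z ^ d * iX z)" by (simp only: uu_iu power_one mult_1_right mult.assoc)
  finally have e: "U * uu z ^ a * iu z ^ b * iX z = U * (iu z ^ d * iX z)" .
  have "vle z (0 + (int d * - 1 + - 1)) (U * (iu z ^ d * iX z))"
    by (intro vle_mult vle_power vfreeD(2) assms iu_degree iX_degree)
  then have "vle z (- 1) (U * (iu z ^ d * iX z))" by (auto simp: vle_def)
  then show ?thesis unfolding e by (rule constant_term_vle)
qed

lemma constant_term_uu_laurent:
  assumes "vfree z U" and "\<And>f. f \<in> set fs \<Longrightarrow>
    \<exists>A B C. vfree z A \<and> vfree z B \<and> vfree z C \<and> f = A * uu z + B + C * iu z"
  shows "constant_term (U * uu z ^ a * iu z ^ b * prod_list fs * iX z) = 0"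
  using assms
proof (induction fs arbitrary: U a b)
  case Nil
  then show ?case using constant_term_uu_power by simp
next
  case (Cons f fs)
  from Cons.prems(2)[of f] obtain A B C where
    f: "vfree z A" "vfree z B" "vfree z C" "f = A * uu z + B + C * iu z" by auto
  have "U * uu z ^ a * iu z ^ b * prod_list (f # fs) * iX z =
      (U * A) * uu z ^ Suc a * iu z ^ b * prod_list fs * iX z +
      (U * B) * uu z ^ a * iu z ^ b * prod_list fs * iX z +
      (U * C) * uu z ^ a * iu z ^ Suc b * prod_list fs * iX z"
    by (simp add: f(4) algebra_simps)
  then show ?case
    using Cons.IH[of "U * A" "Suc a" b] Cons.IH[of "U * B" a b] Cons.IH[of "U * C" a "Suc b"] Cons.prems f
    by (simp add: constant_term_add vfree_mult)
qed

text \<open>Up to the factor \<open>sE z\<close> the series \<open>YY r z\<close> is the reflection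
  of \<open>WW r z\<close>, so their product divided by \<open>sE z\<close> is invariant under
  reflection and hence a polynomial in \<open>uu z\<close>.\<close>

lemma YY_WW: "YY r z * WW r z = sE z * (sq r ^ 2 + sE r * (sq r - sE r) * uu z)"
proof -
  have "sE z * uu z = sX z ^ 2"
    using sE_iE[of z] by (simp add: uu_def mult.left_commute)
  then have "sE z * (sq r ^ 2 + sE r * (sq r - sE r) * uu z) =
      sE z * sq r ^ 2 + sE r * (sq r - sE r) * sX z ^ 2"
    by (metis (no_types, opaque_lifting) distrib_left mult.left_commute)
  then show ?thesis
    by (simp add: YY_def WW_def sE_def sq_def algebra_simps power2_eq_square)
qed

text \<open>As the last variable, \<open>z\<close> occurs in the factors \<open>WW r z\<close> only,
  each of which finds its reflection \<open>YY r z\<close> in the kernel. Once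
  \<open>sE z ^ c\<close> has cancelled \<open>iE z ^ c\<close>, the kernel is a Laurent polynomial
  in \<open>uu z\<close>.\<close>

lemma constant_term_Psi_wall:
  assumes d: "distinct (pre @ [z])" and U: "vfree z U"
  shows "constant_term (Psi c (pre @ [z]) * (U * (sE z ^ c * iX z))) = 0"
proof -
  define n where "n = length pre"
  define U' where "U' = U * vand pre * pairprod YY pre * pairprod WW pre *
    (\<Prod>r\<leftarrow>pre. iE r ^ c * iX r ^ (2 * n))"
  define f where "f r = (uu z - uu r) * (YY r z * WW r z) * iX z ^ 2" for r
  have z: "z \<notin> set pre" using d by auto
  have vp: "vfree z (pairprod f pre)" if "\<And>s t. z \<noteq> s \<Longrightarrow> z \<noteq> t \<Longrightarrow> vfree z (f s t)" for f :: "_ \<Rightarrow> _ \<Rightarrow> ser"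
    by (rule vfree_pairprod, rule that) (use z in auto)
  have "vfree z U'"
    unfolding U'_def vand_def using z U
    by (intro vfree_mult vp vfree_YY vfree_WW vfree_diff vfree_series vfree_prod_list)
       (auto intro!: vfree_mult vfree_power vfree_series)
  moreover have "\<exists>A B C. vfree z A \<and> vfree z B \<and> vfree z C \<and> g = A * uu z + B + C * iu z"
    if "g \<in> set (map f pre)" for g
  proof -
    from that obtain r where r: "r \<in> set pre" "g = f r" by auto
    then have rz: "z \<noteq> r" using z by auto
    define a where "a = sq r ^ 2"
    define b where "b = sE r * (sq r - sE r)"
    have "g = (uu z - uu r) * (a + b * uu z) * iu z"
      unfolding r(2) f_def YY_WW a_def b_def iu_def by (simp only: ac_simps)
    also have "\<dots> = b * uu z * (uu z * iu z) + (a - b * uu r) * (uu z * iu z) + (- a * uu r) * iu z"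
      by (simp add: algebra_simps)
    finally have "g = b * uu z + (a - b * uu r) + (- a * uu r) * iu z" by (simp only: uu_iu mult_1_right)
    moreover have "vfree z a"
      unfolding a_def using rz by (intro vfree_power vfree_series)
    moreover have "vfree z b"
      unfolding b_def using rz by (intro vfree_mult vfree_diff vfree_series)
    moreover have "vfree z (uu r)" using rz by (rule vfree_series)
    ultimately show ?thesis by (intro exI[of _ b] exI[of _ "a - b * uu r"] exI[of _ "- a * uu r"])
        (auto intro!: vfree_mult vfree_diff vfree_uminus)
  qed
  ultimately have "constant_term (U' * uu z ^ 0 * iu z ^ 0 * prod_list (map f pre) * iX z) = 0"
    by (rule constant_term_uu_laurent)
  moreover have "Psi c (pre @ [z]) * (U * (sE z ^ c * iX z)) = U' * prod_list (map f pre) * iX z"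
  proof -
    have f: "(\<Prod>r\<leftarrow>pre. f r) = (\<Prod>r\<leftarrow>pre. uu z - uu r) * (\<Prod>r\<leftarrow>pre. YY r z) * (\<Prod>r\<leftarrow>pre. WW r z) * iX z ^ (2 * n)"
      unfolding n_def by (induction pre) (simp_all add: f_def power2_eq_square ac_simps)
    have "(sE z * iE z) ^ c = 1" by (simp add: sE_iE)
    then have c: "sE z ^ c * iE z ^ c = 1" by (simp only: power_mult_distrib)
    have len: "2 * length (pre @ [z]) - 2 = 2 * n" by (simp add: n_def)
    have "Psi c (pre @ [z]) * (U * (sE z ^ c * iX z)) =
        U' * ((\<Prod>r\<leftarrow>pre. uu z - uu r) * (\<Prod>r\<leftarrow>pre. YY r z) * (\<Prod>r\<leftarrow>pre. WW r z) * iX z ^ (2 * n)) *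
        (sE z ^ c * iE z ^ c) * iX z"
      unfolding Psi_def Phi_def vand_def pairprod_snoc len U'_def by (simp add: vand_def ac_simps)
    then show ?thesis unfolding c f by simp
  qed
  ultimately show ?thesis by (simp only: power_0 mult_1_right)
qed

subsection \<open>Creation of a position\<close>

text \<open>Equality after setting \<open>x_z = 0\<close>, expressed by degrees.\<close>

definition cong0 :: "nat \<Rightarrow> ser \<Rightarrow> ser \<Rightarrow> bool" where
  "cong0 z f g \<longleftrightarrow> vge z 0 f \<and> vge z 0 g \<and> vge z 1 (f - g)"

lemma cong0_refl: "vge z 0 f \<Longrightarrow> cong0 z f f"
  by (simp add: cong0_def vge_def zero_mfls.rep_eq)

lemma cong0_mult: "cong0 z f g \<Longrightarrow> cong0 z f' g' \<Longrightarrow> cong0 z (f * f') (g * g')"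
proof -
  assume a: "cong0 z f g" "cong0 z f' g'"
  have "f * f' - g * g' = f * (f' - g') + (f - g) * g'" by (simp add: algebra_simps)
  moreover have "vge z (0 + 1) (f * (f' - g'))" "vge z (1 + 0) ((f - g) * g')"
    using a unfolding cong0_def by (blast intro: vge_mult)+
  ultimately show ?thesis using a by (simp add: cong0_def vge_mult0 vge_add)
qed

lemma cong0_power: "cong0 z f g \<Longrightarrow> cong0 z (f ^ n) (g ^ n)"
  by (induction n) (auto simp: cong0_mult intro!: cong0_refl vfreeD vfree_1)

lemma cong0_prod_list: "(\<And>r. r \<in> set rs \<Longrightarrow> cong0 z (f r) (g r)) \<Longrightarrow>
    cong0 z (\<Prod>r\<leftarrow>rs. f r) (\<Prod>r\<leftarrow>rs. g r)"
  by (induction rs) (auto simp: cong0_mult intro!: cong0_refl vfreeD vfree_1)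

lemma constant_term_cong0:
  assumes "cong0 z f g" "vfree z B"
  shows "constant_term (f * B) = constant_term (g * B)"
proof -
  have "vge z (1 + 0) ((f - g) * B)"
    using assms by (intro vge_mult) (auto simp: cong0_def vfreeD)
  then have "constant_term ((f - g) * B) = 0" by (intro constant_term_vge) simp
  then show ?thesis by (simp add: left_diff_distrib constant_term_diff)
qed

lemma cong0_sX: "pseries f \<Longrightarrow> cong0 z (sX z * f + g) g" if "pseries g" for f g
  using that vge_mult[OF vge_X, of z 0 f]
  by (auto simp: cong0_def pseries_def intro!: vge_add vge_mult0 vge_X0)

lemma pseries_0: "pseries 0"
  by (simp add: pseries_def vfreeD vfree_0)

text \<open>The values at \<open>x_z = 0\<close>. What the other variables retain,
  \<open>sq r\<close> and \<open>sQ + sX r\<close>, are the numerators of \<open>- al r\<close> and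
  \<open>be r\<close>; so a created position leaves interval ends behind.\<close>

lemma cong0_basic:
  "cong0 z (sE z) 1" "cong0 z (iE z) 1" "cong0 z (YY r z) (sq r)" "cong0 z (WW r z) (sq r)"
  "cong0 z (WW z r) (sQ + sX r)" "cong0 z (gg z) 0" "cong0 z (hh z) 1"
proof -
  have e: "cong0 z h g" if "pseries f" "pseries g" "h = sX z * f + g" for f g h
    using cong0_sX[OF that(2,1)] that(3) by simp
  show "cong0 z (sE z) 1"
    by (rule e[of 1]) (simp_all add: sE_def pseries_intros)
  show "cong0 z (iE z) 1"
  proof (rule e[of "- iE z"])
    show "iE z = sX z * - iE z + 1"
      using sE_iE[of z] by (simp add: sE_def algebra_simps)
  qed (simp_all add: pseries_intros pseries_iE)
  show "cong0 z (YY r z) (sq r)"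
    by (rule e[of "(sQ - 1) + (sQ - 2) * sX r"])
       (simp_all add: YY_def sq_def pseries_intros pseries_2 algebra_simps)
  show "cong0 z (WW r z) (sq r)"
    by (rule e[of "1 + sX r"]) (simp_all add: WW_def sq_def pseries_intros algebra_simps)
  show "cong0 z (WW z r) (sQ + sX r)"
    by (rule e[of "(sQ - 1) + sX r"]) (simp_all add: WW_def pseries_intros algebra_simps)
  show "cong0 z (gg z) 0"
    by (rule e[of "- iq z"]) (simp_all add: gg_def pseries_intros pseries_iq pseries_0)
  show "cong0 z (hh z) 1"
    by (rule e[of "- (sP - 1) * iq z"]) (simp_all add: hh_def gg_def pseries_intros pseries_iq algebra_simps)
qed

lemma cong0_fz: "cong0 z (fz i z k) (if k < i then 0 else 1)"
proof (cases "k < i")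
  case True
  moreover have "cong0 z (gg z ^ (i - k) * hh z) (0 ^ (i - k) * 1)"
    by (intro cong0_mult cong0_power cong0_basic)
  ultimately have "cong0 z (fz i z k) (0 ^ (i - k) * 1)" by (simp add: fz_def)
  moreover have "(0 :: ser) ^ (i - k) = 0" using True by simp
  ultimately show ?thesis using True by (simp only: mult_1_right if_True)
next
  case False
  then show ?thesis by (auto simp: fz_def cong0_basic intro!: cong0_refl vfreeD vfree_1)
qed

fun bwave :: "nat list \<Rightarrow> nat list \<Rightarrow> ser" where
  "bwave (r # rs) (k # ks) = be r * sE r ^ k * bwave rs ks"
| "bwave [] ks = 1"
| "bwave rs [] = 1"

text \<open>The variable of position \<open>k\<close> has been set to \<open>0\<close>; this vanishes if \<open>k\<close> is frozen, since \<open>gg = 0\<close> there.\<close>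

definition hole :: "nat \<Rightarrow> nat list \<Rightarrow> nat list \<Rightarrow> nat list \<Rightarrow> nat \<Rightarrow> nat list \<Rightarrow> ser" where
  "hole i pre post kpre k kpost =
    (\<Prod>r\<leftarrow>pre. al r) * wave i pre kpre * (if k < i then 0 else 1) * bwave post kpost"

lemma wave_append:
  "length pre = length kpre \<Longrightarrow> wave i (pre @ post) (kpre @ kpost) = wave i pre kpre * wave i post kpost"
  by (induction pre kpre rule: list_induct2) (simp_all add: ac_simps)

lemma vfree_wave: "v \<notin> set rs \<Longrightarrow> vfree v (wave i rs ks)"
  by (induction i rs ks rule: wave.induct)
     (auto intro!: vfree_mult vfree_power vfree_series vfree_fz vfree_1)

lemma wave_free:
  "length rs = length ks \<Longrightarrow> (\<And>k. k \<in> set ks \<Longrightarrow> i < k) \<Longrightarrow>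
    (\<Prod>r\<leftarrow>rs. be r) * wave i rs ks = bwave rs ks"
proof (induction rs ks rule: list_induct2)
  case (Cons r rs k ks)
  then have "fz i r k = 1" by (force simp: fz_def)
  moreover have "(\<Prod>r\<leftarrow>rs. be r) * wave i rs ks = bwave rs ks" using Cons by simp
  ultimately show ?case by (simp flip: \<open>_ = bwave rs ks\<close> add: ac_simps)
qed simp

text \<open>In one term of the Laplace expansion the Vandermonde part contains \<open>z\<close> only
  as \<open>uu z ^ n\<close>, which cancels the pole \<open>iX z ^ (2 * n)\<close>. Hence
  \<open>x_z\<close> may be set to 0 in all other factors.\<close>

lemma constant_term_hole:
  assumes z: "z \<notin> set (pre @ post)"
    and len: "length pre = length kpre" "length post = length kpost"
    and kpost: "\<And>t. t \<in> set kpost \<Longrightarrow> k < t"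
  defines "n \<equiv> length (pre @ post)"
  shows "constant_term ((- 1) ^ length post * uu z ^ n * vand (pre @ post) *
      pairprod YY (pre @ z # post) * (\<Prod>r\<leftarrow>pre @ z # post. iE r ^ c * iX r ^ (2 * n)) *
      (pairprod WW (pre @ z # post) * wave i (pre @ z # post) (kpre @ k # kpost))) =
    constant_term (PsiA c (pre @ post) * hole i pre post kpre k kpost)"
proof -
  define pp where "pp = pre @ post"
  define A where "A = iE z ^ n * iE z ^ c * (\<Prod>r\<leftarrow>pp. YY r z) * ((\<Prod>r\<leftarrow>pre. WW r z) * (\<Prod>r\<leftarrow>post. WW z r)) *
    (sE z ^ k * fz i z k)"
  define A0 where "A0 = 1 ^ n * 1 ^ c * (\<Prod>r\<leftarrow>pp. sq r) * ((\<Prod>r\<leftarrow>pre. sq r) * (\<Prod>r\<leftarrow>post. sQ + sX r)) *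
    (1 ^ k * (if k < i then 0 else 1))"
  define B where "B = (- 1) ^ length post * vand pp * pairprod YY pp *
    (\<Prod>r\<leftarrow>pp. iE r ^ c * iX r ^ (2 * n)) * pairprod WW pp * (wave i pre kpre * wave i post kpost)"
  have zpp: "z \<notin> set pp" using z by (simp add: pp_def)
  have "(sX z * iX z) ^ (2 * n) = 1" by (simp add: sX_iX)
  then have XX: "sX z ^ (2 * n) * iX z ^ (2 * n) = 1" by (simp only: power_mult_distrib)
  have "uu z ^ n * iX z ^ (2 * n) = (sX z ^ (2 * n) * iX z ^ (2 * n)) * iE z ^ n"
    by (simp add: uu_def power_mult_distrib power_mult[symmetric] ac_simps)
  then have un: "uu z ^ n * iX z ^ (2 * n) = iE z ^ n" by (simp add: XX)
  have Yz: "(\<Prod>r\<leftarrow>post. YY z r) = (\<Prod>r\<leftarrow>post. YY r z)"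
    by (simp add: YY_commute[of z])
  have "(- 1) ^ length post * uu z ^ n * vand (pre @ post) *
      pairprod YY (pre @ z # post) * (\<Prod>r\<leftarrow>pre @ z # post. iE r ^ c * iX r ^ (2 * n)) *
      (pairprod WW (pre @ z # post) * wave i (pre @ z # post) (kpre @ k # kpost)) =
      (uu z ^ n * iX z ^ (2 * n)) * iE z ^ c * (\<Prod>r\<leftarrow>pp. YY r z) *
      ((\<Prod>r\<leftarrow>pre. WW r z) * (\<Prod>r\<leftarrow>post. WW z r)) * (sE z ^ k * fz i z k) * B"
    unfolding pairprod_split[of YY] pairprod_split[of WW] wave_append[OF len(1)] Yz B_def pp_def
    by (simp add: ac_simps)
  also have "\<dots> = A * B" unfolding un A_def ..
  finally have e1: "(- 1) ^ length post * uu z ^ n * vand (pre @ post) *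
      pairprod YY (pre @ z # post) * (\<Prod>r\<leftarrow>pre @ z # post. iE r ^ c * iX r ^ (2 * n)) *
      (pairprod WW (pre @ z # post) * wave i (pre @ z # post) (kpre @ k # kpost)) = A * B" .
  have cong: "cong0 z A A0"
    unfolding A_def A0_def by (intro cong0_mult cong0_power cong0_prod_list cong0_basic cong0_fz)
  have free: "vfree z B"
  proof -
    have ne: "z \<noteq> r" if "r \<in> set pp" for r using that zpp by auto
    have "vfree z ((- 1 :: ser) ^ length post)" by (intro vfree_power vfree_uminus vfree_1)
    moreover have "vfree z (vand pp)" "vfree z (pairprod YY pp)" "vfree z (pairprod WW pp)"
      unfolding vand_def by (rule vfree_pairprod; use ne in \<open>blast intro: vfree_YY vfree_WW vfree_diff vfree_series\<close>)+
    moreover have "vfree z (\<Prod>r\<leftarrow>pp. iE r ^ c * iX r ^ (2 * n))"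
    proof (rule vfree_prod_list)
      fix f assume "f \<in> set (map (\<lambda>r. iE r ^ c * iX r ^ (2 * n)) pp)"
      then obtain r where "r \<in> set pp" "f = iE r ^ c * iX r ^ (2 * n)" by auto
      then show "vfree z f" using ne[of r] by (auto intro!: vfree_mult vfree_power vfree_series)
    qed
    moreover have "vfree z (wave i pre kpre)" "vfree z (wave i post kpost)"
      using z by (auto intro!: vfree_wave)
    ultimately show ?thesis unfolding B_def by (intro vfree_mult)
  qed
  have e2: "A0 * B = PsiA c pp * hole i pre post kpre k kpost"
  proof (cases "k < i")
    case True
    then show ?thesis by (simp add: A0_def hole_def)
  next
    case False
    \<comment> \<open>With one variable fewer, two powers of \<open>iX r\<close> are set free.
      Together with the values of \<open>YY\<close> and \<open>WW\<close> at \<open>x_z = 0\<close>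
      they form \<open>al r ^ 2\<close> for \<open>r\<close> before \<open>z\<close> and, with the
      sign of the expansion, \<open>al r * be r\<close> for \<open>r\<close> after
      \<open>z\<close>.\<close>
    have rr: "iX r ^ (2 * n) = iX r ^ (2 * n - 2) * iX r ^ 2" if "r \<in> set pp" for r
    proof -
      have "n \<ge> 1" using that by (cases "pre @ post") (auto simp: n_def pp_def)
      then have "2 * n = (2 * n - 2) + 2" by simp
      then show ?thesis by (metis power_add)
    qed
    have c1: "(\<Prod>r\<leftarrow>pp. iE r ^ c * iX r ^ (2 * n)) =
        (\<Prod>r\<leftarrow>pp. iE r ^ c * iX r ^ (2 * n - 2)) * (\<Prod>r\<leftarrow>pp. iX r ^ 2)"
      unfolding prod_list_mult_distrib[symmetric]
      by (intro arg_cong[of _ _ prod_list] map_cong[OF refl]) (simp only: rr mult.assoc)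
    have c2: "(\<Prod>r\<leftarrow>pre. iX r ^ 2) * ((\<Prod>r\<leftarrow>pre. sq r) * (\<Prod>r\<leftarrow>pre. sq r)) = (\<Prod>r\<leftarrow>pre. al r) * (\<Prod>r\<leftarrow>pre. al r)"
      by (induction pre) (simp_all add: al_def power2_eq_square ac_simps)
    have c3: "(- 1) ^ length post * ((\<Prod>r\<leftarrow>post. iX r ^ 2) * ((\<Prod>r\<leftarrow>post. sq r) * (\<Prod>r\<leftarrow>post. sQ + sX r))) =
        (\<Prod>r\<leftarrow>post. al r) * (\<Prod>r\<leftarrow>post. be r)"
      by (induction post) (simp_all add: al_def be_def power2_eq_square ac_simps)
    define G where "G = vand pp * pairprod YY pp * (\<Prod>r\<leftarrow>pp. iE r ^ c * iX r ^ (2 * n - 2)) * pairprod WW pp"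
    have w: "(\<Prod>r\<leftarrow>post. be r) * wave i post kpost = bwave post kpost"
    proof (rule wave_free[OF len(2)])
      fix t assume "t \<in> set kpost"
      then show "i < t" using kpost[of t] False by linarith
    qed
    have "A0 * B = G * ((\<Prod>r\<leftarrow>pre. iX r ^ 2) * ((\<Prod>r\<leftarrow>pre. sq r) * (\<Prod>r\<leftarrow>pre. sq r))) *
      ((- 1) ^ length post * ((\<Prod>r\<leftarrow>post. iX r ^ 2) * ((\<Prod>r\<leftarrow>post. sq r) * (\<Prod>r\<leftarrow>post. sQ + sX r)))) *
      (wave i pre kpre * wave i post kpost)"
      unfolding A0_def B_def c1 G_def using False by (simp add: pp_def ac_simps)
    also have "\<dots> = G * ((\<Prod>r\<leftarrow>pre. al r) * (\<Prod>r\<leftarrow>post. al r)) *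
        ((\<Prod>r\<leftarrow>pre. al r) * wave i pre kpre * ((\<Prod>r\<leftarrow>post. be r) * wave i post kpost))"
      unfolding c2 c3 by (simp only: ac_simps)
    also have "\<dots> = PsiA c pp * hole i pre post kpre k kpost"
      unfolding w PsiA_def Psi_def Phi_def G_def hole_def using False by (simp add: pp_def n_def ac_simps)
    finally show ?thesis .
  qed
  show ?thesis unfolding e1 using constant_term_cong0[OF cong free] e2 by (simp add: pp_def)
qed

lemma ex_bij_map:
  fixes xs ys :: "nat list"
  assumes "distinct xs" "distinct ys" "length xs = length ys"
  shows "\<exists>\<sigma>. bij \<sigma> \<and> map \<sigma> xs = ys"
  using assms(3,1,2)
proof (induction xs ys rule: list_induct2)
  case Nil
  then show ?case by (auto intro: exI[of _ id])
next
  case (Cons x xs y ys)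
  then obtain \<sigma> where \<sigma>: "bij \<sigma>" "map \<sigma> xs = ys" by auto
  let ?\<tau> = "swp (\<sigma> x) y \<circ> \<sigma>"
  have "bij ?\<tau>" using \<sigma>(1) bij_swp by (rule bij_comp)
  moreover have "?\<tau> x = y" by (simp add: swp_def)
  moreover have "?\<tau> t = \<sigma> t" if "t \<in> set xs" for t
  proof -
    have "\<sigma> t \<noteq> \<sigma> x" using Cons.prems(1) that \<sigma>(1) by (metis bij_pointE distinct.simps(2))
    moreover have "\<sigma> t \<in> set ys" using \<sigma>(2) that by auto
    ultimately show ?thesis using Cons.prems(2) by (auto simp: swp_def)
  qed
  ultimately have "bij ?\<tau> \<and> map ?\<tau> (x # xs) = y # ys" using \<sigma>(2) by auto
  then show ?case by (rule exI[of _ ?\<tau>])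
qed

lemma mfls_perm_wave: "bij \<sigma> \<Longrightarrow> mfls_perm \<sigma> (wave i rs ks) = wave i (map \<sigma> rs) ks"
  by (induction i rs ks rule: wave.induct)
     (auto simp: mfls_perm_mult mfls_perm_power mfls_perm_series mfls_perm_1 fz_def)

lemma mfls_perm_bwave: "bij \<sigma> \<Longrightarrow> mfls_perm \<sigma> (bwave rs ks) = bwave (map \<sigma> rs) ks"
  by (induction rs ks rule: bwave.induct)
     (auto simp: mfls_perm_mult mfls_perm_power mfls_perm_series mfls_perm_1)

lemma mfls_perm_hole:
  "bij \<sigma> \<Longrightarrow> mfls_perm \<sigma> (hole i pre post kpre k kpost) = hole i (map \<sigma> pre) (map \<sigma> post) kpre k kpost"
  by (simp add: hole_def mfls_perm_mult mfls_perm_prod_list_map mfls_perm_series mfls_perm_wave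
      mfls_perm_bwave mfls_perm_0 mfls_perm_1 o_def)

lemma rights_True: "length rs = length ks \<Longrightarrow> rights True rs (k # ks) = bwave rs ks"
  by (induction rs ks arbitrary: k rule: list_induct2) simp_all

text \<open>An even row has one position more than variables: \<open>j\<close> is the position
  without a variable, with left ends before it and right ends after it.\<close>

lemma tmain_True:
  "Suc (length rs) = length ks \<Longrightarrow> tmain True i rs ks =
    (\<Sum>j<length ks. hole i (take j rs) (drop j rs) (take j ks) (ks ! j) (drop (Suc j) ks))"
proof (induction ks arbitrary: rs)
  case (Cons k ks)
  show ?case
  proof (cases rs)
    case Nil
    then show ?thesis using Cons.prems by (simp add: hole_def)
  next
    case (Cons r rs1)
    have "(\<Sum>j<length (k # ks). hole i (take j rs) (drop j rs) (take j (k # ks)) ((k # ks) ! j) (drop (Suc j) (k # ks))) =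
      hole i [] rs [] k ks + (\<Sum>j<length ks. hole i (r # take j rs1) (drop j rs1) (k # take j ks) (ks ! j) (drop (Suc j) ks))"
      unfolding Cons by (simp add: sum.lessThan_Suc_shift del: sum.lessThan_Suc)
    also have "\<dots> = (if k < i then 0 else rights True rs (k # ks)) + al r * sE r ^ k * fz i r k *
      (\<Sum>j<length ks. hole i (take j rs1) (drop j rs1) (take j ks) (ks ! j) (drop (Suc j) ks))"
      using Cons.prems rights_True[of rs ks k]
      by (simp add: sum_distrib_left hole_def ac_simps)
    finally show ?thesis
      using Cons.prems Cons.IH[of rs1] Cons by simp
  qed
qed simp

lemma uu_inject: "uu r = uu s \<Longrightarrow> r = s"
proof (rule ccontr)
  assume a: "uu r = uu s" "r \<noteq> s"
  then have "vfree r (uu r)" using vfree_series(10)[of r s] by simp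
  moreover have "uu r \<noteq> 0" using uu_iu[of r] by auto
  then obtain e where "mfls_nth (uu r) e \<noteq> 0" by (metis mfls_eqI zero_mfls.rep_eq)
  ultimately show False using uu_degree[of r] by (force simp: vfree_def vge_def)
qed

text \<open>The \<open>j\<close>-th term of the Laplace expansion creates the \<open>j\<close>-th
  position. A constant term does not depend on the names of the variables, so the variables
  remaining in each term can be renamed to \<open>rs\<close>.\<close>

lemma even_step:
  assumes RS: "distinct RS" "length RS = Suc p" and rs: "distinct rs" "length rs = p"
    and ks: "sorted_wrt (<) ks" "length ks = Suc p"
  shows "constant_term (Psi c RS * wave i RS ks) = constant_term (PsiA c rs * tmain True i rs ks)"
proof -
  define W where "W = pairprod YY RS * (\<Prod>r\<leftarrow>RS. iE r ^ c * iX r ^ (2 * p)) * (pairprod WW RS * wave i RS ks)"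
  have "distinct (map uu RS)"
    using RS(1) by (auto simp: distinct_map inj_on_def dest: uu_inject)
  then have V: "vand RS = (\<Sum>j<Suc p. (- 1) ^ (p - j) * uu (RS ! j) ^ p * vand (del_nth j RS))"
    using vandermonde_laplace[of uu RS] RS(2) by (cases RS) (simp_all add: vand_def)
  have "Psi c RS * wave i RS ks = vand RS * W"
    using RS(2) by (simp add: Psi_def Phi_def W_def ac_simps)
  then have "constant_term (Psi c RS * wave i RS ks) =
      (\<Sum>j<Suc p. constant_term ((- 1) ^ (p - j) * uu (RS ! j) ^ p * vand (del_nth j RS) * W))"
    unfolding V by (simp only: sum_distrib_right constant_term_sum)
  also have "\<dots> = (\<Sum>j<Suc p. constant_term (PsiA c rs *
      hole i (take j rs) (drop j rs) (take j ks) (ks ! j) (drop (Suc j) ks)))"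
  proof (rule sum.cong[OF refl])
    fix j assume "j \<in> {..<Suc p}"
    then have j: "j < Suc p" by simp
    let ?pre = "take j RS" and ?post = "drop (Suc j) RS"
    have R: "RS = ?pre @ RS ! j # ?post" using j RS(2) by (intro split_at_nth) simp
    have K: "ks = take j ks @ ks ! j # drop (Suc j) ks" using j ks(2) by (intro split_at_nth) simp
    have len: "length ?pre = j" "length ?post = p - j" "length (?pre @ ?post) = p"
      using j RS(2) by auto
    have d: "RS ! j \<notin> set (?pre @ ?post)" "distinct (?pre @ ?post)"
      using RS(1) R by (metis distinct_append distinct.simps(2) not_distinct_conv_prefix Un_iff set_append
          disjoint_iff list.set_intros(1), metis RS(1) R distinct_append distinct.simps(2) disjoint_iff
          list.set_intros(2))
    have kp: "ks ! j < t" if "t \<in> set (drop (Suc j) ks)" for t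
      using ks(1) that K by (metis sorted_wrt_append sorted_wrt.simps(2))
    have e1: "(- 1) ^ (p - j) * uu (RS ! j) ^ p * vand (del_nth j RS) * W =
      (- 1) ^ length ?post * uu (RS ! j) ^ length (?pre @ ?post) * vand (?pre @ ?post) *
      pairprod YY (?pre @ RS ! j # ?post) *
      (\<Prod>r\<leftarrow>?pre @ RS ! j # ?post. iE r ^ c * iX r ^ (2 * length (?pre @ ?post))) *
      (pairprod WW (?pre @ RS ! j # ?post) *
      wave i (?pre @ RS ! j # ?post) (take j ks @ ks ! j # drop (Suc j) ks))"
      unfolding len R[symmetric] K[symmetric] W_def del_nth_def by (simp only: mult.assoc)
    have e2: "constant_term ((- 1) ^ (p - j) * uu (RS ! j) ^ p * vand (del_nth j RS) * W) =
        constant_term (PsiA c (?pre @ ?post) *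
        hole i ?pre ?post (take j ks) (ks ! j) (drop (Suc j) ks))"
      unfolding e1 by (rule constant_term_hole) (use d kp len ks(2) j in auto)
    have e3: "constant_term (PsiA c (?pre @ ?post) *
        hole i ?pre ?post (take j ks) (ks ! j) (drop (Suc j) ks)) = constant_term (PsiA c rs *
      hole i (take j rs) (drop j rs) (take j ks) (ks ! j) (drop (Suc j) ks))"
    proof -
      have "length (?pre @ ?post) = length rs" using len(3) rs(2) by simp
      from ex_bij_map[OF d(2) rs(1) this] obtain \<sigma> where "bij \<sigma> \<and> map \<sigma> (?pre @ ?post) = rs" ..
      then have \<sigma>: "bij \<sigma>" "map \<sigma> (?pre @ ?post) = rs" by (rule conjunct1, rule conjunct2)
      have "map \<sigma> ?pre = take j rs" "map \<sigma> ?post = drop j rs"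
        using \<sigma>(2) len(1) by (auto simp flip: \<sigma>(2))
      then have "PsiA c rs * hole i (take j rs) (drop j rs) (take j ks) (ks ! j) (drop (Suc j) ks) =
        mfls_perm \<sigma> (PsiA c (?pre @ ?post) * hole i ?pre ?post (take j ks) (ks ! j) (drop (Suc j) ks))"
        using \<sigma> by (simp only: mfls_perm_mult mfls_perm_PsiA mfls_perm_hole)
      then show ?thesis by (simp only: constant_term_perm[OF \<sigma>(1)])
    qed
    show "constant_term ((- 1) ^ (p - j) * uu (RS ! j) ^ p * vand (del_nth j RS) * W) =
      constant_term (PsiA c rs * hole i (take j rs) (drop j rs) (take j ks) (ks ! j) (drop (Suc j) ks))"
      by (rule trans[OF e2 e3])
  qed
  also have "\<dots> = constant_term (PsiA c rs * tmain True i rs ks)"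
    using rs(2) ks(2) by (simp only: tmain_True sum_distrib_left constant_term_sum)
  finally show ?thesis .
qed

subsection \<open>The count with prescribed positions\<close>

fun FF :: "nat \<Rightarrow> nat \<Rightarrow> nat list \<Rightarrow> ratfun" where
  "FF m 0 ks = (if ks = [] then 1 else 0)"
| "FF m (Suc i) ks =
    (\<Sum>ls\<in>preds (even (Suc i)) m (Suc i) ks. step_weight (Suc i) ls ks * FF m i ls)"

lemma preds_le:
  "ls \<in> preds ev m i ks \<Longrightarrow> (\<And>k. k \<in> set ks \<Longrightarrow> k \<le> m) \<Longrightarrow> l \<in> set ls \<Longrightarrow> l \<le> m"
  by (induction ev m i ks arbitrary: ls l rule: preds.induct) (auto split: if_splits, force+)

lemma tmain_False:
  "length rs = length ks \<Longrightarrow> tmain False i rs ks = (\<Prod>r\<leftarrow>rs. al r) * wave i rs ks"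
proof (induction rs ks rule: list_induct2)
  case (Cons r rs k ks)
  have "rights False rs ks = 0" for rs ks
    by (induction False rs ks rule: rights.induct) auto
  with Cons show ?case by (simp add: ac_simps)
qed simp

theorem FF_eq_constant_term:
  assumes "sorted_wrt (<) ks" "\<And>k. k \<in> set ks \<Longrightarrow> k \<le> m" "length ks = i div 2"
    "distinct rs" "length rs = length ks"
  shows "FF m i ks = constant_term ((if even i then Psi (Suc m) rs else PsiA (Suc m) rs) * wave i rs ks)"
  using assms
proof (induction i arbitrary: ks rs)
  case 0
  then show ?case by (simp add: Psi_def Phi_def vand_def)
next
  case (Suc i)
  let ?ev = "even (Suc i)" and ?i = "Suc i"
  \<comment> \<open>An even row introduces a variable, so the preceding row is described with one
    variable fewer; any distinct variables of that number would do.\<close>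
  define qs where "qs = (if ?ev then tl rs else rs)"
  define \<Psi> where "\<Psi> = (if even i then Psi (Suc m) qs else PsiA (Suc m) qs)"
  have qs: "distinct qs" "length qs + (if ?ev then 1 else 0) = length ks"
  proof -
    have "length rs > 0" if "odd i" using Suc.prems that by (auto elim!: oddE)
    then show "distinct qs" "length qs + (if ?ev then 1 else 0) = length ks"
      using Suc.prems by (auto simp: qs_def distinct_tl)
  qed
  have qlen: "length qs = i div 2"
    using qs(2) Suc.prems(3) by (auto split: if_splits elim!: oddE evenE)
  have "FF m ?i ks = (\<Sum>ls\<in>preds ?ev m ?i ks. step_weight ?i ls ks * constant_term (\<Psi> * wave i qs ls))"
  proof (unfold FF.simps, rule sum.cong[OF refl])
    fix ls assume ls: "ls \<in> preds ?ev m ?i ks"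
    have "FF m i ls = constant_term (\<Psi> * wave i qs ls)"
      unfolding \<Psi>_def
    proof (rule Suc.IH)
      show "sorted_wrt (<) ls" by (rule preds_sorted[OF ls Suc.prems(1)])
      show "\<And>k. k \<in> set ls \<Longrightarrow> k \<le> m" using preds_le[OF ls Suc.prems(2)] by blast
      show "length ls = i div 2" "length qs = length ls"
        using preds_length[OF ls] qs(2) qlen by simp_all
    qed (rule qs(1))
    then show "step_weight ?i ls ks * FF m i ls = step_weight ?i ls ks * constant_term (\<Psi> * wave i qs ls)"
      by simp
  qed
  also have "\<dots> = constant_term (\<Psi> * (\<Sum>ls\<in>preds ?ev m ?i ks. mfls_const (step_weight ?i ls ks) * wave i qs ls))"
    by (simp add: sum_distrib_left constant_term_sum mult.left_commute[of \<Psi>] constant_term_const_times)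
  also have "(\<Sum>ls\<in>preds ?ev m ?i ks. mfls_const (step_weight ?i ls ks) * wave i qs ls) = tsum ?ev m ?i qs ks"
    using sum_preds_eq_tsum[of ks m ?i qs ?ev] Suc.prems qs by simp
  finally have F: "FF m ?i ks = constant_term (\<Psi> * tsum ?ev m ?i qs ks)" .
  have "constant_term (\<Psi> * (1 * tsum ?ev m ?i qs ks)) = constant_term (\<Psi> * (1 * tmain ?ev ?i qs ks))"
  proof (rule row_step[OF qs(1), where pre = "[]"])
    fix pre a b post and F :: ser assume "qs = pre @ a # b # post" "mfls_perm (swp a b) F = F"
    then show "constant_term (\<Psi> * (WW b a * F)) = 0"
      using qs(1) constant_term_Psi_swap constant_term_PsiA_swap by (simp add: \<Psi>_def)
  next
    fix pre z and U :: ser assume "\<not> ?ev" "qs = pre @ [z]" "vfree z U"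
    then show "constant_term (\<Psi> * (U * (sE z ^ Suc m * iX z))) = 0"
      using qs(1) constant_term_Psi_wall[of pre z U "Suc m"] by (simp add: \<Psi>_def del: power_Suc)
  qed (use Suc.prems qs in \<open>auto simp: vfree_1\<close>)
  with F have main: "FF m ?i ks = constant_term (\<Psi> * tmain ?ev ?i qs ks)" by simp
  show ?case
  proof (cases "even i")
    case True
    then have "\<Psi> * tmain ?ev ?i qs ks = PsiA (Suc m) rs * wave ?i rs ks"
      using Suc.prems(5) by (simp add: \<Psi>_def qs_def tmain_False PsiA_def mult.assoc)
    then show ?thesis using main True by simp
  next
    case False
    have "constant_term (Psi (Suc m) rs * wave ?i rs ks) = constant_term (PsiA (Suc m) qs * tmain True ?i qs ks)"
      by (rule even_step[where p = "length qs"]) (use Suc.prems qs False in auto)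
    then show ?thesis using main False by (simp add: \<Psi>_def)
  qed
qed

section \<open>Summation over the positions\<close>

definition yy :: "nat \<Rightarrow> ser" where "yy r = gg r * iE r"

definition Yp :: "nat list \<Rightarrow> ser" where "Yp rs = (\<Prod>r\<leftarrow>rs. yy r)"

text \<open>The sum of all \<open>dwave\<close> terms over increasing positions at most
  \<open>n\<close> without a lower bound. The sums over the gaps are geometric, and the minimal gap
  1 between neighbours accounts for \<open>Yp (take j rs)\<close>.\<close>

definition GG :: "nat list \<Rightarrow> ser" where
  "GG rs = (\<Prod>j<length rs. Yp (take j rs) * inverse (1 - Yp (take (Suc j) rs)))"

lemma Yp_snoc: "Yp (rs @ [r]) = Yp rs * yy r"
  by (simp add: Yp_def)

lemma GG_snoc: "GG (rs @ [r]) = GG rs * (Yp rs * inverse (1 - Yp (rs @ [r])))"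
  by (simp add: GG_def)

lemma pseries_yy: "pseries (yy r)"
  unfolding yy_def by (intro pseries_mult pseries_gg pseries_iE)

lemma yy_degree: "vge r 1 (yy r)"
proof -
  have "vge r (1 + 0) (sX r * (- iq r * iE r))"
    using pseries_mult[OF pseries_uminus[OF pseries_iq] pseries_iE]
    by (intro vge_mult vge_X) (simp add: pseries_def)
  then show ?thesis by (simp add: yy_def gg_def ac_simps)
qed

lemma pseries_Yp: "pseries (Yp rs)"
  unfolding Yp_def by (intro pseries_prod_list) (auto simp: pseries_yy)

lemma Yp_degree: "r \<in> set rs \<Longrightarrow> vge r 1 (Yp rs)"
proof (induction rs)
  case (Cons a rs)
  have "vge r (1 + 0) (yy r * Yp rs)" using pseries_Yp[of rs] by (intro vge_mult yy_degree) (simp add: pseries_def)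
  moreover have "vge r (0 + 1) (yy a * Yp rs)" if "r \<in> set rs"
    using Cons.IH[OF that] pseries_yy[of a] by (intro vge_mult) (simp_all add: pseries_def)
  ultimately show ?case using Cons.prems by (auto simp: Yp_def)
qed simp

lemma one_minus_Yp_unit:
  assumes "rs \<noteq> []"
  shows "1 - Yp rs dvd 1" "pseries (inverse (1 - Yp rs))"
proof -
  have "vge (hd rs) 1 (Yp rs)" using assms by (intro Yp_degree) simp
  then have "constant_term (Yp rs) = 0" by (rule constant_term_vge)
  then have "constant_term (1 - Yp rs) \<noteq> 0" by (simp add: constant_term_diff)
  moreover have "pseries (1 - Yp rs)" by (intro pseries_diff pseries_1 pseries_Yp)
  ultimately show "1 - Yp rs dvd 1" "pseries (inverse (1 - Yp rs))" using pseries_unit by blast+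
qed

lemma one_minus_yy_unit: "1 - yy r dvd 1" "pseries (inverse (1 - yy r))"
  using one_minus_Yp_unit[of "[r]"] by (simp_all add: Yp_def)

lemma pseries_GG: "pseries (GG rs)"
proof (induction rs rule: rev_induct)
  case (snoc r rs)
  then show ?case unfolding GG_snoc using one_minus_Yp_unit[of "rs @ [r]"]
    by (intro pseries_mult pseries_Yp) auto
qed (simp add: GG_def pseries_1)

section \<open>Sums over increasing positions\<close>

definition pos_lists :: "nat \<Rightarrow> nat \<Rightarrow> nat list set" where
  "pos_lists hi N = {ks. sorted_wrt (<) ks \<and> set ks \<subseteq> {1..hi} \<and> length ks = N}"

lemma finite_pos_lists: "finite (pos_lists hi N)"
  by (rule finite_subset[OF _ finite_lists_length_eq[of "{1..hi}" N]]) (auto simp: pos_lists_def)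

lemma sum_pos_lists_Suc:
  "(\<Sum>ks\<in>pos_lists hi (Suc N). f ks) = (\<Sum>k\<in>{1..hi}. \<Sum>ks\<in>pos_lists (k - 1) N. f (ks @ [k]))"
proof -
  have "(\<Sum>k\<in>{1..hi}. \<Sum>ks\<in>pos_lists (k - 1) N. f (ks @ [k])) =
      (\<Sum>(k, ks)\<in>(SIGMA k:{1..hi}. pos_lists (k - 1) N). f (ks @ [k]))"
    by (rule sum.Sigma) (auto simp: finite_pos_lists)
  also have "\<dots> = (\<Sum>ks\<in>pos_lists hi (Suc N). f ks)"
  proof (rule sum.reindex_bij_witness[of _ "\<lambda>ks. (last ks, butlast ks)" "\<lambda>(k, ks). ks @ [k]"])
    fix a assume "a \<in> (SIGMA k:{1..hi}. pos_lists (k - 1) N)"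
    then obtain k ks where a: "a = (k, ks)" "k \<in> {1..hi}" "ks \<in> pos_lists (k - 1) N" by auto
    have "\<forall>x\<in>set ks. 1 \<le> x \<and> x < k" using a by (force simp: pos_lists_def)
    then show "(case a of (k, ks) \<Rightarrow> ks @ [k]) \<in> pos_lists hi (Suc N)"
      using a by (auto simp: pos_lists_def sorted_wrt_append)
  next
    fix ks assume ks: "ks \<in> pos_lists hi (Suc N)"
    then obtain l k where l: "ks = l @ [k]" by (cases ks rule: rev_cases) (auto simp: pos_lists_def)
    have "\<forall>x\<in>set l. 1 \<le> x \<and> x < k" using ks l by (force simp: pos_lists_def sorted_wrt_append)
    then have "set l \<subseteq> {1..k - 1}" by force
    then show "(last ks, butlast ks) \<in> (SIGMA k:{1..hi}. pos_lists (k - 1) N)"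
      using ks l by (auto simp: pos_lists_def sorted_wrt_append)
    show "(case (last ks, butlast ks) of (k, ks) \<Rightarrow> ks @ [k]) = ks" using l by simp
  qed auto
  finally show ?thesis by simp
qed

fun dwave :: "nat \<Rightarrow> nat list \<Rightarrow> nat list \<Rightarrow> ser" where
  "dwave n (r # rs) (k # ks) = yy r ^ (n - k) * dwave n rs ks"
| "dwave n [] ks = 1"
| "dwave n rs [] = 1"

lemma dwave_snoc:
  "length rs = length ks \<Longrightarrow> dwave n (rs @ [r]) (ks @ [k]) = dwave n rs ks * yy r ^ (n - k)"
  by (induction rs ks rule: list_induct2) (simp_all add: ac_simps)

text \<open>Since no final position exceeds \<open>n\<close>, each wave has the form
  \<open>sE r ^ k * gg r ^ (n - k) * hh r\<close>, and extracting \<open>sE r ^ n\<close> leaves a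
  geometric progression in \<open>yy\<close>.\<close>

lemma wave_eq_dwave:
  "length rs = length ks \<Longrightarrow> (\<And>k. k \<in> set ks \<Longrightarrow> k \<le> n) \<Longrightarrow>
    wave n rs ks = (\<Prod>r\<leftarrow>rs. sE r ^ n * hh r) * dwave n rs ks"
proof (induction rs ks rule: list_induct2)
  case (Cons r rs k ks)
  have k: "k \<le> n" using Cons.prems by simp
  then have "sE r ^ n * yy r ^ (n - k) = sE r ^ k * gg r ^ (n - k) * (sE r * iE r) ^ (n - k)"
    by (simp add: yy_def power_mult_distrib ac_simps flip: power_add)
  then have e: "sE r ^ n * yy r ^ (n - k) = sE r ^ k * gg r ^ (n - k)" by (simp add: sE_iE)
  have "wave n (r # rs) (k # ks) = (sE r ^ k * gg r ^ (n - k)) * hh r * wave n rs ks"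
    using k by (simp add: fz_def ac_simps)
  also have "wave n rs ks = (\<Prod>r\<leftarrow>rs. sE r ^ n * hh r) * dwave n rs ks"
    using Cons by simp
  finally show ?case unfolding e[symmetric] by (simp add: ac_simps)
qed simp

lemma vge_iX_prod:
  "distinct rs \<Longrightarrow> vge r (- int k) (\<Prod>s\<leftarrow>rs. iX s ^ k)"
proof (induction rs)
  case Nil
  then show ?case using vge_mono[OF vfreeD(1)[OF vfree_1], of "- int k"] by simp
next
  case (Cons a rs)
  show ?case
  proof (cases "a = r")
    case True
    then have "vfree r (\<Prod>s\<leftarrow>rs. iX s ^ k)"
      using Cons.prems by (intro vfree_prod_list) (auto intro!: vfree_power vfree_series)
    then have "vge r (int k * - 1 + 0) (iX a ^ k * (\<Prod>s\<leftarrow>rs. iX s ^ k))"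
      using True by (intro vge_mult vge_power vfreeD(1)) (simp_all add: iX_degree)
    then show ?thesis by simp
  next
    case False
    then have "vge r (0 + - int k) (iX a ^ k * (\<Prod>s\<leftarrow>rs. iX s ^ k))"
      using Cons by (intro vge_mult vfreeD(1) vfree_power vfree_series) auto
    then show ?thesis by simp
  qed
qed

lemma pseries_pairprod: "(\<And>s t. pseries (f s t)) \<Longrightarrow> pseries (pairprod f rs)"
  by (induction rs) (auto intro!: pseries_mult pseries_prod_list pseries_1)

lemma vge_Phi:
  assumes "distinct rs"
  shows "vge r (- int (2 * length rs - 2)) (Phi c rs)"
proof -
  let ?k = "2 * length rs - 2"
  have "pseries (vand rs * pairprod YY rs * (\<Prod>r\<leftarrow>rs. iE r ^ c))"
    unfolding vand_def
    by (intro pseries_mult pseries_pairprod pseries_series pseries_diff pseries_prod_list)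
       (auto intro!: pseries_power pseries_iE)
  then have "vge r (0 + - int ?k) (vand rs * pairprod YY rs * (\<Prod>r\<leftarrow>rs. iE r ^ c) * (\<Prod>s\<leftarrow>rs. iX s ^ ?k))"
    by (intro vge_mult vge_iX_prod assms) (simp add: pseries_def)
  then show ?thesis by (simp add: Phi_def prod_list_mult_distrib ac_simps)
qed

lemma geometric_tail:
  "hi \<le> n \<Longrightarrow> (1 - Y) * (\<Sum>k\<in>{1..hi}. Y ^ (n - k)) = Y ^ (n - hi) - (Y :: 'a::comm_ring_1) ^ n"
proof (induction hi)
  case (Suc hi)
  have "n - hi = Suc (n - Suc hi)" using Suc.prems by simp
  then show ?case using Suc by (simp add: algebra_simps)
qed simp

lemma constant_term_sum_pos_lists:
  assumes d: "distinct Rs" and n: "n = 2 * length Rs" and Rs: "Rs = rs @ post" and hi: "hi \<le> n"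
    and U: "pseries U" and V: "pseries V"
  shows "constant_term (Phi c Rs * V * (U * (\<Sum>ks\<in>pos_lists hi (length rs). dwave n rs ks))) =
    constant_term (Phi c Rs * V * (U * (Yp rs ^ (n - hi) * GG rs)))"
  using Rs hi U
proof (induction rs arbitrary: post hi U rule: rev_induct)
  case Nil
  have "pos_lists hi 0 = {[]}" by (auto simp: pos_lists_def)
  then show ?case by (simp add: Yp_def GG_def)
next
  case (snoc r rs)
  let ?K = "Phi c Rs * V" and ?Y = "Yp (rs @ [r])"
  define I where "I = inverse (1 - ?Y)"
  have I: "(1 - ?Y) * I = 1" "pseries I"
    unfolding I_def using one_minus_Yp_unit[of "rs @ [r]"] by (auto intro: mfls_inverse_right)
  have IH: "constant_term (?K * (U * yy r ^ (n - k) * (\<Sum>ks\<in>pos_lists (k - 1) (length rs). dwave n rs ks))) =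
      constant_term (?K * (U * (Yp rs * GG rs) * ?Y ^ (n - k)))" if k: "k \<in> {1..hi}" for k
  proof -
    \<comment> \<open>The other positions are at most \<open>k - 1\<close>; this strict inequality
      costs the extra factor \<open>Yp rs\<close>.\<close>
    have "n - (k - 1) = Suc (n - k)" using k snoc.prems(2) by auto
    then have e: "U * yy r ^ (n - k) * (Yp rs ^ (n - (k - 1)) * GG rs) = U * (Yp rs * GG rs) * ?Y ^ (n - k)"
      by (simp add: Yp_snoc power_mult_distrib ac_simps)
    have "constant_term (?K * (U * yy r ^ (n - k) * (\<Sum>ks\<in>pos_lists (k - 1) (length rs). dwave n rs ks))) =
      constant_term (?K * (U * yy r ^ (n - k) * (Yp rs ^ (n - (k - 1)) * GG rs)))"
      by (rule snoc.IH[of "r # post"])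
         (use snoc.prems k in \<open>auto intro!: pseries_mult pseries_power pseries_yy\<close>)
    then show ?thesis unfolding e .
  qed
  have "(\<Sum>ks\<in>pos_lists hi (length (rs @ [r])). dwave n (rs @ [r]) ks) =
      (\<Sum>k\<in>{1..hi}. \<Sum>ks\<in>pos_lists (k - 1) (length rs). dwave n (rs @ [r]) (ks @ [k]))"
    by (simp only: length_append_singleton sum_pos_lists_Suc)
  also have "\<dots> = (\<Sum>k\<in>{1..hi}. yy r ^ (n - k) * (\<Sum>ks\<in>pos_lists (k - 1) (length rs). dwave n rs ks))"
    unfolding sum_distrib_left
    by (intro sum.cong refl) (subst dwave_snoc, auto simp: pos_lists_def mult.commute)
  finally have "constant_term (?K * (U * (\<Sum>ks\<in>pos_lists hi (length (rs @ [r])). dwave n (rs @ [r]) ks))) =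
      (\<Sum>k\<in>{1..hi}. constant_term (?K * (U * yy r ^ (n - k) * (\<Sum>ks\<in>pos_lists (k - 1) (length rs). dwave n rs ks))))"
    by (simp only: sum_distrib_left constant_term_sum mult.assoc)
  also have "\<dots> = (\<Sum>k\<in>{1..hi}. constant_term (?K * (U * (Yp rs * GG rs) * ?Y ^ (n - k))))"
    by (intro sum.cong refl IH)
  also have "\<dots> = constant_term (?K * (U * (Yp rs * GG rs) * (\<Sum>k\<in>{1..hi}. ?Y ^ (n - k))))"
    by (simp only: sum_distrib_left constant_term_sum)
  also have "(\<Sum>k\<in>{1..hi}. ?Y ^ (n - k)) = (?Y ^ (n - hi) - ?Y ^ n) * I"
  proof -
    have "(\<Sum>k\<in>{1..hi}. ?Y ^ (n - k)) = ((1 - ?Y) * I) * (\<Sum>k\<in>{1..hi}. ?Y ^ (n - k))"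
      by (simp add: I)
    also have "\<dots> = ((1 - ?Y) * (\<Sum>k\<in>{1..hi}. ?Y ^ (n - k))) * I" by (simp only: ac_simps)
    finally show ?thesis by (simp only: geometric_tail[OF snoc.prems(2)])
  qed
  also have "?K * (U * (Yp rs * GG rs) * ((?Y ^ (n - hi) - ?Y ^ n) * I)) =
      ?K * (U * (?Y ^ (n - hi) * GG (rs @ [r]))) - Phi c Rs * (V * (U * (Yp rs * GG rs) * I) * ?Y ^ n)"
    unfolding GG_snoc I_def[symmetric] by (simp add: algebra_simps)
  also have "constant_term \<dots> = constant_term (?K * (U * (?Y ^ (n - hi) * GG (rs @ [r]))))"
  proof -
    have ps: "pseries (V * (U * (Yp rs * GG rs) * I))"
      using V snoc.prems(3) I(2) by (intro pseries_mult pseries_Yp pseries_GG)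
    have "vge r (- int (2 * length Rs - 2) + (0 + int n * 1)) (Phi c Rs * (V * (U * (Yp rs * GG rs) * I) * ?Y ^ n))"
      by (intro vge_mult vge_Phi d vge_power Yp_degree) (use ps in \<open>auto simp: pseries_def\<close>)
    moreover have "- int (2 * length Rs - 2) + (0 + int n * 1) \<ge> 1"
      using n snoc.prems(1) by simp
    ultimately have "vge r 1 (Phi c Rs * (V * (U * (Yp rs * GG rs) * I) * ?Y ^ n))" by (rule vge_mono)
    then show ?thesis by (simp add: constant_term_diff constant_term_vge)
  qed
  finally show ?case .
qed

section \<open>Symmetrization\<close>

definition TT :: "nat \<Rightarrow> nat \<Rightarrow> ser" where
  "TT s t = sQ * (1 + sX s) * (1 + sX t) - sX s * sX t"

text \<open>The pair factor of the answer. Its reciprocal is what accompanies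
  \<open>WW s c * yy s\<close> in \<open>symmetrizer_identity_field\<close>.\<close>

definition JJ :: "nat \<Rightarrow> nat \<Rightarrow> ser" where
  "JJ s t = (sX t - sX s) * ((sQ - sX s * sX t) * inverse (TT s t))"

definition II :: "nat list \<Rightarrow> ser" where
  "II rs = (\<Prod>r\<leftarrow>rs. inverse (1 - yy r)) * pairprod JJ rs"

text \<open>The summand with \<open>c\<close> as last variable: the symmetrized \<open>II\<close> of
  the others times what \<open>pairprod WW\<close> and \<open>GG\<close> gain by appending
  \<open>c\<close>, apart from the inverse of \<open>1 - Yp\<close>, which does not depend on the
  choice of \<open>c\<close>.\<close>

definition HH :: "nat list \<Rightarrow> nat \<Rightarrow> ser" where
  "HH rs c = II rs * (\<Prod>s\<leftarrow>rs. WW s c * yy s)"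

lemma constant_term_nonzero: "constant_term f \<noteq> 0 \<Longrightarrow> f \<noteq> 0"
  by auto

lemma TT_unit: "TT s t dvd 1"
proof (rule pseries_unit)
  show "pseries (TT s t)" unfolding TT_def by (intro pseries_intros)
  show "constant_term (TT s t) \<noteq> 0"
    by (simp add: TT_def constant_term_diff constant_term_add constant_term_mult pseries_intros indet_Q_nonzero)
qed

lemma Q_minus_XX_nonzero: "sQ - sX s * sX t \<noteq> 0"
  by (rule constant_term_nonzero)
     (simp add: constant_term_diff constant_term_mult pseries_intros indet_Q_nonzero)

lemma TT_commute: "TT s t = TT t s"
  by (simp add: TT_def ac_simps)

lemma JJ_antisym: "JJ s t = - JJ t s"
  by (simp add: JJ_def TT_commute[of s t] algebra_simps)

lemma sX_inject: "sX r = sX s \<Longrightarrow> r = s"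
proof (rule ccontr)
  assume "sX r = sX s" "r \<noteq> s"
  then have "constant_term (sX s * iX r) = 1" using sX_iX[of r] by simp
  moreover have "vge s 1 (sX s * iX r)"
    using vge_mult[OF vge_X, of s 0 "iX r"] vfreeD(1)[OF vfree_series(3), of s r] \<open>r \<noteq> s\<close> by simp
  ultimately show False using constant_term_vge by fastforce
qed

lemma to_fract_power: "to_fract (a ^ k) = to_fract a ^ k"
  by (induction k) simp_all

lemma to_fract_prod_list: "to_fract (\<Prod>r\<leftarrow>rs. f r) = (\<Prod>r\<leftarrow>rs. to_fract (f r))"
  by (induction rs) simp_all

lemma to_fract_sum: "to_fract (\<Sum>j\<in>A. f j) = (\<Sum>j\<in>A. to_fract (f j))"
  by (induction A rule: infinite_finite_induct) simp_all

lemma to_fract_prod: "to_fract (\<Prod>j\<in>A. f j) = (\<Prod>j\<in>A. to_fract (f j))"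
  by (induction A rule: infinite_finite_induct) simp_all

lemma to_fract_yy:
  "to_fract (yy r) = - to_fract (sX r) / ((1 + to_fract (sX r)) * to_fract (sq r))"
  by (simp add: yy_def gg_def iq_def iE_def to_fract_inverse_unit sq_unit sE_unit divide_inverse)
     (simp add: sE_def)

lemma II_split:
  assumes j: "j < length R"
  shows "II R = II (del_nth j R) * inverse (1 - yy (R ! j)) *
    ((- 1) ^ (length R - 1 - j) * (\<Prod>s\<leftarrow>del_nth j R. JJ s (R ! j)))"
proof -
  have neg: "(\<Prod>r\<leftarrow>xs. JJ c r) = (- 1) ^ length xs * (\<Prod>r\<leftarrow>xs. JJ r c)" for c xs
  proof (induction xs)
    case (Cons a xs)
    then show ?case by (simp add: JJ_antisym[of c a])
  qed simp
  let ?p = "take j R" and ?c = "R ! j" and ?q = "drop (Suc j) R"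
  have R: "R = ?p @ ?c # ?q" using j by (rule split_at_nth)
  have P: "pairprod JJ R = pairprod JJ (?p @ ?q) * ((\<Prod>r\<leftarrow>?p. JJ r ?c) * (\<Prod>r\<leftarrow>?q. JJ ?c r))"
    by (subst R, rule pairprod_split)
  have D: "(\<Prod>r\<leftarrow>R. inverse (1 - yy r)) = (\<Prod>r\<leftarrow>?p @ ?q. inverse (1 - yy r)) * inverse (1 - yy ?c)"
    by (subst R) (simp add: ac_simps)
  have "length ?q = length R - 1 - j" by simp
  then show ?thesis
    unfolding II_def P D neg del_nth_def by (simp add: ac_simps)
qed

text \<open>The field identity multiplied by \<open>II R\<close>: splitting off the variable
  \<open>R ! j\<close> cancels its pair factors \<open>JJ\<close> and leaves \<open>II\<close> of
  the others, with a sign from the antisymmetry of \<open>JJ\<close>.\<close>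

lemma symmetrizer_identity:
  assumes d: "distinct R"
  shows "(\<Sum>j<length R. (- 1) ^ (length R - 1 - j) * HH (del_nth j R) (R ! j)) = (1 - Yp R) * II R"
proof -
  define A where "A = {..<length R}"
  define x where "x i = to_fract (sX (R ! i))" for i
  define Q where "Q = to_fract sQ"
  define y where "y i = - x i / ((1 + x i) * (Q + (Q - 1) * x i))" for i
  have Rinj: "R ! i \<noteq> R ! j" if "i \<in> A" "j \<in> A" "i \<noteq> j" for i j
    using d that by (auto simp: A_def nth_eq_iff_index_eq)
  have yi: "to_fract (yy (R ! i)) = y i" for i
    by (simp add: to_fract_yy y_def x_def Q_def sq_def)
  have id: "(\<Sum>c\<in>A. (1 - y c) * (\<Prod>s\<in>A - {c}. (Q + (Q - 1) * x s + x c + x s * x c) * y s *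
      (Q * (1 + x s) * (1 + x c) - x s * x c) / ((x c - x s) * (Q - x s * x c)))) = 1 - (\<Prod>s\<in>A. y s)"
    unfolding y_def
  proof (rule symmetrizer_identity_field)
    show "finite A" by (simp add: A_def)
    show "inj_on x A" using Rinj by (auto simp: inj_on_def x_def dest: sX_inject)
    show "x i \<noteq> 0" for i by (simp add: x_def sX_nonzero)
    show "1 + x i \<noteq> 0" for i using sE_nonzero[of "R ! i"] by (simp add: x_def sE_def flip: to_fract_1 to_fract_add)
    show "Q + (Q - 1) * x i \<noteq> 0" for i
      using sq_nonzero[of "R ! i"] by (simp add: x_def Q_def sq_def flip: to_fract_1 to_fract_add to_fract_mult to_fract_diff)
    show "Q - x i * x j \<noteq> 0" for i j
      using Q_minus_XX_nonzero[of "R ! i" "R ! j"] by (simp add: x_def Q_def flip: to_fract_mult)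
    show "Q + Q * x i + x i * x i \<noteq> 0" for i
    proof -
      have "sQ + sQ * sX (R ! i) + sX (R ! i) * sX (R ! i) \<noteq> 0"
        by (rule constant_term_nonzero)
           (simp add: constant_term_add constant_term_mult pseries_intros indet_Q_nonzero)
      then have "to_fract (sQ + sQ * sX (R ! i) + sX (R ! i) * sX (R ! i)) \<noteq> 0"
        by (simp only: to_fract_eq_0_iff not_False_eq_True)
      then show ?thesis by (simp add: x_def Q_def)
    qed
  qed
  have summand: "to_fract ((- 1) ^ (length R - 1 - j) * HH (del_nth j R) (R ! j)) =
      to_fract (II R) * ((1 - y j) * (\<Prod>s\<in>A - {j}. (Q + (Q - 1) * x s + x j + x s * x j) * y s *
      (Q * (1 + x s) * (1 + x j) - x s * x j) / ((x j - x s) * (Q - x s * x j))))" if j: "j \<in> A" for j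
  proof -
    define e :: "ser fract" where "e = (- 1) ^ (length R - 1 - j)"
    have e: "to_fract ((- 1) ^ (length R - 1 - j)) = e" "e * e = 1"
      by (simp_all add: e_def to_fract_power flip: power_mult_distrib)
    have jl: "j < length R" using j by (simp add: A_def)
    define L where "L = to_fract (II (del_nth j R))"
    define a where "a s = (x j - x s) * ((Q - x s * x j) / (Q * (1 + x s) * (1 + x j) - x s * x j))" for s
    define w where "w s = (Q + (Q - 1) * x s + x j + x s * x j) * y s" for s
    have PJ: "to_fract (\<Prod>s\<leftarrow>del_nth j R. JJ s (R ! j)) = (\<Prod>s\<in>A - {j}. a s)"
      unfolding prod_list_take_drop[OF jl] A_def[symmetric] to_fract_prod
      by (intro prod.cong refl)
         (simp add: JJ_def a_def to_fract_inverse_unit TT_unit divide_inverse x_def Q_def, simp add: TT_def)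
    have PW: "to_fract (\<Prod>s\<leftarrow>del_nth j R. WW s (R ! j) * yy s) = (\<Prod>s\<in>A - {j}. w s)"
      unfolding prod_list_take_drop[OF jl] A_def[symmetric] to_fract_prod
      by (intro prod.cong refl) (simp add: w_def WW_def x_def Q_def yi[unfolded x_def])
    have y1: "(1 - y j) * to_fract (inverse (1 - yy (R ! j))) = 1"
    proof -
      have "1 - yy (R ! j) \<noteq> 0" using one_minus_yy_unit(1)[of "R ! j"] by auto
      then have "to_fract (1 - yy (R ! j)) \<noteq> 0" by (simp only: to_fract_eq_0_iff not_False_eq_True)
      then show ?thesis by (simp add: to_fract_inverse_unit one_minus_yy_unit yi)
    qed
    have "to_fract (II R) = L * to_fract (inverse (1 - yy (R ! j))) * (e * (\<Prod>s\<in>A - {j}. a s))"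
      unfolding II_split[OF jl] by (simp only: to_fract_mult e(1) L_def PJ)
    then have "to_fract (II R) * ((1 - y j) * (\<Prod>s\<in>A - {j}. w s / a s)) =
        L * ((1 - y j) * to_fract (inverse (1 - yy (R ! j)))) * e * ((\<Prod>s\<in>A - {j}. a s) * (\<Prod>s\<in>A - {j}. w s / a s))"
      by (simp only: ac_simps)
    also have "(\<Prod>s\<in>A - {j}. a s) * (\<Prod>s\<in>A - {j}. w s / a s) = (\<Prod>s\<in>A - {j}. w s)"
      unfolding prod.distrib[symmetric]
    proof (rule prod.cong[OF refl])
      fix s assume s: "s \<in> A - {j}"
      have "x j - x s \<noteq> 0" using Rinj[of j s] s j sX_inject by (auto simp: x_def)
      moreover have "Q - x s * x j \<noteq> 0"
        using Q_minus_XX_nonzero[of "R ! s" "R ! j"] by (simp add: x_def Q_def flip: to_fract_mult)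
      moreover have "TT (R ! s) (R ! j) \<noteq> 0" using TT_unit[of "R ! s" "R ! j"] by auto
      then have "to_fract (TT (R ! s) (R ! j)) \<noteq> 0" by (simp only: to_fract_eq_0_iff not_False_eq_True)
      then have "Q * (1 + x s) * (1 + x j) - x s * x j \<noteq> 0" by (simp add: TT_def x_def Q_def)
      ultimately have "a s \<noteq> 0" by (simp add: a_def)
      then show "a s * (w s / a s) = w s" by simp
    qed
    finally have main: "to_fract (II R) * ((1 - y j) * (\<Prod>s\<in>A - {j}. w s / a s)) =
        e * (L * (\<Prod>s\<in>A - {j}. w s))"
      by (simp only: y1 mult_1_right mult_1_left ac_simps)
    have wa: "(\<Prod>s\<in>A - {j}. w s / a s) = (\<Prod>s\<in>A - {j}. (Q + (Q - 1) * x s + x j + x s * x j) * y s *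
      (Q * (1 + x s) * (1 + x j) - x s * x j) / ((x j - x s) * (Q - x s * x j)))"
      by (intro prod.cong refl) (simp add: w_def a_def)
    show ?thesis
      unfolding HH_def wa[symmetric] main by (simp only: to_fract_mult e(1) PW L_def)
  qed
  have "to_fract (\<Sum>j<length R. (- 1) ^ (length R - 1 - j) * HH (del_nth j R) (R ! j)) =
      (\<Sum>j\<in>A. to_fract (II R) * ((1 - y j) * (\<Prod>s\<in>A - {j}. (Q + (Q - 1) * x s + x j + x s * x j) * y s *
      (Q * (1 + x s) * (1 + x j) - x s * x j) / ((x j - x s) * (Q - x s * x j)))))"
    unfolding to_fract_sum A_def[symmetric] by (intro sum.cong refl summand)
  also have "\<dots> = to_fract (II R) * (1 - (\<Prod>s\<in>A. y s))"
    unfolding sum_distrib_left[symmetric] id ..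
  also have "(\<Prod>s\<in>A. y s) = to_fract (Yp R)"
  proof -
    have "(\<Prod>r\<leftarrow>R. f r) = (\<Prod>i\<in>A. f (R ! i))" for f :: "nat \<Rightarrow> ser fract"
      unfolding A_def by (induction R) (simp_all add: prod.lessThan_Suc_shift del: prod.lessThan_Suc)
    then show ?thesis by (simp add: Yp_def to_fract_prod_list yi)
  qed
  also have "to_fract (II R) * (1 - to_fract (Yp R)) = to_fract ((1 - Yp R) * II R)" by simp
  finally show ?thesis by (simp only: to_fract_inject)
qed

lemma mfls_perm_yy: "bij \<sigma> \<Longrightarrow> mfls_perm \<sigma> (yy r) = yy (\<sigma> r)"
  by (simp add: yy_def mfls_perm_mult mfls_perm_series)

lemma mfls_perm_JJ: "bij \<sigma> \<Longrightarrow> mfls_perm \<sigma> (JJ s t) = JJ (\<sigma> s) (\<sigma> t)"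
  by (simp add: JJ_def mfls_perm_mult mfls_perm_diff mfls_perm_const mfls_perm_series mfls_perm_inverse TT_unit)
     (simp add: TT_def mfls_perm_mult mfls_perm_diff mfls_perm_const mfls_perm_series mfls_perm_add mfls_perm_1)

lemma mfls_perm_II: "bij \<sigma> \<Longrightarrow> mfls_perm \<sigma> (II rs) = II (map \<sigma> rs)"
  by (simp add: II_def mfls_perm_mult mfls_perm_prod_list_map mfls_perm_inverse one_minus_yy_unit
      mfls_perm_diff mfls_perm_1 mfls_perm_yy mfls_perm_pairprod mfls_perm_JJ pairprod_map o_def)

lemma mfls_perm_HH: "bij \<sigma> \<Longrightarrow> mfls_perm \<sigma> (HH rs c) = HH (map \<sigma> rs) (\<sigma> c)"
  by (simp add: HH_def mfls_perm_mult mfls_perm_II mfls_perm_prod_list_map mfls_perm_series mfls_perm_yy o_def)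

lemma pairprod_symmetric_rotate:
  assumes "\<And>s t. f s t = f t s"
  shows "pairprod f (pre @ mid @ c # post) = pairprod f (pre @ c # mid @ post)"
proof -
  have "(\<Prod>r\<leftarrow>mid. f r c) = (\<Prod>r\<leftarrow>mid. f c r)"
    by (intro arg_cong[of _ _ prod_list] map_cong refl assms)
  then show ?thesis
    using pairprod_split[of f "pre @ mid" c post] pairprod_split[of f pre c "mid @ post"]
    by (simp add: ac_simps)
qed

lemma Phi_rotate: "Phi c (pre @ mid @ z # post) = (- 1) ^ length mid * Phi c (pre @ z # mid @ post)"
proof -
  have "vand (pre @ mid @ z # post) = (- 1) ^ length mid * vand (pre @ z # mid @ post)"
    unfolding vand_def by (rule pairprod_rotate) simp
  moreover have "pairprod YY (pre @ mid @ z # post) = pairprod YY (pre @ z # mid @ post)"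
    by (rule pairprod_symmetric_rotate[OF YY_commute])
  ultimately show ?thesis by (simp add: Phi_def ac_simps)
qed

text \<open>The variables of \<open>post\<close> stay fixed because they have already been removed
  by the induction below and may occur in \<open>Z\<close>.\<close>

definition symmetric_in :: "nat list \<Rightarrow> nat list \<Rightarrow> ser \<Rightarrow> bool" where
  "symmetric_in rs post Z \<longleftrightarrow>
    (\<forall>\<sigma>. bij \<sigma> \<longrightarrow> \<sigma> ` set rs = set rs \<longrightarrow> map \<sigma> post = post \<longrightarrow> mfls_perm \<sigma> Z = Z)"

lemma symmetric_in_mult:
  "symmetric_in rs post Z \<Longrightarrow> symmetric_in rs post Z' \<Longrightarrow> symmetric_in rs post (Z * Z')"
  by (simp add: symmetric_in_def mfls_perm_mult)

lemma prod_list_permuted: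
  fixes f :: "nat \<Rightarrow> 'a::comm_monoid_mult"
  assumes "bij \<sigma>" "\<sigma> ` set rs = set rs" "distinct rs"
  shows "(\<Prod>r\<leftarrow>rs. f (\<sigma> r)) = (\<Prod>r\<leftarrow>rs. f r)"
proof -
  have inj: "inj_on \<sigma> (set rs)" using assms(1) by (meson bij_is_inj inj_on_subset subset_UNIV)
  have "(\<Prod>r\<leftarrow>rs. f r) = (\<Prod>r\<in>\<sigma> ` set rs. f r)"
    unfolding assms(2) by (rule prod.distinct_set_conv_list[OF assms(3), symmetric])
  also have "\<dots> = (\<Prod>r\<in>set rs. f (\<sigma> r))" using prod.reindex[OF inj, of f] by simp
  also have "\<dots> = (\<Prod>r\<leftarrow>rs. f (\<sigma> r))" by (rule prod.distinct_set_conv_list[OF assms(3)])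
  finally show ?thesis by simp
qed

lemma symmetric_in_prod_list:
  assumes "distinct rs"
    and "\<And>\<sigma> r. bij \<sigma> \<Longrightarrow> map \<sigma> post = post \<Longrightarrow> mfls_perm \<sigma> (f r) = f (\<sigma> r)"
  shows "symmetric_in rs post (\<Prod>r\<leftarrow>rs. f r)"
  unfolding symmetric_in_def
proof (intro allI impI)
  fix \<sigma> :: "nat \<Rightarrow> nat" assume \<sigma>: "bij \<sigma>" "\<sigma> ` set rs = set rs" "map \<sigma> post = post"
  have "mfls_perm \<sigma> (\<Prod>r\<leftarrow>rs. f r) = (\<Prod>r\<leftarrow>rs. f (\<sigma> r))"
    using \<sigma> by (simp add: mfls_perm_prod_list_map assms(2))
  then show "mfls_perm \<sigma> (\<Prod>r\<leftarrow>rs. f r) = (\<Prod>r\<leftarrow>rs. f r)"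
    using prod_list_permuted[OF \<sigma>(1,2) assms(1), of f] by simp
qed

lemma symmetric_in_inverse:
  assumes "distinct rs" "rs \<noteq> []"
  shows "symmetric_in rs post (inverse (1 - Yp rs))"
proof -
  have "symmetric_in rs post (Yp rs)"
    unfolding Yp_def by (rule symmetric_in_prod_list[OF assms(1)]) (simp add: mfls_perm_yy)
  then show ?thesis
    using assms(2) by (auto simp: symmetric_in_def mfls_perm_inverse one_minus_Yp_unit mfls_perm_diff mfls_perm_1)
qed

text \<open>Next to the antisymmetric \<open>Phi\<close> only the antisymmetrization of the cofactor
  matters. Instead of a sum over all permutations, the induction chooses the last variable in all
  possible ways.\<close>

lemma constant_term_symmetrize:
  assumes "distinct Rs" "Rs = rs @ post" "symmetric_in rs post Z"
  shows "constant_term (Phi c Rs * (Z * (pairprod WW rs * GG rs))) =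
    1 / fact (length rs) * constant_term (Phi c Rs * (Z * II rs))"
  using assms(2,3)
proof (induction rs arbitrary: post Z rule: rev_induct)
  case Nil
  then show ?case by (simp add: GG_def II_def)
next
  case (snoc r rs)
  define R where "R = rs @ [r]"
  define I where "I = inverse (1 - Yp R)"
  define W where "W = (\<Prod>s\<leftarrow>rs. WW s r * yy s)"
  have RP: "Rs = R @ post" using snoc.prems by (simp add: R_def)
  have dR: "distinct R" "distinct (R @ post)" using assms(1) RP by auto
  have symR: "symmetric_in R post I"
    unfolding I_def by (rule symmetric_in_inverse[OF dR(1)]) (simp add: R_def)
  have lift: "symmetric_in rs (r # post) Z'" if "symmetric_in R post Z'" for Z'
    using that by (auto simp: symmetric_in_def R_def)
  have Wsym: "symmetric_in rs (r # post) W"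
    unfolding W_def
    by (rule symmetric_in_prod_list) (use dR(1) in \<open>auto simp: R_def mfls_perm_mult mfls_perm_series mfls_perm_yy\<close>)
  define C where "C = constant_term (Phi c Rs * (Z * I * HH rs r))"
  have "Z * (pairprod WW (rs @ [r]) * GG (rs @ [r])) = Z * (W * I) * (pairprod WW rs * GG rs)"
    by (simp add: pairprod_snoc GG_snoc W_def I_def R_def Yp_def prod_list_mult_distrib ac_simps)
  then have "constant_term (Phi c Rs * (Z * (pairprod WW (rs @ [r]) * GG (rs @ [r])))) =
      constant_term (Phi c Rs * (Z * (W * I) * (pairprod WW rs * GG rs)))" by (simp only:)
  also have "\<dots> = 1 / fact (length rs) * constant_term (Phi c Rs * (Z * (W * I) * II rs))"
    by (rule snoc.IH[of "r # post"])
       (use snoc.prems symR lift Wsym in \<open>auto simp: R_def[symmetric] intro!: symmetric_in_mult\<close>)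
  also have "Z * (W * I) * II rs = Z * I * HH rs r" by (simp add: HH_def W_def ac_simps)
  finally have e1: "constant_term (Phi c Rs * (Z * (pairprod WW (rs @ [r]) * GG (rs @ [r])))) =
      1 / fact (length rs) * C" by (simp add: C_def)
  \<comment> \<open>Making \<open>R ! j\<close> the last variable is a renaming that fixes
    \<open>Z * I\<close> and changes \<open>Phi\<close> by a sign, so each choice gives the same
    constant term \<open>C\<close>.\<close>
  have Cj: "C = constant_term (Phi c Rs * (Z * I * ((- 1) ^ (length R - 1 - j) * HH (del_nth j R) (R ! j))))"
    if j: "j < length R" for j
  proof -
    let ?R' = "del_nth j R @ [R ! j]"
    have Rj: "R = take j R @ R ! j # drop (Suc j) R" using j by (rule split_at_nth)
    have mset: "mset ?R' = mset R" by (subst (3) Rj) (simp add: del_nth_def)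
    then have set': "set ?R' = set R" by (rule mset_eq_setD)
    have d': "distinct (?R' @ post)"
      using dR(2) mset_eq_imp_distinct_iff[of "?R' @ post" "R @ post"] mset by simp
    have len: "length (R @ post) = length (?R' @ post)"
      using mset_eq_length[OF mset] by simp
    from ex_bij_map[OF dR(2) d' len] obtain \<sigma> where "bij \<sigma> \<and> map \<sigma> (R @ post) = ?R' @ post" ..
    then have \<sigma>: "bij \<sigma>" "map \<sigma> (R @ post) = ?R' @ post" by (rule conjunct1, rule conjunct2)
    have "length (map \<sigma> R) = length ?R'" using mset_eq_length[OF mset] by simp
    moreover have "map \<sigma> R @ map \<sigma> post = ?R' @ post" using \<sigma>(2) by (simp only: map_append)
    ultimately have "map \<sigma> R = ?R' \<and> map \<sigma> post = post"
      using append_eq_append_conv[of "map \<sigma> R" ?R' "map \<sigma> post" post] by blast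
    then have \<sigma>R: "map \<sigma> R = ?R'" "map \<sigma> post = post" by (rule conjunct1, rule conjunct2)
    have \<sigma>r: "map \<sigma> rs = del_nth j R" "\<sigma> r = R ! j" using \<sigma>R(1) by (simp_all add: R_def)
    have im: "\<sigma> ` set R = set R" using \<sigma>R(1) set' by (metis set_map)
    have ZI: "mfls_perm \<sigma> (Z * I) = Z * I"
      using symmetric_in_mult[of R post Z I] snoc.prems(2) symR \<sigma>(1) im \<sigma>R(2)
      by (simp add: symmetric_in_def R_def)
    have "C = constant_term (mfls_perm \<sigma> (Phi c Rs * (Z * I * HH rs r)))"
      unfolding C_def by (simp only: constant_term_perm[OF \<sigma>(1)])
    also have "mfls_perm \<sigma> (Phi c Rs * (Z * I * HH rs r)) =
        Phi c (?R' @ post) * (Z * I * HH (del_nth j R) (R ! j))"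
      unfolding mfls_perm_mult[OF \<sigma>(1), of "Phi c (R @ post)"] mfls_perm_mult[OF \<sigma>(1), of "Z * I"] ZI
        mfls_perm_Phi[OF \<sigma>(1)] mfls_perm_HH[OF \<sigma>(1)] RP \<sigma>(2) \<sigma>r ..
    also have "Phi c (?R' @ post) = (- 1) ^ (length R - 1 - j) * Phi c Rs"
    proof -
      have "Phi c (take j R @ drop (Suc j) R @ R ! j # post) =
          (- 1) ^ length (drop (Suc j) R) * Phi c (take j R @ R ! j # drop (Suc j) R @ post)"
        by (rule Phi_rotate)
      moreover have "take j R @ R ! j # drop (Suc j) R @ post = Rs"
        unfolding RP by (subst (4) Rj) simp
      ultimately show ?thesis by (simp add: del_nth_def)
    qed
    finally show ?thesis by (simp only: ac_simps)
  qed
  \<comment> \<open>Adding up the equal choices makes \<open>symmetrizer_identity\<close>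
    applicable; its factor \<open>1 - Yp R\<close> cancels \<open>I\<close>, and the number of
    choices extends the factorial.\<close>
  have "of_nat (length R) * C = (\<Sum>j<length R. C)" by simp
  also have "\<dots> = (\<Sum>j<length R. constant_term (Phi c Rs * (Z * I * ((- 1) ^ (length R - 1 - j) * HH (del_nth j R) (R ! j)))))"
    by (rule sum.cong[OF refl], rule Cj) simp
  also have "\<dots> = constant_term (Phi c Rs * (Z * I * ((1 - Yp R) * II R)))"
    unfolding symmetrizer_identity[OF dR(1), symmetric] by (simp only: sum_distrib_left constant_term_sum)
  also have "Z * I * ((1 - Yp R) * II R) = Z * II R"
  proof -
    have "(1 - Yp R) * I = 1" unfolding I_def
      by (rule mfls_inverse_right, rule one_minus_Yp_unit) (simp add: R_def)
    then have "Z * II R = Z * ((1 - Yp R) * I) * II R" by simp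
    then show ?thesis by (simp only: ac_simps)
  qed
  finally have e2: "of_nat (Suc (length rs)) * C = constant_term (Phi c Rs * (Z * II R))"
    by (simp add: R_def)
  have "(of_nat (Suc (length rs)) :: ratfun) \<noteq> 0" by (rule of_nat_neq_0)
  then have "1 / fact (length rs) * C = 1 / fact (Suc (length rs)) * (of_nat (Suc (length rs)) * C)"
    by (simp only: fact_Suc) (simp del: of_nat_Suc)
  then show ?case unfolding e1 e2 by (simp add: R_def)
qed

lemma constant_term_GG:
  assumes d: "distinct Rs" and n: "n = 2 * length Rs" and m: "n \<le> m"
  shows "(\<Sum>ks\<in>pos_lists n (length Rs). FF m n ks) =
    1 / fact (length Rs) * constant_term (Phi (Suc m) Rs * ((\<Prod>r\<leftarrow>Rs. sE r ^ n * hh r) * II Rs))"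
proof -
  define Z where "Z = (\<Prod>r\<leftarrow>Rs. sE r ^ n * hh r)"
  have "FF m n ks = constant_term (Phi (Suc m) Rs * (Z * pairprod WW Rs) * (1 * dwave n Rs ks))"
    if ks: "ks \<in> pos_lists n (length Rs)" for ks
  proof -
    have le: "k \<le> n" if "k \<in> set ks" for k using ks that by (auto simp: pos_lists_def)
    have "FF m n ks = constant_term ((if even n then Psi (Suc m) Rs else PsiA (Suc m) Rs) * wave n Rs ks)"
      by (rule FF_eq_constant_term) (use ks n m d le in \<open>auto simp: pos_lists_def intro: order_trans\<close>)
    also have "(if even n then Psi (Suc m) Rs else PsiA (Suc m) Rs) * wave n Rs ks =
        Phi (Suc m) Rs * (Z * pairprod WW Rs) * (1 * dwave n Rs ks)"
      using n ks le by (subst wave_eq_dwave) (auto simp: pos_lists_def Psi_def Z_def ac_simps)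
    finally show ?thesis .
  qed
  then have "(\<Sum>ks\<in>pos_lists n (length Rs). FF m n ks) =
      constant_term (Phi (Suc m) Rs * (Z * pairprod WW Rs) * (1 * (\<Sum>ks\<in>pos_lists n (length Rs). dwave n Rs ks)))"
    by (simp only: sum_distrib_left constant_term_sum) (rule sum.cong[OF refl])
  also have "\<dots> = constant_term (Phi (Suc m) Rs * (Z * pairprod WW Rs) * (1 * (Yp Rs ^ (n - n) * GG Rs)))"
  proof (rule constant_term_sum_pos_lists[OF d n, of _ "[]"])
    have "pseries Z" unfolding Z_def
      by (rule pseries_prod_list) (auto intro!: pseries_mult pseries_power pseries_basic pseries_series)
    then show "pseries (Z * pairprod WW Rs)" by (intro pseries_mult pseries_pairprod pseries_series)
  qed (simp_all add: pseries_1)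
  also have "Phi (Suc m) Rs * (Z * pairprod WW Rs) * (1 * (Yp Rs ^ (n - n) * GG Rs)) =
      Phi (Suc m) Rs * (Z * (pairprod WW Rs * GG Rs))"
    by (simp add: ac_simps)
  also have "constant_term \<dots> = 1 / fact (length Rs) * constant_term (Phi (Suc m) Rs * (Z * II Rs))"
  proof (rule constant_term_symmetrize[OF d, of _ "[]"])
    show "symmetric_in Rs [] Z" unfolding Z_def
      by (rule symmetric_in_prod_list[OF d]) (simp add: mfls_perm_mult mfls_perm_power mfls_perm_series)
  qed simp
  finally show ?thesis by (simp add: Z_def)
qed

section \<open>Identification with the stated product formula\<close>

lemma prod_list_upt: "(\<Prod>r\<leftarrow>[1..<Suc N]. f r) = (\<Prod>r = 1..N. f r :: 'a::comm_monoid_mult)"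
  by (simp add: prod.distinct_set_conv_list[symmetric] atLeastLessThanSuc_atLeastAtMost del: upt_Suc)

lemma pairprod_upt:
  "pairprod f [1..<Suc N] = (\<Prod>(s, t) | 1 \<le> s \<and> s < t \<and> t \<le> N. f s t)"
proof (induction N)
  case 0
  have e: "{(s, t). 1 \<le> s \<and> s < t \<and> t \<le> (0 :: nat)} = {}" by auto
  show ?case unfolding e by simp
next
  case (Suc N)
  let ?A = "{(s, t). 1 \<le> s \<and> s < t \<and> t \<le> N}" and ?B = "(\<lambda>s. (s, Suc N)) ` {1..N}"
  have "{(s, t). 1 \<le> s \<and> s < t \<and> t \<le> Suc N} = ?A \<union> ?B" by auto
  moreover have "finite ?A" by (rule finite_subset[of _ "{..N} \<times> {..N}"]) auto
  ultimately have "(\<Prod>(s, t) | 1 \<le> s \<and> s < t \<and> t \<le> Suc N. f s t) =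
      (\<Prod>(s, t)\<in>?A. f s t) * (\<Prod>(s, t)\<in>?B. f s t)"
    by (simp only:) (rule prod.union_disjoint, auto)
  also have "(\<Prod>(s, t)\<in>?B. f s t) = (\<Prod>s\<leftarrow>[1..<Suc N]. f s (Suc N))"
    unfolding prod_list_upt by (subst prod.reindex) (auto simp: inj_on_def)
  finally show ?case
    using Suc pairprod_snoc[of f "[1..<Suc N]" "Suc N"] by simp
qed

lemma mfls_unit_mult:
  fixes f g :: "('v, 'a::comm_ring_1) mfls"
  shows "f dvd 1 \<Longrightarrow> g dvd 1 \<Longrightarrow> f * g dvd 1"
  using mult_dvd_mono[of f 1 g 1] by simp

lemma mfls_unit_power:
  fixes f :: "('v, 'a::comm_ring_1) mfls"
  shows "f dvd 1 \<Longrightarrow> f ^ k dvd 1"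
  by (induction k) (simp_all add: mfls_unit_mult)

lemma Delta_unit: "sQ * (1 + sX r)\<^sup>2 - (sX r)\<^sup>2 dvd 1"
proof (rule pseries_unit)
  show "pseries (sQ * (1 + sX r)\<^sup>2 - (sX r)\<^sup>2)" by (intro pseries_intros)
  show "constant_term (sQ * (1 + sX r)\<^sup>2 - (sX r)\<^sup>2) \<noteq> 0"
    by (simp add: power2_eq_square constant_term_diff constant_term_add constant_term_mult pseries_intros indet_Q_nonzero)
qed

text \<open>The balance of the powers of \<open>1 + x\<close>: \<open>n\<close> from the waves and 1
  from \<open>1 / (1 - yy)\<close> stand against \<open>c\<close> from the kernel and
  \<open>k\<close> from the Vandermonde product. The denominators \<open>sq\<close> of
  \<open>hh\<close> and of \<open>1 - yy\<close> cancel.\<close>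

lemma single_factor:
  assumes e: "n + 1 + e = c + k"
  shows "iE r ^ c * iX r ^ j * (sE r ^ n * hh r) * inverse (1 - yy r) * iE r ^ k =
    (sQ + (sQ - sP) * sX r) / (sX r ^ j * (1 + sX r) ^ e * (sQ * (1 + sX r)\<^sup>2 - (sX r)\<^sup>2))"
proof -
  define x where "x = to_fract (sX r)"
  define Q where "Q = to_fract sQ"
  define P where "P = to_fract sP"
  define q where "q = Q + (Q - 1) * x"
  have x: "x \<noteq> 0" by (simp add: x_def sX_nonzero)
  have E: "1 + x \<noteq> 0"
    using sE_nonzero[of r] by (simp add: x_def sE_def flip: to_fract_1 to_fract_add)
  have qq: "to_fract (sq r) = q" by (simp add: sq_def q_def Q_def x_def)
  have q: "q \<noteq> 0" using sq_nonzero[of r] by (simp flip: qq)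
  have D: "Q * (1 + x)\<^sup>2 - x\<^sup>2 \<noteq> 0"
  proof -
    have "sQ * (1 + sX r)\<^sup>2 - (sX r)\<^sup>2 \<noteq> 0" using Delta_unit[of r] by auto
    then have "to_fract (sQ * (1 + sX r)\<^sup>2 - (sX r)\<^sup>2) \<noteq> 0"
      by (simp only: to_fract_eq_0_iff not_False_eq_True)
    then show ?thesis by (simp add: Q_def x_def to_fract_power)
  qed
  have h: "to_fract (hh r) = (Q + (Q - P) * x) / q"
  proof -
    have "to_fract (hh r) = 1 + (P - 1) * (- x / q)"
      by (simp add: hh_def gg_def iq_def to_fract_inverse_unit sq_unit qq P_def x_def divide_inverse)
    then show ?thesis using q by (simp add: field_simps) (simp add: q_def algebra_simps)
  qed
  have y: "1 - to_fract (yy r) = (Q * (1 + x)\<^sup>2 - x\<^sup>2) / ((1 + x) * q)"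
  proof -
    have "Q * (1 + x)\<^sup>2 - x\<^sup>2 = (1 + x) * q + x"
      by (simp add: q_def algebra_simps power2_eq_square)
    moreover have "(1 + x) * q \<noteq> 0" using E q by simp
    ultimately show ?thesis
      unfolding to_fract_yy qq x_def[symmetric] by (simp only: add_divide_distrib divide_self) simp
  qed
  have "to_fract (iE r ^ c * iX r ^ j * (sE r ^ n * hh r) * inverse (1 - yy r) * iE r ^ k) =
      inverse (1 + x) ^ c * inverse x ^ j * ((1 + x) ^ n * ((Q + (Q - P) * x) / q)) *
      inverse ((Q * (1 + x)\<^sup>2 - x\<^sup>2) / ((1 + x) * q)) * inverse (1 + x) ^ k"
    by (simp add: to_fract_power iE_def iX_def to_fract_inverse_unit sE_unit mfls_X_unit one_minus_yy_unit y h)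
       (simp add: sE_def x_def)
  also have "\<dots> = ((1 + x) ^ (n + 1) * inverse (1 + x) ^ (c + k)) * inverse x ^ j *
      ((Q + (Q - P) * x) / (Q * (1 + x)\<^sup>2 - x\<^sup>2))"
    using q by (simp add: power_add divide_inverse ac_simps)
  also have "(1 + x) ^ (n + 1) * inverse (1 + x) ^ (c + k) = inverse (1 + x) ^ e"
  proof -
    have "(1 + x) ^ (n + 1) * inverse (1 + x) ^ (n + 1) = 1"
      using E by (simp add: power_mult_distrib[symmetric] del: power_Suc)
    then show ?thesis unfolding e[symmetric] power_add[of _ "n + 1" e] by (simp only: mult.assoc[symmetric] mult_1_left)
  qed
  also have "inverse (1 + x) ^ e * inverse x ^ j * ((Q + (Q - P) * x) / (Q * (1 + x)\<^sup>2 - x\<^sup>2)) =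
      to_fract ((sQ + (sQ - sP) * sX r) / (sX r ^ j * (1 + sX r) ^ e * (sQ * (1 + sX r)\<^sup>2 - (sX r)\<^sup>2)))"
  proof -
    have "sX r ^ j * (1 + sX r) ^ e * (sQ * (1 + sX r)\<^sup>2 - (sX r)\<^sup>2) dvd 1"
      using sE_unit[of r] by (intro mfls_unit_mult mfls_unit_power mfls_X_unit Delta_unit) (simp add: sE_def)
    then show ?thesis
      by (simp add: divide_mfls_def to_fract_inverse_unit to_fract_power x_def Q_def P_def divide_inverse
          power_inverse ac_simps)
  qed
  finally show ?thesis by (simp only: to_fract_inject)
qed

lemma uu_diff: "uu t - uu s = (sX t - sX s) * (sX s + sX t + sX s * sX t) * (iE s * iE t)"
proof -
  have "uu t - uu s = sX t ^ 2 * iE t * (sE s * iE s) - sX s ^ 2 * iE s * (sE t * iE t)"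
    by (simp add: uu_def sE_iE)
  also have "\<dots> = (sX t ^ 2 * sE s - sX s ^ 2 * sE t) * (iE s * iE t)"
    by (simp add: algebra_simps)
  also have "sX t ^ 2 * sE s - sX s ^ 2 * sE t = (sX t - sX s) * (sX s + sX t + sX s * sX t)"
    by (simp add: sE_def algebra_simps power2_eq_square)
  finally show ?thesis .
qed

lemma kernel_eq_vs_series:
  assumes n: "n = 2 * N" "N \<ge> 1" and l: "l \<ge> 3" "odd l" and m: "m = n - 1 + (l - 1) div 2"
  defines "Rs \<equiv> [1..<Suc N]"
  shows "mfls_const (1 / fact N) * (Phi (Suc m) Rs * ((\<Prod>r\<leftarrow>Rs. sE r ^ n * hh r) * II Rs)) = vs_series n l N"
proof -
  define f where "f s t = (sX t - sX s) * (sX s + sX t + sX s * sX t)" for s t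
  define e where "e = (n + l - 5) div 2"
  have len: "length Rs = N" by (simp add: Rs_def)
  \<comment> \<open>Each variable lies in \<open>N - 1\<close> pairs, which is the exponent
    \<open>k\<close> in \<open>single_factor\<close>. The difference \<open>sX t - sX s\<close> in
    \<open>f\<close> and the one in \<open>JJ\<close> form the square in the series.\<close>
  have V: "vand Rs = pairprod f Rs * (\<Prod>r\<leftarrow>Rs. iE r) ^ (N - 1)"
  proof -
    have "vand Rs = pairprod (\<lambda>s t. f s t * (iE s * iE t)) Rs"
      unfolding vand_def uu_diff f_def ..
    also have "\<dots> = pairprod f Rs * pairprod (\<lambda>s t. iE s * iE t) Rs" by (rule pairprod_mult)
    finally show ?thesis by (simp only: pairprod_pow len)
  qed
  have pw: "(\<Prod>r\<leftarrow>Rs. iE r) ^ (N - 1) = (\<Prod>r\<leftarrow>Rs. iE r ^ (N - 1))"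
    by (induction Rs) (simp_all add: power_mult_distrib)
  have pairs: "pairprod f Rs * pairprod YY Rs * pairprod JJ Rs = (\<Prod>(s, t) | 1 \<le> s \<and> s < t \<and> t \<le> N.
         ((sX t - sX s)\<^sup>2 * (sX s + sX t + sX s * sX t) *
          (sQ + (sQ - 1) * sX s + (sQ - 1) * sX t + (sQ - 2) * sX s * sX t) *
          (sQ - sX s * sX t)) / (sQ * (1 + sX s) * (1 + sX t) - sX s * sX t))"
    unfolding Rs_def pairprod_upt prod.distrib[symmetric]
    by (intro prod.cong refl)
       (auto simp: f_def YY_def JJ_def divide_mfls_def TT_def power2_eq_square ac_simps)
  have "n + 1 + e = Suc m + (N - 1)"
  proof -
    obtain k where k: "l = 2 * k + 1" using l(2) by (auto elim: oddE)
    show ?thesis using l(1) n unfolding e_def m k by simp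
  qed
  then have singles: "(\<Prod>r\<leftarrow>Rs. iE r ^ Suc m * iX r ^ (n - 2)) * (\<Prod>r\<leftarrow>Rs. sE r ^ n * hh r) *
      (\<Prod>r\<leftarrow>Rs. inverse (1 - yy r)) * (\<Prod>r\<leftarrow>Rs. iE r ^ (N - 1)) =
      (\<Prod>r = 1..N. (sQ + (sQ - sP) * sX r) /
         (sX r ^ (n - 2) * (1 + sX r) ^ e * (sQ * (1 + sX r)\<^sup>2 - (sX r)\<^sup>2)))"
    unfolding prod_list_mult_distrib[symmetric] by (simp only: single_factor Rs_def prod_list_upt)
  have "Phi (Suc m) Rs * ((\<Prod>r\<leftarrow>Rs. sE r ^ n * hh r) * II Rs) =
      ((\<Prod>r\<leftarrow>Rs. iE r ^ Suc m * iX r ^ (n - 2)) * (\<Prod>r\<leftarrow>Rs. sE r ^ n * hh r) *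
      (\<Prod>r\<leftarrow>Rs. inverse (1 - yy r)) * (\<Prod>r\<leftarrow>Rs. iE r ^ (N - 1))) *
      (pairprod f Rs * pairprod YY Rs * pairprod JJ Rs)"
    unfolding Phi_def II_def V pw len n(1)[symmetric] by (simp only: ac_simps)
  then show ?thesis
    unfolding singles pairs vs_series_def Let_def e_def by (simp only: mult.assoc)
qed

theorem sum_FF_eq_constant_term:
  assumes "n = 2 * N" "N \<ge> 1" "l \<ge> 3" "odd l" "m = n - 1 + (l - 1) div 2"
  shows "(\<Sum>ks\<in>pos_lists n N. FF m n ks) = constant_term (vs_series n l N)"
proof -
  have "n \<le> m" using assms by auto
  then have "(\<Sum>ks\<in>pos_lists n (length [1..<Suc N]). FF m n ks) = 1 / fact (length [1..<Suc N]) *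
      constant_term (Phi (Suc m) [1..<Suc N] * ((\<Prod>r\<leftarrow>[1..<Suc N]. sE r ^ n * hh r) * II [1..<Suc N]))"
    using assms by (intro constant_term_GG) simp_all
  then show ?thesis
    unfolding kernel_eq_vs_series[OF assms, symmetric] constant_term_const_times by (simp del: upt_Suc)
qed

section \<open>Interlacing sets\<close>

fun count_le :: "nat list \<Rightarrow> nat \<Rightarrow> nat" where
  "count_le [] j = 0"
| "count_le (l # ls) j = (if l \<le> j then 1 else 0) + count_le ls j"

lemma count_le_eq_0: "(\<And>x. x \<in> set ls \<Longrightarrow> j < x) \<Longrightarrow> count_le ls j = 0"
  by (induction ls) force+

lemma count_le_card: "distinct ls \<Longrightarrow> count_le ls j = card (set ls \<inter> {..j})"
  by (induction ls) auto

text \<open>Interlacing in terms of counting functions, because their difference is the partial sum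
  of a row of the trapezoid.\<close>

definition stepl :: "bool \<Rightarrow> nat \<Rightarrow> nat \<Rightarrow> nat list \<Rightarrow> nat list \<Rightarrow> bool" where
  "stepl ev m i ls ks \<longleftrightarrow> (\<forall>l\<in>set ls. l \<le> m) \<and> (\<forall>j<i. j \<in> set ls \<longleftrightarrow> j \<in> set ks) \<and>
    (\<forall>j. count_le ls j \<le> count_le ks j \<and> count_le ks j \<le> count_le ls j + 1) \<and> length ks = length ls + (if ev then 1 else 0)"

lemma preds_imp_stepl:
  "ls \<in> preds ev m i ks \<Longrightarrow> sorted_wrt (<) ks \<Longrightarrow> (\<And>k. k \<in> set ks \<Longrightarrow> k \<le> m) \<Longrightarrow> stepl ev m i ls ks"
proof (induction ev m i ks arbitrary: ls rule: preds.induct)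
  case (1 ev m i)
  then show ?case by (auto simp: stepl_def split: if_splits)
next
  case (2 ev m i k)
  then show ?case by (auto simp: stepl_def split: if_splits)
next
  case (3 ev m i k k' ks)
  show ?case
  proof (cases "k < i")
    case True
    then obtain ls' where ls: "ls = k # ls'" "ls' \<in> preds ev m i (k' # ks)" using 3 by auto
    have "stepl ev m i ls' (k' # ks)" using 3 True ls by auto
    then show ?thesis using 3(5)[of k] by (auto simp: stepl_def ls)
  next
    case False
    then obtain l ls' where ls: "ls = l # ls'" "l \<in> {k..k'}" "ls' \<in> preds ev m i (k' # ks)"
      using 3 by auto
    have s: "stepl ev m i ls' (k' # ks)" using 3 False ls by auto
    have z: "count_le (k' # ks) j = 0" if "j < k'" for j
      by (rule count_le_eq_0) (use that 3(4) in force)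
    have sj: "count_le ls' j \<le> count_le (k' # ks) j" "count_le (k' # ks) j \<le> count_le ls' j + 1" for j
      using s by (simp_all add: stepl_def del: count_le.simps)
    have "count_le (l # ls') j \<le> count_le (k # k' # ks) j \<and> count_le (k # k' # ks) j \<le> count_le (l # ls') j + 1" for j
      unfolding count_le.simps(2)[of l] count_le.simps(2)[of k "k' # ks"]
      using ls(2) 3(4) z[of j] sj[of j] by (auto simp del: count_le.simps)
    moreover have "l \<le> m" using ls(2) 3(5)[of k'] by simp
    moreover have "j \<notin> set (l # ls')" "j \<notin> set (k # k' # ks)" if "j < i" for j
      using preds_ge[OF 3(3,4), of j] that False ls(1) 3(4) by force+
    ultimately show ?thesis using s ls by (simp add: stepl_def)
  qed
qed

lemma stepl_imp_preds:
  "stepl ev m i ls ks \<Longrightarrow> sorted_wrt (<) ls \<Longrightarrow> sorted_wrt (<) ks \<Longrightarrow> ls \<in> preds ev m i ks"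
proof (induction ks arbitrary: ls)
  case Nil
  then show ?case by (auto simp: stepl_def)
next
  case (Cons k ks)
  have cnt: "count_le ls j \<le> count_le (k # ks) j" "count_le (k # ks) j \<le> count_le ls j + 1" for j
    using Cons.prems(1) by (auto simp: stepl_def)
  have low: "k \<le> x" if "x \<in> set ls" for x
  proof (rule ccontr)
    assume "\<not> k \<le> x"
    then have "count_le (k # ks) x = 0" using Cons.prems(3) by (intro count_le_eq_0) force
    then have "count_le ls x = 0" using cnt(1)[of x] by simp
    moreover have "count_le ls x > 0" using that by (induction ls) auto
    ultimately show False by simp
  qed
  show ?case
  proof (cases "k < i")
    case True
    then have "k \<in> set ls" using Cons.prems(1) by (auto simp: stepl_def)
    then obtain ls' where ls: "ls = k # ls'"
      using low Cons.prems(2) by (cases ls) force+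
    have nk: "k \<notin> set ls'" "k \<notin> set ks" using Cons.prems ls by auto
    have "stepl ev m i ls' ks"
      using Cons.prems(1) nk unfolding stepl_def ls by auto
    then have "ls' \<in> preds ev m i ks" using Cons.IH[of ls'] Cons.prems ls by simp
    then show ?thesis using True ls by (cases ks) auto
  next
    case False
    show ?thesis
    proof (cases ks)
      case Nil
      then show ?thesis
        using Cons.prems(1) low False by (cases ls) (auto simp: stepl_def)
    next
      case (Cons k' ks')
      note ks = this
      have kk: "k < k'" using Cons.prems(3) ks by simp
      \<comment> \<open>Two positions of the new list up to \<open>k'\<close> force one of the old
        list there, so the head of \<open>ls\<close> cannot lie beyond \<open>k'\<close>.\<close>
      have "count_le (k # ks) k' \<ge> 2" using kk ks by simp
      then have "count_le ls k' \<ge> 1" using cnt(2)[of k'] by simp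
      then obtain l ls' where ls: "ls = l # ls'" by (cases ls) auto
      have srt: "l < x" if "x \<in> set ls'" for x using Cons.prems(2) ls that by auto
      have "l \<le> k'"
      proof (rule ccontr)
        assume "\<not> l \<le> k'"
        then have "count_le ls k' = 0" using srt ls by (intro count_le_eq_0) force
        with \<open>count_le ls k' \<ge> 1\<close> show False by simp
      qed
      have lk: "l \<in> {k..k'}" using \<open>l \<le> k'\<close> low ls by simp
      have zero: "count_le ks j = 0" if "j < k'" for j
        by (rule count_le_eq_0) (use that Cons.prems(3) ks in force)
      have zero': "count_le ls' j = 0" if "j < l" for j
        by (rule count_le_eq_0) (use that srt in force)
      have "stepl ev m i ls' ks"
        unfolding stepl_def
      proof (intro conjI allI impI)
        fix j
        have c: "count_le ls j = (if l \<le> j then 1 else 0) + count_le ls' j"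
          "count_le (k # ks) j = (if k \<le> j then 1 else 0) + count_le ks j" by (simp_all add: ls)
        show "count_le ls' j \<le> count_le ks j"
          using cnt(1)[of j] c zero' lk by (cases "l \<le> j") auto
        show "count_le ks j \<le> count_le ls' j + 1"
        proof (cases "l \<le> j")
          case True
          then show ?thesis using cnt(2)[of j] c lk by auto
        next
          case False
          then have "j < k'" using lk by simp
          then show ?thesis using zero by simp
        qed
      next
        fix j assume j: "j < i"
        have "j \<notin> set ls'" using low[of j] ls j False by auto
        moreover have "j \<notin> set ks" using Cons.prems(3) j False by force
        ultimately show "j \<in> set ls' \<longleftrightarrow> j \<in> set ks" by simp
      qed (use Cons.prems(1) ls in \<open>auto simp: stepl_def\<close>)
      then have "ls' \<in> preds ev m i ks" using Cons.IH[of ls'] Cons.prems ls by simp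
      moreover have "ls' = [] \<or> l < hd ls'" using srt by (cases ls') auto
      ultimately show ?thesis using False ks lk ls by auto
    qed
  qed
qed

text \<open>Row \<open>i\<close> on the left half: ended columns do not change, the partial row sums
  are 0 or 1, and the sum of the half is dictated by the central entry, which alternates with the
  parity of \<open>i\<close>.\<close>

definition step :: "nat \<Rightarrow> nat \<Rightarrow> nat set \<Rightarrow> nat set \<Rightarrow> bool" where
  "step m i L K \<longleftrightarrow> L \<subseteq> {1..m} \<and> K \<subseteq> {1..m} \<and> (\<forall>j<i. j \<in> L \<longleftrightarrow> j \<in> K) \<and>
    (\<forall>j. card (L \<inter> {..j}) \<le> card (K \<inter> {..j}) \<and> card (K \<inter> {..j}) \<le> card (L \<inter> {..j}) + 1) \<and>
    card K = card L + (if even i then 1 else 0)"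

definition set_weight :: "nat \<Rightarrow> nat set \<Rightarrow> nat set \<Rightarrow> ratfun" where
  "set_weight i L K = indet_Q ^ card (L - K) * (if i \<in> L \<and> i \<in> K then indet_P else 1)"

lemma FF_Suc_sets:
  assumes K: "K \<subseteq> {1..m}"
  shows "FF m (Suc i) (sorted_list_of_set K) =
    (\<Sum>L | step m (Suc i) L K. set_weight (Suc i) L K * FF m i (sorted_list_of_set L))"
proof -
  let ?ks = "sorted_list_of_set K" and ?ev = "even (Suc i)"
  have fin: "finite L" if "L \<subseteq> {1..m}" for L using that finite_subset by blast
  have ks: "sorted_wrt (<) ?ks" "set ?ks = K" using fin[OF K] by (simp_all add: strict_sorted_list_of_set)
  have S: "stepl ?ev m (Suc i) (sorted_list_of_set L) ?ks" if "step m (Suc i) L K" for L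
  proof -
    have L: "L \<subseteq> {1..m}" using that by (simp add: step_def)
    show ?thesis
      using that fin[OF L] fin[OF K] unfolding stepl_def step_def
      by (simp add: count_le_card) force
  qed
  show ?thesis
    unfolding FF.simps
  proof (rule sum.reindex_bij_witness[of _ sorted_list_of_set set])
    fix ls assume ls: "ls \<in> preds ?ev m (Suc i) ?ks"
    have srt: "sorted_wrt (<) ls" by (rule preds_sorted[OF ls ks(1)])
    then have d: "distinct ls" "sorted ls" by (simp_all add: strict_sorted_iff)
    show "sorted_list_of_set (set ls) = ls" using d by (simp add: sorted_list_of_set.idem_if_sorted_distinct)
    have st: "stepl ?ev m (Suc i) ls ?ks"
      by (rule preds_imp_stepl[OF ls ks(1)]) (use K ks in auto)
    have ge: "1 \<le> x" if "x \<in> set ls" for x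
    proof (cases ?ks)
      case Nil
      then show ?thesis using ls that by (auto split: if_splits)
    next
      case (Cons k ks')
      then have "k \<le> x" using preds_ge[of ls ?ev m "Suc i" k ks' x] ls ks that by simp
      moreover have "k \<in> K" using ks(2) Cons by (metis list.set_intros(1))
      ultimately show ?thesis using K by auto
    qed
    show "set ls \<in> {L. step m (Suc i) L K}"
      using st ge K fin[OF K] d(1) unfolding stepl_def step_def
      by (auto simp: count_le_card distinct_card)
    show "set_weight (Suc i) (set ls) K * FF m i (sorted_list_of_set (set ls)) =
        step_weight (Suc i) ls ?ks * FF m i ls"
      using ks d by (simp add: set_weight_def step_weight_def sorted_list_of_set.idem_if_sorted_distinct)
  next
    fix L assume L: "L \<in> {L. step m (Suc i) L K}"
    then have "finite L" using fin by (auto simp: step_def)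
    then show "set (sorted_list_of_set L) = L" by simp
    show "sorted_list_of_set L \<in> preds ?ev m (Suc i) ?ks"
      by (rule stepl_imp_preds) (use L S ks in \<open>auto simp: strict_sorted_list_of_set\<close>)
  qed
qed

section \<open>Chains of column sets\<close>

definition step_chains :: "nat \<Rightarrow> nat \<Rightarrow> nat set \<Rightarrow> (nat \<Rightarrow> nat set) set" where
  "step_chains m i K = {S. S 0 = {} \<and> (\<forall>r\<in>{1..i}. step m r (S (r - 1)) (S r)) \<and> S i = K \<and> (\<forall>r>i. S r = {})}"

lemma step_chains_Suc:
  "step_chains m (Suc i) K = (\<Union>L\<in>{L. step m (Suc i) L K}. (\<lambda>S. S(Suc i := K)) ` step_chains m i L)"
proof (intro set_eqI iffI)
  fix S assume S: "S \<in> step_chains m (Suc i) K"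
  have "S(Suc i := {}) \<in> step_chains m i (S i)"
    using S by (auto simp: step_chains_def)
  moreover have "step m (Suc i) (S i) K" using S unfolding step_chains_def by force
  moreover have "S = (S(Suc i := {}))(Suc i := K)" using S by (auto simp: step_chains_def)
  ultimately show "S \<in> (\<Union>L\<in>{L. step m (Suc i) L K}. (\<lambda>S. S(Suc i := K)) ` step_chains m i L)"
    by blast
next
  fix S assume "S \<in> (\<Union>L\<in>{L. step m (Suc i) L K}. (\<lambda>S. S(Suc i := K)) ` step_chains m i L)"
  then show "S \<in> step_chains m (Suc i) K"
    by (auto simp: step_chains_def le_Suc_eq)
qed

lemma finite_steps: "finite {L. step m i L K}"
  by (rule finite_subset[of _ "Pow {1..m}"]) (auto simp: step_def)

lemma finite_step_chains: "finite (step_chains m i K)"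
proof (induction i arbitrary: K)
  case 0
  have "step_chains m 0 K \<subseteq> {\<lambda>_. {}}" by (auto simp: step_chains_def fun_eq_iff) (metis gr0I empty_iff)
  then show ?case using finite_subset by blast
next
  case (Suc i)
  then show ?case unfolding step_chains_Suc using finite_steps by auto
qed

lemma FF_eq_sum_chains:
  "K \<subseteq> {1..m} \<Longrightarrow> FF m i (sorted_list_of_set K) =
    (\<Sum>S\<in>step_chains m i K. \<Prod>r\<in>{1..i}. set_weight r (S (r - 1)) (S r))"
proof (induction i arbitrary: K)
  case 0
  have "finite K" using 0 finite_subset by blast
  moreover have "step_chains m 0 K = (if K = {} then {\<lambda>_. {}} else {})"
    by (auto simp: step_chains_def fun_eq_iff) (metis gr0I empty_iff)
  ultimately show ?case by simp
next
  case (Suc i)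
  have inj: "inj_on (\<lambda>S. S(Suc i := K)) (step_chains m i L)" for L
  proof (rule inj_onI)
    fix S T assume ST: "S \<in> step_chains m i L" "T \<in> step_chains m i L" "S(Suc i := K) = T(Suc i := K)"
    show "S = T"
    proof
      fix r show "S r = T r"
      proof (cases "r = Suc i")
        case True
        then show ?thesis using ST(1,2) by (simp add: step_chains_def)
      next
        case False
        then show ?thesis using fun_cong[OF ST(3), of r] by simp
      qed
    qed
  qed
  have disj: "L = L'" if "S \<in> step_chains m i L" "T \<in> step_chains m i L'" "S(Suc i := K) = T(Suc i := K)" for L L' S T
  proof -
    have "S i = T i" using fun_cong[OF that(3), of i] by simp
    then show ?thesis using that(1,2) by (simp add: step_chains_def)
  qed
  have "(\<Sum>S\<in>step_chains m (Suc i) K. \<Prod>r\<in>{1..Suc i}. set_weight r (S (r - 1)) (S r)) =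
      (\<Sum>L | step m (Suc i) L K. \<Sum>S\<in>(\<lambda>S. S(Suc i := K)) ` step_chains m i L. \<Prod>r\<in>{1..Suc i}. set_weight r (S (r - 1)) (S r))"
    unfolding step_chains_Suc
  proof (rule sum.UNION_disjoint)
    show "\<forall>L\<in>{L. step m (Suc i) L K}. \<forall>L'\<in>{L. step m (Suc i) L K}. L \<noteq> L' \<longrightarrow>
        (\<lambda>S. S(Suc i := K)) ` step_chains m i L \<inter> (\<lambda>S. S(Suc i := K)) ` step_chains m i L' = {}"
    proof (intro ballI impI equals0I)
      fix L L' S assume LL: "L \<noteq> L'"
        and S: "S \<in> (\<lambda>S. S(Suc i := K)) ` step_chains m i L \<inter> (\<lambda>S. S(Suc i := K)) ` step_chains m i L'"
      from S obtain T where T: "T \<in> step_chains m i L" "S = T(Suc i := K)" by (elim IntE imageE)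
      from S obtain T' where T': "T' \<in> step_chains m i L'" "S = T'(Suc i := K)" by (elim IntE imageE)
      have "L = L'" by (rule disj[OF T(1) T'(1)]) (simp only: T(2)[symmetric] T'(2)[symmetric])
      with LL show False by simp
    qed
  qed (simp_all add: finite_steps finite_step_chains)
  also have "\<dots> = (\<Sum>L | step m (Suc i) L K. set_weight (Suc i) L K * FF m i (sorted_list_of_set L))"
  proof (rule sum.cong[OF refl])
    fix L assume L: "L \<in> {L. step m (Suc i) L K}"
    have "(\<Sum>S\<in>(\<lambda>S. S(Suc i := K)) ` step_chains m i L. \<Prod>r\<in>{1..Suc i}. set_weight r (S (r - 1)) (S r)) =
      (\<Sum>S\<in>step_chains m i L. \<Prod>r\<in>{1..Suc i}. set_weight r ((S(Suc i := K)) (r - 1)) ((S(Suc i := K)) r))"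
      by (subst sum.reindex[OF inj]) simp
    also have "\<dots> = (\<Sum>S\<in>step_chains m i L. set_weight (Suc i) L K * (\<Prod>r\<in>{1..i}. set_weight r (S (r - 1)) (S r)))"
    proof (rule sum.cong[OF refl])
      fix S assume S: "S \<in> step_chains m i L"
      have "(\<Prod>r\<in>{1..i}. set_weight r ((S(Suc i := K)) (r - 1)) ((S(Suc i := K)) r)) =
          (\<Prod>r\<in>{1..i}. set_weight r (S (r - 1)) (S r))"
        by (rule prod.cong) auto
      moreover have "S i = L" using S by (simp add: step_chains_def)
      ultimately show "(\<Prod>r\<in>{1..Suc i}. set_weight r ((S(Suc i := K)) (r - 1)) ((S(Suc i := K)) r)) =
          set_weight (Suc i) L K * (\<Prod>r\<in>{1..i}. set_weight r (S (r - 1)) (S r))"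
        by (simp add: mult.commute)
    qed
    also have "\<dots> = set_weight (Suc i) L K * FF m i (sorted_list_of_set L)"
      using Suc.IH[of L] L by (simp add: step_def sum_distrib_left)
    finally show "(\<Sum>S\<in>(\<lambda>S. S(Suc i := K)) ` step_chains m i L. \<Prod>r\<in>{1..Suc i}. set_weight r (S (r - 1)) (S r)) =
      set_weight (Suc i) L K * FF m i (sorted_list_of_set L)" .
  qed
  finally show ?case using FF_Suc_sets[OF Suc.prems, of i] by simp
qed

text \<open>The condition \<open>S n \<subseteq> {1..n}\<close> expresses that the central columns
  in the left half have sum 0.\<close>

definition all_chains :: "nat \<Rightarrow> nat \<Rightarrow> (nat \<Rightarrow> nat set) set" where
  "all_chains m n = {S. S 0 = {} \<and> (\<forall>r\<in>{1..n}. step m r (S (r - 1)) (S r)) \<and> S n \<subseteq> {1..n} \<and> (\<forall>r>n. S r = {})}"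

lemma chain_card:
  assumes "S 0 = {}" "\<forall>r\<in>{1..n}. step m r (S (r - 1)) (S r)"
  shows "r \<le> n \<Longrightarrow> card (S r) = r div 2"
proof (induction r)
  case (Suc r)
  then have "step m (Suc r) (S r) (S (Suc r))" using assms(2) by force
  then show ?case using Suc by (auto simp: step_def elim!: evenE oddE)
qed (simp add: assms)

lemma sum_FF_eq_sum_chains:
  assumes n: "n = 2 * N" and m: "n \<le> m"
  shows "(\<Sum>ks\<in>pos_lists n N. FF m n ks) =
    (\<Sum>S\<in>all_chains m n. \<Prod>r\<in>{1..n}. set_weight r (S (r - 1)) (S r))"
proof -
  let ?A = "{K. K \<subseteq> {1..n} \<and> card K = N}"
  have finA: "finite ?A" by (rule finite_subset[of _ "Pow {1..n}"]) auto
  have "(\<Sum>ks\<in>pos_lists n N. FF m n ks) = (\<Sum>K\<in>?A. FF m n (sorted_list_of_set K))"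
  proof (rule sum.reindex_bij_witness[of _ sorted_list_of_set set])
    fix ks assume ks: "ks \<in> pos_lists n N"
    then have d: "distinct ks" "sorted ks" by (auto simp: pos_lists_def strict_sorted_iff)
    then show e: "sorted_list_of_set (set ks) = ks" by (simp add: sorted_list_of_set.idem_if_sorted_distinct)
    show "set ks \<in> ?A" using ks d by (auto simp: pos_lists_def distinct_card)
    show "FF m n (sorted_list_of_set (set ks)) = FF m n ks" unfolding e ..
  next
    fix K assume K: "K \<in> ?A"
    then have "finite K" using finite_subset by auto
    then show "set (sorted_list_of_set K) = K" "sorted_list_of_set K \<in> pos_lists n N"
      using K by (auto simp: pos_lists_def strict_sorted_list_of_set)
  qed
  also have "\<dots> = (\<Sum>K\<in>?A. \<Sum>S\<in>step_chains m n K. \<Prod>r\<in>{1..n}. set_weight r (S (r - 1)) (S r))"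
    using m by (intro sum.cong refl FF_eq_sum_chains) auto
  also have "\<dots> = (\<Sum>S\<in>(\<Union>K\<in>?A. step_chains m n K). \<Prod>r\<in>{1..n}. set_weight r (S (r - 1)) (S r))"
    by (rule sum.UNION_disjoint[symmetric]) (use finA finite_step_chains in \<open>auto simp: step_chains_def\<close>)
  also have "(\<Union>K\<in>?A. step_chains m n K) = all_chains m n"
  proof -
    have "card (S n) = N" if "S \<in> all_chains m n" for S
      using chain_card[of S n m n] that n by (simp add: all_chains_def)
    then show ?thesis by (auto simp: step_chains_def all_chains_def)
  qed
  finally show ?thesis .
qed

section \<open>Alternating sequences\<close>

lemma alternating_partial_sums:
  fixes e :: "nat \<Rightarrow> int"
  assumes e: "\<And>j. e j \<in> {- 1, 0, 1}"
    and alt: "\<And>j j'. 1 \<le> j \<Longrightarrow> j < j' \<Longrightarrow> e j \<noteq> 0 \<Longrightarrow> e j' \<noteq> 0 \<Longrightarrow>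
      (\<And>k. j < k \<Longrightarrow> k < j' \<Longrightarrow> e k = 0) \<Longrightarrow> e j' = - e j"
    and first: "\<And>j. 1 \<le> j \<Longrightarrow> e j \<noteq> 0 \<Longrightarrow> (\<And>k. 1 \<le> k \<Longrightarrow> k < j \<Longrightarrow> e k = 0) \<Longrightarrow> e j = 1"
  shows "(\<Sum>k = 1..j. e k) \<in> {0, 1}"
proof -
  \<comment> \<open>The invariant remembers the last nonzero entry, which alone determines the
    partial sum.\<close>
  have "((\<forall>k\<in>{1..j}. e k = 0) \<and> (\<Sum>k = 1..j. e k) = 0) \<or>
    (\<exists>k\<in>{1..j}. e k \<noteq> 0 \<and> (\<forall>k'. k < k' \<and> k' \<le> j \<longrightarrow> e k' = 0) \<and> (\<Sum>k = 1..j. e k) = (if e k = 1 then 1 else 0))"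
  proof (induction j)
    case (Suc j)
    show ?case
    proof (cases "e (Suc j) = 0")
      case True
      from Suc show ?thesis
      proof
        assume "(\<forall>k\<in>{1..j}. e k = 0) \<and> (\<Sum>k = 1..j. e k) = 0"
        then show ?thesis using True by (auto simp: le_Suc_eq)
      next
        assume "\<exists>k\<in>{1..j}. e k \<noteq> 0 \<and> (\<forall>k'. k < k' \<and> k' \<le> j \<longrightarrow> e k' = 0) \<and> (\<Sum>k = 1..j. e k) = (if e k = 1 then 1 else 0)"
        then obtain k where "k \<in> {1..j}" "e k \<noteq> 0" "\<forall>k'. k < k' \<and> k' \<le> j \<longrightarrow> e k' = 0"
          "(\<Sum>k = 1..j. e k) = (if e k = 1 then 1 else 0)" by blast
        then show ?thesis using True by (intro disjI2 bexI[of _ k]) (auto simp: le_Suc_eq)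
      qed
    next
      case False
      have "(\<Sum>k = 1..Suc j. e k) = (if e (Suc j) = 1 then 1 else 0)"
        using Suc
      proof
        assume a: "(\<forall>k\<in>{1..j}. e k = 0) \<and> (\<Sum>k = 1..j. e k) = 0"
        then have "e (Suc j) = 1" using False by (intro first) auto
        then show ?thesis using a by simp
      next
        assume "\<exists>k\<in>{1..j}. e k \<noteq> 0 \<and> (\<forall>k'. k < k' \<and> k' \<le> j \<longrightarrow> e k' = 0) \<and> (\<Sum>k = 1..j. e k) = (if e k = 1 then 1 else 0)"
        then obtain k where k: "k \<in> {1..j}" "e k \<noteq> 0" "\<forall>k'. k < k' \<and> k' \<le> j \<longrightarrow> e k' = 0"
          "(\<Sum>k = 1..j. e k) = (if e k = 1 then 1 else 0)" by blast
        have "e (Suc j) = - e k" using k False by (intro alt) auto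
        then show ?thesis using k e[of k] by auto
      qed
      then show ?thesis using False by (intro disjI2 bexI[of _ "Suc j"]) auto
    qed
  qed simp
  then show ?thesis by auto
qed

text \<open>Rows are given by their total instead of their first nonzero entry. If that entry were
  \<open>-1\<close>, the negated row would have all partial sums 0 or 1, contrary to its total
  \<open>-1\<close>.\<close>

lemma alternating_partial_sums_total:
  fixes e :: "nat \<Rightarrow> int"
  assumes e: "\<And>j. e j \<in> {- 1, 0, 1}"
    and alt: "\<And>j j'. 1 \<le> j \<Longrightarrow> j < j' \<Longrightarrow> e j \<noteq> 0 \<Longrightarrow> e j' \<noteq> 0 \<Longrightarrow>
      (\<And>k. j < k \<Longrightarrow> k < j' \<Longrightarrow> e k = 0) \<Longrightarrow> e j' = - e j"
    and total: "(\<Sum>k = 1..M. e k) = 1"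
  shows "(\<Sum>k = 1..j. e k) \<in> {0, 1}"
proof (rule alternating_partial_sums[OF e alt])
  fix j assume j: "1 \<le> j" "e j \<noteq> 0" "\<And>k. 1 \<le> k \<Longrightarrow> k < j \<Longrightarrow> e k = 0"
  show "e j = 1"
  proof (rule ccontr)
    assume "e j \<noteq> 1"
    then have ej: "e j = - 1" using e[of j] j(2) by auto
    have "(\<Sum>k = 1..M. - e k) \<in> {0, 1}"
    proof (rule alternating_partial_sums)
      fix i assume i: "1 \<le> i" "- e i \<noteq> 0" "\<And>k. 1 \<le> k \<Longrightarrow> k < i \<Longrightarrow> - e k = 0"
      have "i = j" using i j by (metis linorder_neqE_nat neg_equal_0_iff_equal)
      then show "- e i = 1" using ej by simp
    next
      fix i i' assume "1 \<le> i" "i < i'" "- e i \<noteq> 0" "- e i' \<noteq> 0" "\<And>k. i < k \<Longrightarrow> k < i' \<Longrightarrow> - e k = 0"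
      then have "e i' = - e i" by (intro alt) auto
      then show "- e i' = - (- e i)" by simp
    next
      fix i show "- e i \<in> {- 1, 0, 1}" using e[of i] by auto
    qed
    then show False using total by (simp add: sum_negf)
  qed
qed

lemma partial_sums_alternating:
  fixes e :: "nat \<Rightarrow> int"
  assumes ps: "\<And>j. j \<le> M \<Longrightarrow> (\<Sum>k = 1..j. e k) \<in> {0, 1}"
  shows "1 \<le> j \<Longrightarrow> j \<le> M \<Longrightarrow> e j \<in> {- 1, 0, 1}"
    and "1 \<le> j \<Longrightarrow> j < j' \<Longrightarrow> j' \<le> M \<Longrightarrow> e j \<noteq> 0 \<Longrightarrow> e j' \<noteq> 0 \<Longrightarrow>
      (\<And>k. j < k \<Longrightarrow> k < j' \<Longrightarrow> e k = 0) \<Longrightarrow> e j' = - e j"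
    and "1 \<le> j \<Longrightarrow> j \<le> M \<Longrightarrow> e j \<noteq> 0 \<Longrightarrow> (\<And>k. 1 \<le> k \<Longrightarrow> k < j \<Longrightarrow> e k = 0) \<Longrightarrow> e j = 1"
proof -
  have rec: "(\<Sum>k = 1..j. e k) = (\<Sum>k = 1..j - 1. e k) + e j" if "1 \<le> j" for j
    using that by (cases j) auto
  have s: "(\<Sum>k = 1..j - 1. e k) \<in> {0, 1}" "(\<Sum>k = 1..j. e k) \<in> {0, 1}" if "j \<le> M" for j
    using ps[of "j - 1"] ps[of j] that by auto
  show "e j \<in> {- 1, 0, 1}" if "1 \<le> j" "j \<le> M"
    using rec[OF that(1)] s[OF that(2)] by auto
  show "e j = 1" if "1 \<le> j" "j \<le> M" "e j \<noteq> 0" "\<And>k. 1 \<le> k \<Longrightarrow> k < j \<Longrightarrow> e k = 0"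
  proof -
    have "(\<Sum>k = 1..j - 1. e k) = 0" using that by (intro sum.neutral) auto
    then show ?thesis using rec[OF that(1)] s[OF that(2)] that(3) by auto
  qed
  show "e j' = - e j" if a: "1 \<le> j" "j < j'" "j' \<le> M" "e j \<noteq> 0" "e j' \<noteq> 0" "\<And>k. j < k \<Longrightarrow> k < j' \<Longrightarrow> e k = 0"
  proof -
    have "(\<Sum>k = 1..j' - 1. e k) = (\<Sum>k = 1..j. e k)"
      using a by (intro sum.mono_neutral_right) auto
    then show ?thesis
      using rec[of j] rec[of j'] s[of j] s[of j'] a by auto
  qed
qed

section \<open>Trapezoids as chains of column sets\<close>

text \<open>
  The values outside rows \<open>0, \<dots>, n\<close> are fixed arbitrarily, so that trapezoids and chains correspond
  bijectively.
\<close>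

definition col_state :: "nat \<Rightarrow> nat \<Rightarrow> (nat \<Rightarrow> nat \<Rightarrow> int) \<Rightarrow> nat \<Rightarrow> nat set" where
  "col_state m n a r = (if r \<le> n then {j \<in> {1..m}. (\<Sum>i = 1..r. a i j) = 1} else {})"

definition chain_entry :: "(nat \<Rightarrow> nat set) \<Rightarrow> nat \<Rightarrow> nat \<Rightarrow> int" where
  "chain_entry S i j = of_bool (j \<in> S i) - of_bool (j \<in> S (i - 1))"

definition chain_array :: "nat \<Rightarrow> nat \<Rightarrow> (nat \<Rightarrow> nat set) \<Rightarrow> nat \<Rightarrow> nat \<Rightarrow> int" where
  "chain_array m n S i j =
    (if 1 \<le> i \<and> i \<le> n then
       if 1 \<le> j \<and> j \<le> m then chain_entry S i j
       else if j = Suc m then (if odd i then 1 else - 1)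
       else if Suc m < j \<and> j \<le> 2 * m + 1 then chain_entry S i (2 * m + 2 - j)
       else 0
     else 0)"

lemma sum_of_bool_card:
  fixes A :: "nat set"
  assumes "A \<subseteq> {1..m}"
  shows "(\<Sum>k = 1..j. of_bool (k \<in> A)) = int (card (A \<inter> {..j}))"
proof -
  have "(\<Sum>k = 1..j. of_bool (k \<in> A)) = (\<Sum>k\<in>A \<inter> {..j}. 1 :: int)"
    using assms by (intro sum.mono_neutral_cong_right) auto
  then show ?thesis by simp
qed

text \<open>By symmetry the entries after \<open>j\<close> add up to the partial sum at
  \<open>2 * m + 1 - j\<close>; this carries conditions from the left half of a row to the right
  half.\<close>

lemma reflected_sum:
  fixes e :: "nat \<Rightarrow> int"
  assumes "\<And>k. k \<in> {1..2 * m + 1} \<Longrightarrow> e (2 * m + 2 - k) = e k" "j \<le> 2 * m + 1"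
  shows "(\<Sum>k = 1..j. e k) + (\<Sum>k = 1..2 * m + 1 - j. e k) = (\<Sum>k = 1..2 * m + 1. e k)"
proof -
  have "(\<Sum>k = 1..2 * m + 1 - j. e k) = (\<Sum>k = Suc j..2 * m + 1. e k)"
    by (rule sum.reindex_bij_witness[of _ "\<lambda>k. 2 * m + 2 - k" "\<lambda>k. 2 * m + 2 - k"])
       (use assms in auto)
  moreover have "(\<Sum>k = 1..2 * m + 1. e k) = (\<Sum>k = 1..j. e k) + (\<Sum>k = Suc j..2 * m + 1. e k)"
  proof -
    have "{1..2 * m + 1} = {1..j} \<union> {Suc j..2 * m + 1}" using assms(2) by auto
    then show ?thesis by (simp only:) (rule sum.union_disjoint, auto)
  qed
  ultimately show ?thesis by (simp only:)
qed

section \<open>Trapezoids characterized by partial sums\<close>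

context
  fixes n l m :: nat
  assumes n: "even n" "2 \<le> n" and l: "3 \<le> l" "odd l" and m: "m = n - 1 + (l - 1) div 2"
begin

lemma width: "2 * n + l - 1 = 2 * m + 2" "n \<le> m" "m \<le> n + l - 2" "n + l - 1 + n = 2 * m + 2"
  using n l m by (auto elim!: oddE)

lemma index_iff:
  "(i, j) \<in> trapezoid_index n l \<longleftrightarrow> 1 \<le> i \<and> i \<le> n \<and> i \<le> j \<and> i + j \<le> 2 * m + 2"
  using width by (auto simp: trapezoid_index_def)

lemma column_sum_eq:
  assumes "\<And>i j. (i, j) \<notin> trapezoid_index n l \<Longrightarrow> a i j = 0"
  shows "column_sum n l a j = (\<Sum>i = 1..n. a i j)"
  unfolding column_sum_def
  by (rule sum.mono_neutral_left) (use assms in \<open>auto simp: index_iff\<close>)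

text \<open>Alternation together with a leading 1 is the same as partial sums in
  \<open>{0, 1}\<close>. Because the array vanishes outside the trapezoid, all sums can start at 1
  regardless of its slanted border.\<close>

lemma alternating_sign_trapezoid_iff:
  "alternating_sign_trapezoid n l a \<longleftrightarrow>
    (\<forall>i j. (i, j) \<notin> trapezoid_index n l \<longrightarrow> a i j = 0) \<and>
    (\<forall>i\<in>{1..n}. (\<forall>j. (\<Sum>k = 1..j. a i k) \<in> {0, 1}) \<and> (\<Sum>k = 1..2 * m + 1. a i k) = 1) \<and>
    (\<forall>j r. (\<Sum>i = 1..r. a i j) \<in> {0, 1}) \<and>
    (\<forall>j\<in>{n + 1..n + l - 2}. (\<Sum>i = 1..n. a i j) = 0)" (is "?lhs \<longleftrightarrow> ?rhs")
proof
  assume L: ?lhs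
  have z: "a i j = 0" if "(i, j) \<notin> trapezoid_index n l" for i j
    using L that by (simp add: alternating_sign_trapezoid_def)
  have ent: "a i j \<in> {- 1, 0, 1}" for i j
    using L z[of i j] unfolding alternating_sign_trapezoid_def by (cases "(i, j) \<in> trapezoid_index n l") auto
  have T: "(i, j) \<in> trapezoid_index n l" if "a i j \<noteq> 0" for i j
    using that z by (cases "(i, j) \<in> trapezoid_index n l") simp_all
  note L2 = L[unfolded alternating_sign_trapezoid_def, THEN conjunct2, THEN conjunct2]
  note Lr = L2[THEN conjunct1]
  note Lc = L2[THEN conjunct2, THEN conjunct1]
  note Lf = L2[THEN conjunct2, THEN conjunct2, THEN conjunct1]
  have row_alt: "a i j' = - a i j" if "j < j'" "a i j \<noteq> 0" "a i j' \<noteq> 0" "\<And>k. j < k \<Longrightarrow> k < j' \<Longrightarrow> a i k = 0" for i j j'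
    using Lr[rule_format, of i j j'] T[OF that(2)] T[OF that(3)] that by simp
  have col_alt: "a i' j = - a i j" if "i < i'" "a i j \<noteq> 0" "a i' j \<noteq> 0" "\<And>k. i < k \<Longrightarrow> k < i' \<Longrightarrow> a k j = 0" for i i' j
    using Lc[rule_format, of i j i'] T[OF that(2)] T[OF that(3)] that by simp
  have col_first: "a i j = 1" if "a i j \<noteq> 0" "\<And>k. 1 \<le> k \<Longrightarrow> k < i \<Longrightarrow> a k j = 0" for i j
    using Lf[rule_format, of i j] T[OF that(1)] that by (simp add: index_iff)
  have total: "(\<Sum>k = 1..2 * m + 1. a i k) = 1" if i: "i \<in> {1..n}" for i
  proof -
    have "(\<Sum>k = 1..2 * m + 1. a i k) = (\<Sum>k = i..2 * n + l - 1 - i. a i k)"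
      by (rule sum.mono_neutral_right) (use i width in \<open>auto intro!: z simp: index_iff\<close>)
    then show ?thesis using L i by (simp add: alternating_sign_trapezoid_def)
  qed
  have rows: "(\<Sum>k = 1..j. a i k) \<in> {0, 1}" if i: "i \<in> {1..n}" for i j
    by (rule alternating_partial_sums_total[OF ent _ total[OF i]]) (use row_alt in auto)
  have cols: "(\<Sum>i = 1..r. a i j) \<in> {0, 1}" for r j
    by (rule alternating_partial_sums[OF ent]) (use col_alt col_first in auto)
  have "(\<Sum>i = 1..n. a i j) = 0" if "j \<in> {n + 1..n + l - 2}" for j
    using L that column_sum_eq[of a j, OF z] by (simp add: alternating_sign_trapezoid_def)
  then show ?rhs using z rows total cols by blast
next
  assume R: ?rhs
  then have z: "a i j = 0" if "(i, j) \<notin> trapezoid_index n l" for i j using that by blast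
  have rows: "(\<Sum>k = 1..j. a i k) \<in> {0, 1}" "(\<Sum>k = 1..2 * m + 1. a i k) = 1" if i: "i \<in> {1..n}" for i j
    using R i by blast+
  have cols: "(\<Sum>i = 1..r. a i j) \<in> {0, 1}" for r j using R by blast
  have csum: "column_sum n l a j = (\<Sum>i = 1..n. a i j)" for j by (rule column_sum_eq[of a j, OF z])
  show ?lhs
    unfolding alternating_sign_trapezoid_def
  proof (intro conjI allI impI ballI)
    fix i j assume "(i, j) \<in> trapezoid_index n l"
    then show "a i j \<in> {- 1, 0, 1}"
      using partial_sums_alternating(1)[of j "a i" j] rows(1)[of i] by (auto simp: index_iff)
  next
    fix i j assume "(i, j) \<notin> trapezoid_index n l"
    then show "a i j = 0" by (rule z)
  next
    fix i j j' assume A: "(i, j) \<in> trapezoid_index n l \<and> (i, j') \<in> trapezoid_index n l \<and> j < j' \<and>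
        a i j \<noteq> 0 \<and> a i j' \<noteq> 0 \<and> (\<forall>k. j < k \<and> k < j' \<longrightarrow> a i k = 0)"
    show "a i j' = - a i j"
      by (rule partial_sums_alternating(2)[of j']) (use A rows(1)[of i] in \<open>auto simp: index_iff\<close>)
  next
    fix i i' j assume A: "(i, j) \<in> trapezoid_index n l \<and> (i', j) \<in> trapezoid_index n l \<and> i < i' \<and>
        a i j \<noteq> 0 \<and> a i' j \<noteq> 0 \<and> (\<forall>k. i < k \<and> k < i' \<longrightarrow> a k j = 0)"
    show "a i' j = - a i j"
      by (rule partial_sums_alternating(2)[of i' "\<lambda>i. a i j"]) (use A cols in \<open>auto simp: index_iff\<close>)
  next
    fix i j assume A: "(i, j) \<in> trapezoid_index n l \<and> a i j \<noteq> 0 \<and>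
        (\<forall>k. (k, j) \<in> trapezoid_index n l \<and> k < i \<longrightarrow> a k j = 0)"
    have "a k j = 0" if "k < i" for k using A z[of k j] that by blast
    then show "a i j = 1"
      using A cols by (intro partial_sums_alternating(3)[of i "\<lambda>i. a i j"]) (auto simp: index_iff)
  next
    fix i assume i: "i \<in> {1..n}"
    have "(\<Sum>k = 1..2 * m + 1. a i k) = (\<Sum>k = i..2 * n + l - 1 - i. a i k)"
      by (rule sum.mono_neutral_right) (use i width in \<open>auto intro!: z simp: index_iff\<close>)
    then show "(\<Sum>k = i..2 * n + l - 1 - i. a i k) = 1" using rows(2)[OF i] by simp
  next
    fix j assume "j \<in> {n + 1..n + l - 2}"
    then show "column_sum n l a j = 0" using R csum by simp
  qed
qed

lemma vs_trapezoidsD: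
  assumes a: "a \<in> vs_trapezoids n l"
  shows "\<And>i j. (i, j) \<notin> trapezoid_index n l \<Longrightarrow> a i j = 0"
    and "\<And>i j. i \<in> {1..n} \<Longrightarrow> (\<Sum>k = 1..j. a i k) \<in> {0, 1}"
    and "\<And>i. i \<in> {1..n} \<Longrightarrow> (\<Sum>k = 1..2 * m + 1. a i k) = 1"
    and "\<And>j r. (\<Sum>i = 1..r. a i j) \<in> {0, 1}"
    and "\<And>j. j \<in> {n + 1..n + l - 2} \<Longrightarrow> (\<Sum>i = 1..n. a i j) = 0"
    and "\<And>i j. j \<le> 2 * m + 2 \<Longrightarrow> a i (2 * m + 2 - j) = a i j"
proof -
  have R: "alternating_sign_trapezoid n l a" "vertically_symmetric n l a"
    using a by (simp_all add: vs_trapezoids_def)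
  note R1 = R(1)[unfolded alternating_sign_trapezoid_iff]
  show z: "a i j = 0" if "(i, j) \<notin> trapezoid_index n l" for i j using R1 that by blast
  show "(\<Sum>k = 1..j. a i k) \<in> {0, 1}" if "i \<in> {1..n}" for i j using R1 that by blast
  show "(\<Sum>k = 1..2 * m + 1. a i k) = 1" if "i \<in> {1..n}" for i using R1 that by blast
  show "(\<Sum>i = 1..r. a i j) \<in> {0, 1}" for j r using R1 by blast
  show "(\<Sum>i = 1..n. a i j) = 0" if "j \<in> {n + 1..n + l - 2}" for j using R1 that by blast
  show "a i (2 * m + 2 - j) = a i j" if j: "j \<le> 2 * m + 2" for i j
  proof (cases "(i, j) \<in> trapezoid_index n l")
    case True
    then show ?thesis using R(2) width(1) unfolding vertically_symmetric_def by fastforce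
  next
    case False
    then have "(i, 2 * m + 2 - j) \<notin> trapezoid_index n l" using j by (auto simp: index_iff)
    then show ?thesis using z False by simp
  qed
qed

lemma vs_center:
  assumes a: "a \<in> vs_trapezoids n l" and r: "r \<in> {1..n}"
  shows "a r (Suc m) = (if odd r then 1 else - 1)" "(\<Sum>k = 1..m. a r k) = (if even r then 1 else 0)"
proof -
  have tot: "2 * (\<Sum>k = 1..m. a r k) + a r (Suc m) = 1" if "r \<in> {1..n}" for r
  proof -
    have "(\<Sum>k = 1..m. a r k) + (\<Sum>k = 1..2 * m + 1 - m. a r k) = (\<Sum>k = 1..2 * m + 1. a r k)"
      by (rule reflected_sum) (use vs_trapezoidsD(6)[OF a] in auto)
    moreover have "2 * m + 1 - m = Suc m" by simp
    ultimately show ?thesis using vs_trapezoidsD(3)[OF a that] by simp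
  qed
  \<comment> \<open>The row sum 1 is twice the left half plus the central entry, so the latter is
    odd and the central column has no zeros.\<close>
  have odd: "a r (Suc m) \<noteq> 0" if "r \<in> {1..n}" for r
  proof
    assume "a r (Suc m) = 0"
    then have "2 * (\<Sum>k = 1..m. a r k) = 1" using tot[OF that] by simp
    then show False by presburger
  qed
  have cs: "(\<Sum>i = 1..r. a i (Suc m)) = (if odd r then 1 else 0)" if "r \<le> n" for r
    using that
  proof (induction r)
    case (Suc r)
    have "a (Suc r) (Suc m) \<noteq> 0" using odd[of "Suc r"] Suc.prems by simp
    moreover have "(\<Sum>i = 1..Suc r. a i (Suc m)) \<in> {0, 1}" by (rule vs_trapezoidsD(4)[OF a])
    ultimately show ?case using Suc by (auto split: if_splits)
  qed simp
  have "(\<Sum>i = 1..r. a i (Suc m)) = (\<Sum>i = 1..r - 1. a i (Suc m)) + a r (Suc m)"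
    using r by (cases r) auto
  then show c: "a r (Suc m) = (if odd r then 1 else - 1)"
    using cs[of r] cs[of "r - 1"] r by (cases r) auto
  show "(\<Sum>k = 1..m. a r k) = (if even r then 1 else 0)"
    using tot[OF r] c by (auto split: if_splits)
qed

section \<open>The bijection between trapezoids and chains\<close>

lemma col_state_entry:
  assumes a: "a \<in> vs_trapezoids n l" and i: "i \<in> {1..n}" and j: "j \<in> {1..m}"
  shows "a i j = chain_entry (col_state m n a) i j"
proof -
  have s: "of_bool (j \<in> col_state m n a r) = (\<Sum>i = 1..r. a i j)" if "r \<le> n" for r
    using vs_trapezoidsD(4)[OF a, of j r] that j by (auto simp: col_state_def)
  have "(\<Sum>i = 1..i. a i j) = (\<Sum>i = 1..i - 1. a i j) + a i j"
    using i by (cases i) auto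
  moreover have "i \<le> n" "i - 1 \<le> n" using i by auto
  ultimately show ?thesis unfolding chain_entry_def s[OF \<open>i \<le> n\<close>] s[OF \<open>i - 1 \<le> n\<close>] by simp
qed

lemma chain_array_col_state:
  assumes a: "a \<in> vs_trapezoids n l"
  shows "chain_array m n (col_state m n a) = a"
proof (intro ext)
  fix i j
  show "chain_array m n (col_state m n a) i j = a i j"
  proof (cases "1 \<le> i \<and> i \<le> n")
    case False
    then have "a i j = 0" by (intro vs_trapezoidsD(1)[OF a]) (auto simp: index_iff)
    then show ?thesis using False by (auto simp: chain_array_def)
  next
    case True
    then have i: "i \<in> {1..n}" by simp
    consider "1 \<le> j \<and> j \<le> m" | "j = Suc m" | "Suc m < j \<and> j \<le> 2 * m + 1" | "j = 0 \<or> 2 * m + 1 < j"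
      by linarith
    then show ?thesis
    proof cases
      case 1
      then show ?thesis using True col_state_entry[OF a i, of j] by (simp add: chain_array_def)
    next
      case 2
      then show ?thesis using True vs_center(1)[OF a i] by (simp add: chain_array_def)
    next
      case 3
      then have "a i j = a i (2 * m + 2 - j)" using vs_trapezoidsD(6)[OF a, of j i] by simp
      also have "\<dots> = chain_entry (col_state m n a) i (2 * m + 2 - j)"
        using 3 by (intro col_state_entry[OF a i]) auto
      finally show ?thesis using True 3 by (simp add: chain_array_def)
    next
      case 4
      then have "a i j = 0" using True by (intro vs_trapezoidsD(1)[OF a]) (auto simp: index_iff)
      then show ?thesis using True 4 by (auto simp: chain_array_def)
    qed
  qed
qed

lemma col_state_chain:
  assumes a: "a \<in> vs_trapezoids n l"
  shows "col_state m n a \<in> all_chains m n"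
proof -
  let ?S = "col_state m n a"
  have sub: "?S r \<subseteq> {1..m}" for r by (auto simp: col_state_def)
  have "step m r (?S (r - 1)) (?S r)" if r: "r \<in> {1..n}" for r
  proof -
    have diff: "int (card (?S r \<inter> {..j})) - int (card (?S (r - 1) \<inter> {..j})) = (\<Sum>k = 1..j. a r k)" if "j \<le> m" for j
    proof -
      have "(\<Sum>k = 1..j. a r k) = (\<Sum>k = 1..j. of_bool (k \<in> ?S r) - of_bool (k \<in> ?S (r - 1)))"
        using that col_state_entry[OF a r] by (intro sum.cong) (auto simp: chain_entry_def)
      then show ?thesis unfolding sum_subtractf sum_of_bool_card[OF sub] by simp
    qed
    have all: "?S r \<inter> {..j} = ?S r \<inter> {..min j m}" for r j using sub[of r] by auto
    have full: "?S r \<inter> {..m} = ?S r" for r using sub[of r] by auto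
    have "(j \<in> ?S (r - 1)) = (j \<in> ?S r)" if "j < r" for j
    proof (cases "j \<in> {1..m}")
      case True
      have "a r j = 0" using that by (intro vs_trapezoidsD(1)[OF a]) (auto simp: index_iff)
      then show ?thesis using col_state_entry[OF a r True] by (auto simp: chain_entry_def of_bool_def split: if_splits)
    next
      case False
      then show ?thesis using sub by blast
    qed
    moreover have "card (?S (r - 1) \<inter> {..j}) \<le> card (?S r \<inter> {..j}) \<and>
        card (?S r \<inter> {..j}) \<le> card (?S (r - 1) \<inter> {..j}) + 1" for j
      using diff[of "min j m"] vs_trapezoidsD(2)[OF a r, of "min j m"] unfolding all[of _ j] by auto
    moreover have "card (?S r) = card (?S (r - 1)) + (if even r then 1 else 0)"
      using diff[of m] vs_center(2)[OF a r] unfolding full by (auto split: if_splits)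
    ultimately show ?thesis using sub by (simp add: step_def)
  qed
  moreover have "?S n \<subseteq> {1..n}"
  proof
    fix j assume j: "j \<in> ?S n"
    then have jm: "j \<in> {1..m}" "(\<Sum>i = 1..n. a i j) = 1" by (auto simp: col_state_def)
    have "j \<le> n"
    proof (rule ccontr)
      assume "\<not> j \<le> n"
      then have "(\<Sum>i = 1..n. a i j) = 0" using jm width by (intro vs_trapezoidsD(5)[OF a]) auto
      with jm show False by simp
    qed
    then show "j \<in> {1..n}" using jm by simp
  qed
  moreover have "?S 0 = {}" "\<And>r. r > n \<Longrightarrow> ?S r = {}" by (auto simp: col_state_def)
  ultimately show ?thesis by (simp add: all_chains_def)
qed

lemma chain_col_sum:
  assumes S: "S \<in> all_chains m n" and j: "j \<in> {1..m}"
  shows "r \<le> n \<Longrightarrow> (\<Sum>i = 1..r. chain_array m n S i j) = of_bool (j \<in> S r)"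
proof (induction r)
  case 0
  then show ?case using S by (simp add: all_chains_def)
next
  case (Suc r)
  then show ?case using j by (simp add: chain_array_def chain_entry_def)
qed

lemma col_state_chain_array:
  assumes S: "S \<in> all_chains m n"
  shows "col_state m n (chain_array m n S) = S"
proof
  fix r
  show "col_state m n (chain_array m n S) r = S r"
  proof (cases "r \<le> n")
    case True
    have "S r \<subseteq> {1..m}"
    proof (cases r)
      case (Suc r')
      then have "r \<in> {1..n}" using True by simp
      then have "step m r (S (r - 1)) (S r)" using S unfolding all_chains_def by blast
      then show ?thesis by (simp add: step_def)
    qed (use S in \<open>simp add: all_chains_def\<close>)
    then show ?thesis using True chain_col_sum[OF S _ True] by (auto simp: col_state_def)
  next
    case False
    then show ?thesis using S by (simp add: col_state_def all_chains_def)
  qed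
qed

lemma chain_array_zero:
  assumes S: "S \<in> all_chains m n" and ij: "(i, j) \<notin> trapezoid_index n l"
  shows "chain_array m n S i j = 0"
proof (cases "1 \<le> i \<and> i \<le> n")
  case True
  then have st: "step m i (S (i - 1)) (S i)" using S by (auto simp: all_chains_def)
  have z: "chain_entry S i k = 0" if "k < i" for k
    using st that by (auto simp: step_def chain_entry_def)
  show ?thesis
    using ij True width(2) z by (auto simp: chain_array_def index_iff)
qed (auto simp: chain_array_def)

lemma chain_array_reflect:
  "j \<le> 2 * m + 2 \<Longrightarrow> chain_array m n S i (2 * m + 2 - j) = chain_array m n S i j"
proof -
  assume j: "j \<le> 2 * m + 2"
  consider "j = 0" | "1 \<le> j \<and> j \<le> m" | "j = Suc m" | "Suc m < j \<and> j \<le> 2 * m + 1" | "j = 2 * m + 2"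
    using j by linarith
  then show ?thesis by cases (auto simp: chain_array_def)
qed

lemma chain_array_vs:
  assumes S: "S \<in> all_chains m n"
  shows "chain_array m n S \<in> vs_trapezoids n l"
proof -
  let ?a = "chain_array m n S"
  have st: "step m i (S (i - 1)) (S i)" if "i \<in> {1..n}" for i
    using S that by (simp add: all_chains_def)
  have left: "(\<Sum>k = 1..j. ?a i k) = int (card (S i \<inter> {..j})) - int (card (S (i - 1) \<inter> {..j}))"
    if i: "i \<in> {1..n}" and j: "j \<le> m" for i j
  proof -
    have sub: "S i \<subseteq> {1..m}" "S (i - 1) \<subseteq> {1..m}" using st[OF i] by (auto simp: step_def)
    have "(\<Sum>k = 1..j. ?a i k) = (\<Sum>k = 1..j. of_bool (k \<in> S i) - of_bool (k \<in> S (i - 1)))"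
      using i j by (intro sum.cong) (auto simp: chain_array_def chain_entry_def)
    then show ?thesis unfolding sum_subtractf sum_of_bool_card[OF sub(1)] sum_of_bool_card[OF sub(2)] .
  qed
  have refl: "(\<Sum>k = 1..j. ?a i k) + (\<Sum>k = 1..2 * m + 1 - j. ?a i k) = (\<Sum>k = 1..2 * m + 1. ?a i k)"
    if "j \<le> 2 * m + 1" for i j
    by (rule reflected_sum) (use that chain_array_reflect in auto)
  have total: "(\<Sum>k = 1..2 * m + 1. ?a i k) = 1" if i: "i \<in> {1..n}" for i
  proof -
    have "S i \<inter> {..m} = S i" "S (i - 1) \<inter> {..m} = S (i - 1)" using st[OF i] by (auto simp: step_def)
    then have t: "(\<Sum>k = 1..m. ?a i k) = (if even i then 1 else 0)"
      using left[OF i, of m] st[OF i] by (simp add: step_def)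
    have "2 * m + 1 - m = Suc m" by simp
    then have "(\<Sum>k = 1..2 * m + 1. ?a i k) = (\<Sum>k = 1..m. ?a i k) + ((\<Sum>k = 1..m. ?a i k) + ?a i (Suc m))"
      using refl[of m i] by simp
    then show ?thesis using t i by (auto simp: chain_array_def)
  qed
  have rows: "(\<Sum>k = 1..j. ?a i k) \<in> {0, 1}" if i: "i \<in> {1..n}" for i j
  proof -
    have lo: "(\<Sum>k = 1..j. ?a i k) \<in> {0, 1}" if "j \<le> m" for j
    proof -
      have "card (S (i - 1) \<inter> {..j}) \<le> card (S i \<inter> {..j}) \<and> card (S i \<inter> {..j}) \<le> card (S (i - 1) \<inter> {..j}) + 1"
        using st[OF i] by (simp add: step_def)
      then show ?thesis unfolding left[OF i that] by auto
    qed
    consider "j \<le> m" | "m < j \<and> j \<le> 2 * m + 1" | "2 * m + 1 < j" by linarith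
    then show ?thesis
    proof cases
      case 1
      then show ?thesis by (rule lo)
    next
      case 2
      then show ?thesis using refl[of j i] total[OF i] lo[of "2 * m + 1 - j"] by auto
    next
      case 3
      have "(\<Sum>k = 1..j. ?a i k) = (\<Sum>k = 1..2 * m + 1. ?a i k)"
        using 3 by (intro sum.mono_neutral_right) (auto simp: chain_array_def)
      then show ?thesis using total[OF i] by simp
    qed
  qed
  have center: "(\<Sum>i = 1..r. ?a i (Suc m)) = (if odd r then 1 else 0)" if "r \<le> n" for r
    using that by (induction r) (auto simp: chain_array_def)
  have colsn: "(\<Sum>i = 1..r. ?a i j) \<in> {0, 1}" if r: "r \<le> n" for r j
  proof -
    consider "j \<in> {1..m}" | "j = Suc m" | "Suc m < j \<and> j \<le> 2 * m + 1" | "j = 0 \<or> 2 * m + 1 < j"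
      by force
    then show ?thesis
    proof cases
      case 1
      then show ?thesis using chain_col_sum[OF S 1 r] by simp
    next
      case 2
      then show ?thesis using center[OF r] by simp
    next
      case 3
      then have "(\<Sum>i = 1..r. ?a i j) = (\<Sum>i = 1..r. ?a i (2 * m + 2 - j))"
        using chain_array_reflect[of j] by (intro sum.cong) auto
      moreover have "2 * m + 2 - j \<in> {1..m}" using 3 by auto
      ultimately show ?thesis using chain_col_sum[OF S _ r, of "2 * m + 2 - j"] by simp
    next
      case 4
      then have "?a i j = 0" for i by (auto simp: chain_array_def)
      then show ?thesis by simp
    qed
  qed
  have cols: "(\<Sum>i = 1..r. ?a i j) \<in> {0, 1}" for r j
  proof (cases "r \<le> n")
    case False
    then have "(\<Sum>i = 1..r. ?a i j) = (\<Sum>i = 1..n. ?a i j)"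
      by (intro sum.mono_neutral_right) (auto simp: chain_array_def)
    then show ?thesis using colsn[of n j] by simp
  qed (rule colsn)
  have central: "(\<Sum>i = 1..n. ?a i j) = 0" if j: "j \<in> {n + 1..n + l - 2}" for j
  proof -
    have Sn: "k \<notin> S n" if "k > n" for k using S that by (auto simp: all_chains_def)
    consider "j \<le> m" | "j = Suc m" | "Suc m < j" by linarith
    then show ?thesis
    proof cases
      case 1
      then show ?thesis using chain_col_sum[OF S, of j n] j Sn by simp
    next
      case 2
      \<comment> \<open>The central column alternates in every row, so its sum is 0 because
        \<open>n\<close> is even.\<close>
      then show ?thesis using center[of n] n by simp
    next
      case 3
      have j': "2 * m + 2 - j > n" "2 * m + 2 - j \<in> {1..m}" "j \<le> 2 * m + 2" using j 3 width by auto
      have "(\<Sum>i = 1..n. ?a i j) = (\<Sum>i = 1..n. ?a i (2 * m + 2 - j))"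
        using chain_array_reflect[of j] j'(3) by (intro sum.cong) auto
      then show ?thesis using chain_col_sum[OF S j'(2), of n] Sn j'(1) by simp
    qed
  qed
  have "alternating_sign_trapezoid n l ?a"
    unfolding alternating_sign_trapezoid_iff
    using chain_array_zero[OF S] rows total cols central by blast
  moreover have "vertically_symmetric n l ?a"
    unfolding vertically_symmetric_def width(1)
  proof safe
    fix i j assume "(i, j) \<in> trapezoid_index n l"
    then have "j \<le> 2 * m + 2" by (simp add: index_iff)
    then show "?a i j = ?a i (2 * m + 2 - j)" by (rule chain_array_reflect[symmetric])
  qed
  ultimately show ?thesis by (simp add: vs_trapezoids_def)
qed

section \<open>The weight of a chain\<close>

lemma chain_frozen:
  assumes S: "S \<in> all_chains m n" and j: "1 \<le> j" "j \<le> r" "r \<le> n"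
  shows "j \<in> S r \<longleftrightarrow> j \<in> S j"
  using j(2,3)
proof (induction r rule: dec_induct)
  case (step r)
  then have "step m (Suc r) (S r) (S (Suc r))" using S by (force simp: all_chains_def)
  then show ?case using step by (simp add: step_def)
qed simp

text \<open>The even row \<open>n\<close> adds one position; smaller columns are frozen and larger
  ones are excluded from \<open>S n\<close>, so the new position can only be \<open>n\<close>. Hence
  the factor of row \<open>n\<close> contributes no \<open>P\<close>, in accordance with a
  \<open>P\<close>-weight that stops at column \<open>n - 1\<close>.\<close>

lemma last_not_10:
  assumes S: "S \<in> all_chains m n"
  shows "\<not> (n \<in> S (n - 1) \<and> n \<in> S n)"
proof
  assume nn: "n \<in> S (n - 1) \<and> n \<in> S n"
  have st: "step m n (S (n - 1)) (S n)" using S n by (simp add: all_chains_def)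
  have sub: "S n \<subseteq> {1..n}" using S by (simp add: all_chains_def)
  have "S n \<subseteq> S (n - 1)"
  proof
    fix j assume "j \<in> S n"
    then show "j \<in> S (n - 1)" using sub st nn by (cases "j = n") (auto simp: step_def)
  qed
  moreover have "finite (S (n - 1))" using st finite_subset by (auto simp: step_def)
  ultimately have "card (S n) \<le> card (S (n - 1))" by (intro card_mono)
  then show False using st n by (simp add: step_def)
qed

lemma chain_weight:
  assumes S: "S \<in> all_chains m n"
  shows "P_weight n l (chain_array m n S) * Q_weight n l (chain_array m n S) =
    (\<Prod>r\<in>{1..n}. set_weight r (S (r - 1)) (S r))"
proof -
  let ?a = "chain_array m n S"
  have st: "step m i (S (i - 1)) (S i)" if "i \<in> {1..n}" for i
    using S that by (simp add: all_chains_def)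
  \<comment> \<open>An entry \<open>-1\<close> in row \<open>r\<close> is a column that leaves the
    set in that row.\<close>
  have Q: "{(i, j) \<in> trapezoid_index n l. j \<le> n - 1 + (l - 1) div 2 \<and> ?a i j = - 1} =
      (SIGMA r:{1..n}. S (r - 1) - S r)"
  proof (intro set_eqI iffI)
    fix p assume "p \<in> {(i, j) \<in> trapezoid_index n l. j \<le> n - 1 + (l - 1) div 2 \<and> ?a i j = - 1}"
    then obtain i j where p: "p = (i, j)" "1 \<le> i" "i \<le> n" "i \<le> j" "j \<le> m" "?a i j = - 1"
      using m by (auto simp: index_iff)
    then have "chain_entry S i j = - 1" by (simp add: chain_array_def)
    then show "p \<in> (SIGMA r:{1..n}. S (r - 1) - S r)" using p by (auto simp: chain_entry_def of_bool_def split: if_splits)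
  next
    fix p assume "p \<in> (SIGMA r:{1..n}. S (r - 1) - S r)"
    then obtain i j where p: "p = (i, j)" "i \<in> {1..n}" "j \<in> S (i - 1)" "j \<notin> S i" by auto
    have j: "j \<in> {1..m}" using st[OF p(2)] p(3) by (auto simp: step_def)
    have a: "?a i j = - 1" using p j by (simp add: chain_array_def chain_entry_def)
    then have "(i, j) \<in> trapezoid_index n l" using chain_array_zero[OF S, of i j] by force
    then show "p \<in> {(i, j) \<in> trapezoid_index n l. j \<le> n - 1 + (l - 1) div 2 \<and> ?a i j = - 1}"
      using p a j m by simp
  qed
  have fin: "finite (S (r - 1) - S r)" if "r \<in> {1..n}" for r
    using st[OF that] finite_subset by (auto simp: step_def)
  have Qw: "Q_weight n l ?a = (\<Prod>r\<in>{1..n}. indet_Q ^ card (S (r - 1) - S r))"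
    unfolding Q_weight_def Q using fin by (subst card_SigmaI) (auto simp: power_sum)
  have P: "{j \<in> {1..n - 1}. is_10_column n l ?a j} = {r \<in> {1..n}. r \<in> S (r - 1) \<and> r \<in> S r}"
  proof (intro set_eqI iffI)
    \<comment> \<open>Column \<open>j\<close> ends in row \<open>j\<close>, so membership in
      \<open>S j\<close> decides its sum, and the bottom entry 0 means that \<open>j\<close> was
      already present one row earlier.\<close>
    have key: "is_10_column n l ?a j \<longleftrightarrow> j \<in> S (j - 1) \<and> j \<in> S j" if j: "j \<in> {1..n - 1}" for j
    proof -
      have jm: "j \<in> {1..m}" using j width by auto
      have "column_sum n l ?a j = of_bool (j \<in> S n)"
        using column_sum_eq[of ?a j, OF chain_array_zero[OF S]] chain_col_sum[OF S jm, of n] by simp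
      moreover have "bottom_row n l j = j"
        unfolding bottom_row_def by (rule Max_eqI) (use j width in \<open>auto simp: index_iff intro: finite_subset[of _ "{..n}"]\<close>)
      moreover have "?a j j = chain_entry S j j" using j jm by (auto simp: chain_array_def)
      moreover have "j \<in> S n \<longleftrightarrow> j \<in> S j" using j by (intro chain_frozen[OF S]) auto
      ultimately show ?thesis
        by (auto simp: is_10_column_def is_1_column_def chain_entry_def)
    qed
    fix j
    show "j \<in> {r \<in> {1..n}. r \<in> S (r - 1) \<and> r \<in> S r}" if "j \<in> {j \<in> {1..n - 1}. is_10_column n l ?a j}"
      using that key[of j] by auto
    show "j \<in> {j \<in> {1..n - 1}. is_10_column n l ?a j}" if a: "j \<in> {r \<in> {1..n}. r \<in> S (r - 1) \<and> r \<in> S r}"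
    proof -
      have "j \<noteq> n" using a last_not_10[OF S] by auto
      then have "j \<in> {1..n - 1}" using a by auto
      then show ?thesis using a key[of j] by simp
    qed
  qed
  have Pw: "P_weight n l ?a = (\<Prod>r\<in>{1..n}. if r \<in> S (r - 1) \<and> r \<in> S r then indet_P else 1)"
    unfolding P_weight_def P by (simp add: prod.If_cases Int_def)
  show ?thesis unfolding Pw Qw set_weight_def prod.distrib[symmetric] by (simp only: mult.commute)
qed

lemma sum_vs_trapezoids:
  "(\<Sum>a\<in>vs_trapezoids n l. P_weight n l a * Q_weight n l a) =
    (\<Sum>S\<in>all_chains m n. \<Prod>r\<in>{1..n}. set_weight r (S (r - 1)) (S r))"
proof (rule sum.reindex_bij_witness[of _ "chain_array m n" "col_state m n"])
  fix a assume a: "a \<in> vs_trapezoids n l"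
  show "chain_array m n (col_state m n a) = a" by (rule chain_array_col_state[OF a])
  show "col_state m n a \<in> all_chains m n" by (rule col_state_chain[OF a])
  then show "(\<Prod>r\<in>{1..n}. set_weight r (col_state m n a (r - 1)) (col_state m n a r)) =
      P_weight n l a * Q_weight n l a"
    using chain_weight[of "col_state m n a"] chain_array_col_state[OF a] by simp
next
  fix S assume S: "S \<in> all_chains m n"
  show "col_state m n (chain_array m n S) = S" by (rule col_state_chain_array[OF S])
  show "chain_array m n S \<in> vs_trapezoids n l" by (rule chain_array_vs[OF S])
qed

end

theorem theorem4p3:
  fixes n l N :: nat
  assumes "n \<ge> 2" and "even n" and "l \<ge> 3" and "odd l" and "N = n div 2"
  shows "(\<Sum>a\<in>vs_trapezoids n l. P_weight n l a * Q_weight n l a) =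
         constant_term (vs_series n l N)"
proof -
  define m where "m = n - 1 + (l - 1) div 2"
  have N: "n = 2 * N" "N \<ge> 1" using assms by auto
  have "n \<le> m" using width(2)[OF assms(2,1,3,4) m_def] .
  then show ?thesis
    using sum_vs_trapezoids[OF assms(2,1,3,4) m_def] sum_FF_eq_sum_chains[OF N(1)]
      sum_FF_eq_constant_term[OF N assms(3,4) m_def] by simp
qed

end
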